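(* Let $\mathbf f=(f_1,\ldots,f_L):[0,1]^2\to\mathbb R^L$ be linearly independent with $\mathbf f\in\mathcal C$. For $p,q\in[L]$ and $\boldsymbol\theta\in\mathbb R^L$ let $$\Sigma_{pq}(\boldsymbol\theta)=\int_{[0,1]^6}\frac{g_p(\mathbf z_1,\mathbf z_2)\,g_q(\mathbf z_1,\mathbf z_3)}{(1+e^{\boldsymbol\theta^\top\mathbf g(\mathbf z_1,\mathbf z_2)})(1+e^{\boldsymbol\theta^\top\mathbf g(\mathbf z_1,\mathbf z_3)})}\prod_{a=1}^3d\mu_{\boldsymbol\theta}(\mathbf z_a),$$ $$A_{pq}(\boldsymbol\theta)=\frac12\int_{[0,1]^4}\frac{g_p(\mathbf z_1,\mathbf z_2)\,g_q(\mathbf z_1,\mathbf z_2)\,e^{\boldsymbol\theta^\top\mathbf g(\mathbf z_1,\mathbf z_2)}}{(1+e^{\boldsymbol\theta^\top\mathbf g(\mathbf z_1,\mathbf z_2)})^2}\prod_{a=1}^2d\mu_{\boldsymbol\theta}(\mathbf z_a),\qquad \Gamma_{pq}=\int_{[0,1]^2}f_p(x,y)f_q(x,y)\,dx\,dy.$$ Then $$A(\mathbf 0)^{-1}\Sigma(\mathbf 0)A(\mathbf 0)^{-1}=\Gamma^{-1}.$$ Consequently, if the true parameter is $\boldsymbol\theta_0=\mathbf 0$ (i.e. $\pi\sim\mathbb P_{n,\mathbf 0}$), then $\hat{\boldsymbol\theta}_{PL}$ and $\hat{\boldsymbol\theta}_{ML}$ have the same asymptotic distribution, i.e. $\sqrt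 n\,\hat{\boldsymbol\theta}_{PL}$ and $\sqrt n\,\hat{\boldsymbol\theta}_{ML}$ have the same limit in distribution as $n\to\infty$.
   Context: $[n]=\{1,\ldots,n\}$ and $S_n$ is the set of permutations of $[n]$. Class $\mathcal C$: the set of continuous $F:[0,1]^2\to\mathbb R$, not almost everywhere $0$, such that $\int_0^1F(x,z)\,dz=0$ for all $x$ and $\int_0^1F(z,y)\,dz=0$ for all $y$. For a vector function, $\mathbf f\in\mathcal C$ means $f_r\in\mathcal C$ for every $r\in[L]$. $\mathbf f$ is linearly independent if there is no nonzero $\mathbf d\in\mathbb R^L$ with $\mathbf d^\top\mathbf f=0$ Lebesgue-a.e. on $[0,1]^2$. Model: $\mathbb P_{n,\boldsymbol\theta}(\pi)=\exp(\boldsymbol\theta^\top\mathbf T(\pi)-Z_n(\boldsymbol\theta))$ for $\pi\in S_n$, where $\mathbf T(\pi)=\sum_{i=1}^n\mathbf f(i/n,\pi(i)/n)$ and $Z_n(\boldsymbol\theta)=\log\sum_{\pi\in S_n}\exp(\boldsymbol\theta^\top\mathbf T(\pi))$. Estimators: $\hat{\boldsymbol\theta}_{ML}$ is the root in $\boldsymbol\theta$ of $\mathbf T(\pi)=\nabla Z_n(\boldsymbol\theta)$. With $\mathbf y_\pi(i,j)=\mathbf f(\frac in,\frac{\pi(i)}n)+\mathbf f(\frac jn,\frac{\pi(j)}n)-\mathbf f(\frac in,\frac{\pi(j)}n)-\mathbf f(\frac jn,\frac{\pi(i)}n)$, $\hat{\boldsymbol\theta}_{PL}$ is the root in $\boldsymbol\theta$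 of $\sum_{1\le i<j\le n}\frac{1}{1+e^{\boldsymbol\theta^\top\mathbf y_\pi(i,j)}}\mathbf y_\pi(i,j)=\mathbf 0$. (Each root exists and is unique with probability tending to $1$.) $\mathbf g=(g_1,\ldots,g_L)$ is $\mathbf g((x_1,y_1),(x_2,y_2))=\mathbf f(x_1,y_1)+\mathbf f(x_2,y_2)-\mathbf f(x_1,y_2)-\mathbf f(x_2,y_1)$; each $\mathbf z_a$ ranges over $[0,1]^2$. $\mathcal M$ is the set of probability measures on $[0,1]^2$ with uniform marginals, $u$ is the uniform distribution on $[0,1]^2$, $D(\cdot\|\cdot)$ is Kullback–Leibler divergence ($+\infty$ without absolute continuity), and $\mu_{\boldsymbol\theta}$ is the unique maximizer over $\mu\in\mathcal M$ of $\boldsymbol\theta^\top\int\mathbf f\,d\mu-D(\mu\|u)$. *)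

theory Defs
  imports "HOL-Probability.Probability"
begin

text \<open>Measures on \<open>[0,1]\<close> and \<open>[0,1]\<^sup>2\<close> live on the restricted Borel spaces, so the values of a
  function outside the unit square, where nothing is assumed about it, play no role.\<close>

definition unit_square :: "(real \<times> real) set" where
  "unit_square = {0..1} \<times> {0..1}"

definition unif_interval :: "real measure" where
  "unif_interval = restrict_space lborel {0..1}"

definition unif_square :: "(real \<times> real) measure" where
  "unif_square = restrict_space lborel unit_square"

definition class_C :: "(real \<times> real \<Rightarrow> real) set" where
  "class_C = {F. continuous_on unit_square F
     \<and> \<not> (AE z in unif_square. F z = 0)
     \<and> (\<forall>x\<in>{0..1}. (\<integral>z. F (x, z) \<partial>unif_interval) = 0)
     \<and> (\<forall>y\<in>{0..1}. (\<integral>z. F (z, y) \<partial>unif_interval) = 0)}"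

definition lin_indep :: "(real \<times> real \<Rightarrow> real ^ 'l) \<Rightarrow> bool" where
  "lin_indep f \<longleftrightarrow> \<not> (\<exists>d. d \<noteq> 0 \<and> (AE z in unif_square. d \<bullet> f z = 0))"

subsection \<open>The permutation model and the two estimating equations\<close>

definition perms :: "nat \<Rightarrow> (nat \<Rightarrow> nat) set" where
  "perms n = {\<pi>. \<pi> permutes {1..n}}"

definition suff_stat :: "(real \<times> real \<Rightarrow> real ^ 'l) \<Rightarrow> nat \<Rightarrow> (nat \<Rightarrow> nat) \<Rightarrow> real ^ 'l" where
  "suff_stat f n \<pi> = (\<Sum>i = 1..n. f (real i / real n, real (\<pi> i) / real n))"

definition log_partition :: "(real \<times> real \<Rightarrow> real ^ 'l) \<Rightarrow> nat \<Rightarrow> real ^ 'l \<Rightarrow> real" where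
  "log_partition f n \<theta> = ln (\<Sum>\<pi>\<in>perms n. exp (\<theta> \<bullet> suff_stat f n \<pi>))"

definition perm_model ::
    "(real \<times> real \<Rightarrow> real ^ 'l) \<Rightarrow> nat \<Rightarrow> real ^ 'l \<Rightarrow> (nat \<Rightarrow> nat) measure" where
  "perm_model f n \<theta> =
     point_measure (perms n) (\<lambda>\<pi>. ennreal (exp (\<theta> \<bullet> suff_stat f n \<pi> - log_partition f n \<theta>)))"

definition is_root_ML ::
    "(real \<times> real \<Rightarrow> real ^ 'l) \<Rightarrow> nat \<Rightarrow> (nat \<Rightarrow> nat) \<Rightarrow> real ^ 'l \<Rightarrow> bool" where
  "is_root_ML f n \<pi> \<theta> \<longleftrightarrow> GDERIV (log_partition f n) \<theta> :> suff_stat f n \<pi>"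

definition swap_stat ::
    "(real \<times> real \<Rightarrow> real ^ 'l) \<Rightarrow> nat \<Rightarrow> (nat \<Rightarrow> nat) \<Rightarrow> nat \<Rightarrow> nat \<Rightarrow> real ^ 'l" where
  "swap_stat f n \<pi> i j =
     f (real i / real n, real (\<pi> i) / real n) + f (real j / real n, real (\<pi> j) / real n)
     - f (real i / real n, real (\<pi> j) / real n) - f (real j / real n, real (\<pi> i) / real n)"

definition is_root_PL ::
    "(real \<times> real \<Rightarrow> real ^ 'l) \<Rightarrow> nat \<Rightarrow> (nat \<Rightarrow> nat) \<Rightarrow> real ^ 'l \<Rightarrow> bool" where
  "is_root_PL f n \<pi> \<theta> \<longleftrightarrow>
     (\<Sum>(i, j)\<in>{(i, j). 1 \<le> i \<and> i < j \<and> j \<le> n}.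
        (1 / (1 + exp (\<theta> \<bullet> swap_stat f n \<pi> i j))) *\<^sub>R swap_stat f n \<pi> i j) = 0"

text \<open>An estimator is ``the root'' of its estimating equation: its value is the root whenever there
  is exactly one, and is left unspecified otherwise (an event of vanishing probability).\<close>

definition root_estimator ::
    "(nat \<Rightarrow> (nat \<Rightarrow> nat) \<Rightarrow> real ^ 'l \<Rightarrow> bool) \<Rightarrow> (nat \<Rightarrow> (nat \<Rightarrow> nat) \<Rightarrow> real ^ 'l) \<Rightarrow> bool" where
  "root_estimator R est \<longleftrightarrow>
     (\<forall>n. \<forall>\<pi>\<in>perms n. (\<exists>!\<theta>. R n \<pi> \<theta>) \<longrightarrow> R n \<pi> (est n \<pi>))"

subsection \<open>The limiting permuton\<close>

definition permutons :: "(real \<times> real) measure set" where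
  "permutons = {\<mu>. prob_space \<mu>
     \<and> sets \<mu> = sets (restrict_space borel unit_square)
     \<and> distr \<mu> (restrict_space borel {0..1}) fst = unif_interval
     \<and> distr \<mu> (restrict_space borel {0..1}) snd = unif_interval}"

text \<open>The library's \<^const>\<open>KL_divergence\<close> is real-valued and takes the reference measure first.
  For probability measures with \<open>\<mu>\<close> absolutely continuous with respect to \<open>\<nu>\<close>, the negative part of
  the log-density is always \<open>\<mu>\<close>-integrable, so non-integrability means that the divergence
  is \<open>\<infinity>\<close>.\<close>

definition KL :: "'a measure \<Rightarrow> 'a measure \<Rightarrow> ereal" where
  "KL \<mu> \<nu> = (if absolutely_continuous \<nu> \<mu> \<and> integrable \<mu> (entropy_density (exp 1) \<nu> \<mu>)
              then ereal (KL_divergence (exp 1) \<nu> \<mu>) else \<infinity>)"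

definition objective ::
    "(real \<times> real \<Rightarrow> real ^ 'l) \<Rightarrow> real ^ 'l \<Rightarrow> (real \<times> real) measure \<Rightarrow> ereal" where
  "objective f \<theta> \<mu> = ereal (\<theta> \<bullet> (\<integral>z. f z \<partial>\<mu>)) - KL \<mu> unif_square"

definition opt_permuton ::
    "(real \<times> real \<Rightarrow> real ^ 'l) \<Rightarrow> real ^ 'l \<Rightarrow> (real \<times> real) measure" where
  "opt_permuton f \<theta> =
     (THE \<mu>. \<mu> \<in> permutons \<and> (\<forall>\<nu>\<in>permutons. objective f \<theta> \<nu> \<le> objective f \<theta> \<mu>))"

subsection \<open>The matrices\<close>

definition swap_fun ::
    "(real \<times> real \<Rightarrow> real ^ 'l) \<Rightarrow> real \<times> real \<Rightarrow> real \<times> real \<Rightarrow> real ^ 'l" where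
  "swap_fun f = (\<lambda>(x1, y1) (x2, y2). f (x1, y1) + f (x2, y2) - f (x1, y2) - f (x2, y1))"

definition Sigma_mat :: "(real \<times> real \<Rightarrow> real ^ 'l) \<Rightarrow> real ^ 'l \<Rightarrow> real ^ 'l ^ 'l" where
  "Sigma_mat f \<theta> = (let \<mu> = opt_permuton f \<theta>; g = swap_fun f in
     \<chi> p q. integral\<^sup>L (\<mu> \<Otimes>\<^sub>M \<mu> \<Otimes>\<^sub>M \<mu>)
       (\<lambda>(z1, z2, z3). (g z1 z2 $ p * g z1 z3 $ q)
          / ((1 + exp (\<theta> \<bullet> g z1 z2)) * (1 + exp (\<theta> \<bullet> g z1 z3)))))"

definition A_mat :: "(real \<times> real \<Rightarrow> real ^ 'l) \<Rightarrow> real ^ 'l \<Rightarrow> real ^ 'l ^ 'l" where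
  "A_mat f \<theta> = (let \<mu> = opt_permuton f \<theta>; g = swap_fun f in
     \<chi> p q. 1 / 2 * integral\<^sup>L (\<mu> \<Otimes>\<^sub>M \<mu>)
       (\<lambda>(z1, z2). (g z1 z2 $ p * g z1 z2 $ q * exp (\<theta> \<bullet> g z1 z2))
          / (1 + exp (\<theta> \<bullet> g z1 z2))\<^sup>2))"

definition Gamma_mat :: "(real \<times> real \<Rightarrow> real ^ 'l) \<Rightarrow> real ^ 'l ^ 'l" where
  "Gamma_mat f = (\<chi> p q. \<integral>z. f z $ p * f z $ q \<partial>unif_square)"

subsection \<open>Convergence in distribution\<close>

text \<open>The library's \<^const>\<open>weak_conv_m\<close> only covers measures on the real line.\<close>

definition conv_in_distr ::
    "(nat \<Rightarrow> 'a measure) \<Rightarrow> (nat \<Rightarrow> 'a \<Rightarrow> real ^ 'l) \<Rightarrow> (real ^ 'l) measure \<Rightarrow> bool" where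
  "conv_in_distr P X \<nu> \<longleftrightarrow>
     (\<forall>h :: real ^ 'l \<Rightarrow> real. continuous_on UNIV h \<and> bounded (range h) \<longrightarrow>
        (\<lambda>n. \<integral>\<omega>. h (X n \<omega>) \<partial>P n) \<longlonglongrightarrow> (\<integral>x. h x \<partial>\<nu>))"

end

theory Submission
  imports Defs
begin

text \<open>
  Let \<open>T\<close> be the sufficient statistic of a uniform permutation of \<open>{1..n}\<close>, \<open>E T\<close> its mean, and
  \<open>W = (T - E T) / sqrt n\<close> (\<open>fluct\<close> below). The two estimators agree in the limit because both
  estimating equations, viewed at the scale \<open>h = sqrt n *\<^sub>R \<theta>\<close>, are the critical point equations of
  random functions that differ by \<open>o(1)\<close> from the same quadratic
  \<open>h \<bullet> (\<Gamma> *v h) / 2 - h \<bullet> W\<close>, whose minimum is at \<open>\<Gamma>\<^sup>-\<^sup>1 *v W\<close>.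

  \<^item> For maximum likelihood the function is the cumulant generating function of \<open>W\<close> minus
    \<open>h \<bullet> W\<close> (\<open>ml_local_eq\<close>). The cumulant generating function tends to \<open>h \<bullet> (\<Gamma> *v h) / 2\<close>,
    uniformly on bounded sets (\<open>log_mgf_limit\<close>).
  \<^item> For pseudo-likelihood the function is a rescaled sum of logistic losses of the swap statistics.
    Its linear term is exactly \<open>- h \<bullet> W\<close>, because the sum of all swap statistics is
    \<open>n *\<^sub>R (T - E T)\<close> (\<open>sum_swap_stat_pairs\<close>), and its quadratic term is governed by the mean square
    of the swap statistics, which concentrates at \<open>\<Gamma>\<close> (\<open>energy_mat_tendsto\<close>).

  The exact centring by \<open>E T\<close> is essential: \<open>f\<close> is merely continuous, so the Riemann sum \<open>E T\<close> may be
  of larger order than \<open>sqrt n\<close>. A function close to such a quadratic has an interior minimum near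
  \<open>\<Gamma>\<^sup>-\<^sup>1 *v W\<close> (\<open>interior_critical_point\<close>), hence a root there. Both score functions are strictly
  monotone once the swap energy is nondegenerate, so this root is the only one and is the value of
  the estimator (\<open>estimators_localised\<close>, \<open>estimators_linearised\<close>).

  It remains to find the limit law of \<open>\<Gamma>\<^sup>-\<^sup>1 *v W\<close>, which is a combinatorial central limit theorem.
  It is proved with Stein's exchangeable pair for transforms: composing a permutation with
  a transposition preserves the uniform distribution and changes a linear statistic by the
  corresponding swap difference. For complex \<open>z\<close> this turns \<open>E (S exp (z S))\<close> into
  \<open>z * variance * E (exp (z S))\<close> up to \<open>O(1 / sqrt n)\<close>, a differential equation for the transform
  whose solution is Gaussian (\<open>transform_approximation\<close>). The value \<open>z = 1\<close> gives the cumulant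
  generating function, and \<open>z = \<i>\<close> the characteristic function. Characteristic functions determine
  convergence in distribution in several dimensions by the Stone--Weierstrass theorem
  (\<open>conv_in_distr_trig\<close>), and the Gaussian limit is built from a decomposition of its covariance
  form into squares (\<open>gaussian_measure_exists\<close>).

  The matrix identity holds because the optimal permuton at \<open>0\<close> is the uniform distribution, under
  which the kernel \<open>g\<close> has conditional mean \<open>f\<close> and second moment \<open>4 *\<^sub>R \<Gamma>\<close>, so that
  \<open>\<Sigma>(0) = \<Gamma> / 4\<close> and \<open>A(0) = \<Gamma> / 2\<close>.
\<close>

section \<open>Averages over uniform permutations\<close>

definition perm_avg :: "nat \<Rightarrow> ((nat \<Rightarrow> nat) \<Rightarrow> 'a::real_vector) \<Rightarrow> 'a" where
  "perm_avg n F = (\<Sum>\<pi>\<in>perms n. F \<pi>) /\<^sub>R fact n"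

lemma finite_perms [simp]: "finite (perms n)"
  by (simp add: perms_def finite_permutations)

lemma card_perms: "card (perms n) = fact n"
  by (simp add: perms_def card_permutations)

lemma perms_range: "\<pi> \<in> perms n \<Longrightarrow> i \<in> {1..n} \<Longrightarrow> \<pi> i \<in> {1..n}"
  unfolding perms_def using permutes_in_image[of \<pi> "{1..n}" i] by blast

lemma perms_bij: "\<pi> \<in> perms n \<Longrightarrow> bij_betw \<pi> {1..n} {1..n}"
  unfolding perms_def by (auto intro: permutes_imp_bij)

lemma sum_perms_reindex: "\<pi> \<in> perms n \<Longrightarrow> (\<Sum>i = 1..n. h (\<pi> i)) = (\<Sum>i = 1..n. h i)"
  using perms_bij by (rule sum.reindex_bij_betw)

lemma perm_avg_add: "perm_avg n (\<lambda>\<pi>. F \<pi> + G \<pi>) = perm_avg n F + perm_avg n G"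
  by (simp add: perm_avg_def sum.distrib scaleR_add_right)

lemma perm_avg_diff: "perm_avg n (\<lambda>\<pi>. F \<pi> - G \<pi>) = perm_avg n F - perm_avg n G"
  by (simp add: perm_avg_def sum_subtractf scaleR_diff_right)

lemma perm_avg_uminus: "perm_avg n (\<lambda>\<pi>. - F \<pi>) = - perm_avg n F"
  by (simp add: perm_avg_def sum_negf)

lemma perm_avg_sum: "perm_avg n (\<lambda>\<pi>. \<Sum>i\<in>I. F i \<pi>) = (\<Sum>i\<in>I. perm_avg n (F i))"
  unfolding perm_avg_def by (subst sum.swap) (simp add: scaleR_right.sum)

lemma perm_avg_cmult: 
  fixes c :: "'a::real_algebra" 
  shows "perm_avg n (\<lambda>\<pi>. c * F \<pi>) = c * perm_avg n F"
  by (simp add: perm_avg_def sum_distrib_left)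

lemma perm_avg_const [simp]: "perm_avg n (\<lambda>\<pi>. c) = c"
  by (simp add: perm_avg_def card_perms scaleR_conv_of_real of_nat_fact sum_constant_scaleR)

lemma perm_avg_cong: "(\<And>\<pi>. \<pi> \<in> perms n \<Longrightarrow> F \<pi> = G \<pi>) \<Longrightarrow> perm_avg n F = perm_avg n G"
  by (simp add: perm_avg_def)

lemma perm_avg_mono: 
  fixes F G :: "(nat \<Rightarrow> nat) \<Rightarrow> real"
  shows "(\<And>\<pi>. \<pi> \<in> perms n \<Longrightarrow> F \<pi> \<le> G \<pi>) \<Longrightarrow> perm_avg n F \<le> perm_avg n G"
  by (simp add: perm_avg_def sum_mono)

lemma perm_avg_norm_le: "norm (perm_avg n F) \<le> perm_avg n (\<lambda>\<pi>. norm (F \<pi>))"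
  for F :: "(nat \<Rightarrow> nat) \<Rightarrow> 'a::real_normed_vector"
  by (simp add: perm_avg_def norm_sum)

lemma perm_avg_abs_bound:
  fixes F :: "(nat \<Rightarrow> nat) \<Rightarrow> 'a::real_normed_vector"
  assumes "\<And>\<pi>. \<pi> \<in> perms n \<Longrightarrow> norm (F \<pi>) \<le> B"
  shows "norm (perm_avg n F) \<le> B"
  using order_trans[OF perm_avg_norm_le perm_avg_mono[of n "\<lambda>\<pi>. norm (F \<pi>)" "\<lambda>_. B"]] assms
  by simp

lemma perm_avg_nonneg: 
  fixes F :: "(nat \<Rightarrow> nat) \<Rightarrow> real"
  shows "(\<And>\<pi>. \<pi> \<in> perms n \<Longrightarrow> 0 \<le> F \<pi>) \<Longrightarrow> 0 \<le> perm_avg n F"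
  using perm_avg_mono[of n "\<lambda>_. 0" F] by simp

lemma perm_avg_transpose:
  assumes "i \<in> {1..n}" "j \<in> {1..n}"
  shows "perm_avg n (\<lambda>\<pi>. F (\<pi> \<circ> Transposition.transpose i j)) = perm_avg n F"
proof -
  have "Transposition.transpose i j permutes {1..n}" using assms by (intro permutes_swap_id)
  then show ?thesis
    unfolding perm_avg_def perms_def using sum_permutations_compose_right[of _ "{1..n}" F] by simp
qed

text \<open>Since \<open>G\<close> is unchanged when \<open>\<pi> l\<close> is exchanged with \<open>\<pi> m\<close> for \<open>m\<close> outside \<open>I\<close>, the value \<open>b (\<pi> l)\<close> may be
  replaced by its mean over all positions outside \<open>I\<close>. As the values of \<open>b\<close> sum to zero, that mean
  involves only the \<open>card I\<close> positions inside \<open>I\<close>. This replaces any computation with the joint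
  distribution of several values of a random permutation.\<close>

lemma perm_avg_decouple:
  fixes G :: "(nat \<Rightarrow> nat) \<Rightarrow> real"
  assumes I: "I \<subseteq> {1..n}" "card I < n" and l: "l \<in> {1..n} - I"
    and inv: "\<And>\<pi> m. \<pi> \<in> perms n \<Longrightarrow> m \<in> {1..n} - I \<Longrightarrow> G (\<pi> \<circ> Transposition.transpose l m) = G \<pi>"
    and G: "\<And>\<pi>. \<pi> \<in> perms n \<Longrightarrow> \<bar>G \<pi>\<bar> \<le> B"
    and b: "\<And>m. m \<in> {1..n} \<Longrightarrow> \<bar>b m\<bar> \<le> C" and b0: "(\<Sum>m = 1..n. b m) = 0"
  shows "\<bar>perm_avg n (\<lambda>\<pi>. G \<pi> * b (\<pi> l))\<bar> \<le> real (card I) * C * B / (real n - real (card I))"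
proof -
  let ?E = "perm_avg n (\<lambda>\<pi>. G \<pi> * b (\<pi> l))"
  have finI: "finite I" using I finite_subset by blast
  have eq: "?E = perm_avg n (\<lambda>\<pi>. G \<pi> * b (\<pi> m))" if m: "m \<in> {1..n} - I" for m
  proof -
    have "?E = perm_avg n (\<lambda>\<pi>. G (\<pi> \<circ> Transposition.transpose l m) * b ((\<pi> \<circ> Transposition.transpose l m) l))"
      by (rule perm_avg_transpose[symmetric, of l n m "\<lambda>\<pi>. G \<pi> * b (\<pi> l)"]) (use l m in auto)
    also have "\<dots> = perm_avg n (\<lambda>\<pi>. G \<pi> * b (\<pi> m))"
      by (rule perm_avg_cong) (simp add: inv[OF _ m])
    finally show ?thesis .
  qed
  have "(real n - real (card I)) * ?E = (\<Sum>m\<in>{1..n} - I. ?E)"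
    using I finI by (simp add: card_Diff_subset of_nat_diff)
  also have "\<dots> = (\<Sum>m\<in>{1..n} - I. perm_avg n (\<lambda>\<pi>. G \<pi> * b (\<pi> m)))"
    by (rule sum.cong[OF refl eq])
  also have "\<dots> = perm_avg n (\<lambda>\<pi>. G \<pi> * (\<Sum>m\<in>{1..n} - I. b (\<pi> m)))"
    by (simp add: perm_avg_sum sum_distrib_left)
  also have "\<bar>\<dots>\<bar> \<le> B * (real (card I) * C)"
  proof -
    have "\<bar>G \<pi> * (\<Sum>m\<in>{1..n} - I. b (\<pi> m))\<bar> \<le> B * (real (card I) * C)" if \<pi>: "\<pi> \<in> perms n" for \<pi>
    proof -
      have "(\<Sum>m\<in>{1..n} - I. b (\<pi> m)) = (\<Sum>m = 1..n. b (\<pi> m)) - (\<Sum>m\<in>I. b (\<pi> m))"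
        using I by (simp add: sum_diff)
      also have "(\<Sum>m = 1..n. b (\<pi> m)) = 0" using sum_perms_reindex[OF \<pi>, of b] b0 by simp
      finally have "\<bar>\<Sum>m\<in>{1..n} - I. b (\<pi> m)\<bar> = \<bar>\<Sum>m\<in>I. b (\<pi> m)\<bar>" by simp
      also have "\<dots> \<le> (\<Sum>m\<in>I. C)"
        by (rule order_trans[OF sum_abs sum_mono]) (use I b perms_range[OF \<pi>] in blast)
      finally have "\<bar>\<Sum>m\<in>{1..n} - I. b (\<pi> m)\<bar> \<le> real (card I) * C" by simp
      then show ?thesis unfolding abs_mult
        using G[OF \<pi>] by (intro mult_mono) auto
    qed
    then show ?thesis using perm_avg_abs_bound[of n "\<lambda>\<pi>. G \<pi> * (\<Sum>m\<in>{1..n} - I. b (\<pi> m))"] by auto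
  qed
  finally have "(real n - real (card I)) * \<bar>?E\<bar> \<le> B * (real (card I) * C)"
    using I by (simp add: abs_mult)
  then show ?thesis using I by (simp add: field_simps)
qed

text \<open>The \<open>n\<close> diagonal terms of the square are at most \<open>C\<^sup>2\<close>; each of the \<open>n\<^sup>2\<close> others is \<open>O(1 / n)\<close> by decoupling
  with \<open>I = {i}\<close>.\<close>

lemma linear_statistic_second_moment:
  assumes n: "n \<ge> 2"
    and c: "\<And>i j. i \<in> {1..n} \<Longrightarrow> j \<in> {1..n} \<Longrightarrow> \<bar>c i j\<bar> \<le> C"
    and c0: "\<And>i. i \<in> {1..n} \<Longrightarrow> (\<Sum>j = 1..n. c i j) = 0"
  shows "perm_avg n (\<lambda>\<pi>. (\<Sum>i = 1..n. c i (\<pi> i))\<^sup>2) \<le> 3 * real n * C\<^sup>2"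
proof -
  have C0: "0 \<le> C" using c[of 1 1] n by simp
  have cc: "\<bar>perm_avg n (\<lambda>\<pi>. c i (\<pi> i) * c l (\<pi> l))\<bar> \<le> (if l = i then C\<^sup>2 else C\<^sup>2 / (real n - 1))"
    if i: "i \<in> {1..n}" and l: "l \<in> {1..n}" for i l
  proof (cases "l = i")
    case True
    have "norm (perm_avg n (\<lambda>\<pi>. c i (\<pi> i) * c i (\<pi> i))) \<le> C * C"
    proof (rule perm_avg_abs_bound)
      fix \<pi> assume "\<pi> \<in> perms n"
      then have "\<bar>c i (\<pi> i)\<bar> \<le> C" using c i perms_range by blast
      then show "norm (c i (\<pi> i) * c i (\<pi> i)) \<le> C * C"
        unfolding real_norm_def abs_mult using C0 by (intro mult_mono) auto
    qed
    with True show ?thesis by (simp add: power2_eq_square)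
  next
    case False
    have "\<bar>perm_avg n (\<lambda>\<pi>. c i (\<pi> i) * c l (\<pi> l))\<bar> \<le> real (card {i}) * C * C / (real n - real (card {i}))"
      by (rule perm_avg_decouple) (use i l n c c0 False perms_range in \<open>auto simp: Transposition.transpose_apply_other\<close>)
    with False show ?thesis by (simp add: power2_eq_square)
  qed
  have "perm_avg n (\<lambda>\<pi>. (\<Sum>i = 1..n. c i (\<pi> i))\<^sup>2)
      = (\<Sum>i = 1..n. \<Sum>l = 1..n. perm_avg n (\<lambda>\<pi>. c i (\<pi> i) * c l (\<pi> l)))"
    by (simp add: power2_eq_square sum_product perm_avg_sum)
  also have "\<dots> \<le> (\<Sum>i = 1..n. \<Sum>l = 1..n. (if l = i then C\<^sup>2 else C\<^sup>2 / (real n - 1)))"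
    by (intro sum_mono order_trans[OF abs_ge_self cc]) auto
  also have "\<dots> \<le> (\<Sum>i = 1..n. \<Sum>l = 1..n. (if l = i then C\<^sup>2 else 0) + C\<^sup>2 / (real n - 1))"
    using n by (intro sum_mono) auto
  also have "\<dots> = real n * C\<^sup>2 + real n * (real n / (real n - 1)) * C\<^sup>2"
    by (simp add: sum.distrib distrib_left)
  also have "\<dots> \<le> real n * C\<^sup>2 + real n * 2 * C\<^sup>2"
    using n by (intro add_left_mono mult_right_mono mult_left_mono) (auto simp: field_simps)
  finally show ?thesis by simp
qed

text \<open>The square is a sum over four indices. The \<open>O(n\<^sup>3)\<close> terms in which the last index repeats an earlier one
  are bounded trivially, and the others are \<open>O(1 / n)\<close> by decoupling from the first three indices.\<close>

lemma quadratic_statistic_second_moment: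
  assumes n: "n \<ge> 4"
    and a: "\<And>i j. i \<in> {1..n} \<Longrightarrow> j \<in> {1..n} \<Longrightarrow> \<bar>a i j\<bar> \<le> C"
    and a0: "\<And>i. i \<in> {1..n} \<Longrightarrow> (\<Sum>j = 1..n. a i j) = 0"
  shows "perm_avg n (\<lambda>\<pi>. (\<Sum>i = 1..n. \<Sum>j = 1..n. a i (\<pi> j) * a j (\<pi> i))\<^sup>2) \<le> 15 * real n ^ 3 * C ^ 4"
proof -
  have C0: "0 \<le> C" using a[of 1 1] n by simp
  define q where "q i j k l \<pi> = (a i (\<pi> j) * a j (\<pi> i) * a l (\<pi> k)) * a k (\<pi> l)" for i j k l \<pi>
  have ind: "(if l = i \<or> l = j \<or> l = k then C ^ 4 else 3 * C ^ 4 / (real n - 3))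
     \<le> (if l = i then C ^ 4 else 0) + (if l = j then C ^ 4 else 0) + (if l = k then C ^ 4 else 0)
        + 3 * C ^ 4 / (real n - 3)" for i j k l :: nat
  proof -
    have "0 \<le> C ^ 4" "0 \<le> 3 * C ^ 4 / (real n - 3)" using n C0 by auto
    then show ?thesis by auto
  qed
  have qb: "\<bar>perm_avg n (q i j k l)\<bar> \<le> (if l = i \<or> l = j \<or> l = k then C ^ 4 else 3 * C ^ 4 / (real n - 3))"
    if i: "i \<in> {1..n}" and j: "j \<in> {1..n}" and k: "k \<in> {1..n}" and l: "l \<in> {1..n}" for i j k l
  proof -
    have g: "\<bar>a i (\<pi> j) * a j (\<pi> i) * a l (\<pi> k)\<bar> \<le> C * C * C" if "\<pi> \<in> perms n" for \<pi>
      unfolding abs_mult using that a i j k l perms_range C0 by (intro mult_mono) auto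
    show ?thesis
    proof (cases "l = i \<or> l = j \<or> l = k")
      case True
      have "norm (perm_avg n (q i j k l)) \<le> (C * C * C) * C"
        unfolding q_def
        by (rule perm_avg_abs_bound, unfold real_norm_def abs_mult[of "_ * _ * _"])
           (use a k l perms_range g C0 in \<open>auto intro!: mult_mono\<close>)
      with True show ?thesis by (simp add: power4_eq_xxxx)
    next
      case False
      have c3: "card {i,j,k} \<le> 3" by (simp add: card_insert_if)
      have "\<bar>perm_avg n (\<lambda>\<pi>. (a i (\<pi> j) * a j (\<pi> i) * a l (\<pi> k)) * a k (\<pi> l))\<bar>
        \<le> real (card {i,j,k}) * C * (C * C * C) / (real n - real (card {i,j,k}))"
      proof (rule perm_avg_decouple)
        show "card {i,j,k} < n" using c3 n by linarith
      qed (use i j k l False a a0 g in \<open>auto simp: Transposition.transpose_apply_other\<close>)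
      also have "\<dots> \<le> 3 * C * (C * C * C) / (real n - 3)"
        using c3 n C0 by (intro frac_le mult_right_mono) auto
      finally show ?thesis using False by (simp add: q_def[abs_def] power4_eq_xxxx mult.assoc)
    qed
  qed
  have "perm_avg n (\<lambda>\<pi>. (\<Sum>i = 1..n. \<Sum>j = 1..n. a i (\<pi> j) * a j (\<pi> i))\<^sup>2)
    = perm_avg n (\<lambda>\<pi>. \<Sum>i = 1..n. \<Sum>k = 1..n. \<Sum>j = 1..n. \<Sum>l = 1..n. q i j k l \<pi>)"
    by (simp add: power2_eq_square sum_product q_def mult_ac)
  also have "\<dots> = (\<Sum>i = 1..n. \<Sum>k = 1..n. \<Sum>j = 1..n. \<Sum>l = 1..n. perm_avg n (q i j k l))"
    by (simp add: perm_avg_sum)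
  also have "\<dots> \<le> (\<Sum>i = 1..n. \<Sum>k = 1..n. \<Sum>j = 1..n. \<Sum>l = 1..n.
      (if l = i then C ^ 4 else 0) + (if l = j then C ^ 4 else 0) + (if l = k then C ^ 4 else 0)
        + 3 * C ^ 4 / (real n - 3))"
    by (intro sum_mono order_trans[OF abs_ge_self order_trans[OF qb ind]]) auto
  also have "\<dots> = 3 * real n ^ 3 * C ^ 4 + 3 * real n ^ 3 * (real n / (real n - 3)) * C ^ 4"
    by (simp add: sum.distrib power3_eq_cube algebra_simps)
  also have "\<dots> \<le> 3 * real n ^ 3 * C ^ 4 + 3 * real n ^ 3 * 4 * C ^ 4"
    using n C0 by (intro add_left_mono mult_right_mono mult_left_mono) (auto simp: field_simps)
  also have "\<dots> = 15 * real n ^ 3 * C ^ 4" by (simp add: algebra_simps)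
  finally show ?thesis .
qed

section \<open>Linear permutation statistics and their swap energy\<close>

definition lin_stat :: "nat \<Rightarrow> (nat \<Rightarrow> nat \<Rightarrow> real) \<Rightarrow> (nat \<Rightarrow> nat) \<Rightarrow> real" where
  "lin_stat n a \<pi> = (\<Sum>i = 1..n. a i (\<pi> i))"

definition swap_diff :: "(nat \<Rightarrow> nat \<Rightarrow> real) \<Rightarrow> (nat \<Rightarrow> nat) \<Rightarrow> nat \<Rightarrow> nat \<Rightarrow> real" where
  "swap_diff a \<pi> i j = a i (\<pi> i) + a j (\<pi> j) - a i (\<pi> j) - a j (\<pi> i)"

text \<open>A random version of the variance \<open>array_var\<close>: one quarter of the mean square of the change of the statistic
  under a random transposition. It appears both as the second-order term in Stein's identity and as the
  Hessian of the pseudo-likelihood.\<close>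

definition swap_energy :: "nat \<Rightarrow> (nat \<Rightarrow> nat \<Rightarrow> real) \<Rightarrow> (nat \<Rightarrow> nat) \<Rightarrow> real" where
  "swap_energy n a \<pi> = (\<Sum>i = 1..n. \<Sum>j = 1..n. (swap_diff a \<pi> i j)\<^sup>2) / (4 * (real n)\<^sup>2)"

definition array_var :: "nat \<Rightarrow> (nat \<Rightarrow> nat \<Rightarrow> real) \<Rightarrow> real" where
  "array_var n a = (\<Sum>i = 1..n. \<Sum>j = 1..n. (a i j)\<^sup>2) / (real n)\<^sup>2"

lemma perm_avg_of_real: "complex_of_real (perm_avg n F) = perm_avg n (\<lambda>\<pi>. complex_of_real (F \<pi>))"
  by (simp add: perm_avg_def scaleR_conv_of_real)

lemma lin_stat_transpose:
  assumes "i \<in> {1..n}" "j \<in> {1..n}"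
  shows "lin_stat n a (\<pi> \<circ> Transposition.transpose i j) = lin_stat n a \<pi> - swap_diff a \<pi> i j"
proof (cases "i = j")
  case True
  then show ?thesis by (simp add: swap_diff_def)
next
  case False
  let ?t = "Transposition.transpose i j"
  have "lin_stat n a \<pi> - lin_stat n a (\<pi> \<circ> ?t) = (\<Sum>k = 1..n. a k (\<pi> k) - a k (\<pi> (?t k)))"
    by (simp add: lin_stat_def sum_subtractf)
  also have "\<dots> = (\<Sum>k\<in>{i,j}. a k (\<pi> k) - a k (\<pi> (?t k)))"
    using assms by (intro sum.mono_neutral_right) (auto simp: Transposition.transpose_apply_other)
  also have "\<dots> = swap_diff a \<pi> i j" using False by (simp add: swap_diff_def)
  finally show ?thesis by simp
qed

lemma swap_diff_transpose:
  "swap_diff a (\<pi> \<circ> Transposition.transpose i j) i j = - swap_diff a \<pi> i j"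
  by (simp add: swap_diff_def)

text \<open>Stein's exchangeable pair: composition with the transposition of \<open>i\<close> and \<open>j\<close> leaves the uniform average
  invariant, lowers the statistic by the swap difference and negates the swap difference. The identity
  is the mean of the two resulting expressions for the same average.\<close>

lemma exchange_identity:
  fixes z :: complex
  assumes "i \<in> {1..n}" "j \<in> {1..n}"
  shows "2 * perm_avg n (\<lambda>\<pi>. swap_diff a \<pi> i j * exp (z * lin_stat n a \<pi>))
     = perm_avg n (\<lambda>\<pi>. swap_diff a \<pi> i j * exp (z * lin_stat n a \<pi>) * (1 - exp (- z * swap_diff a \<pi> i j)))"
proof -
  let ?F = "\<lambda>\<pi>. swap_diff a \<pi> i j * exp (z * lin_stat n a \<pi>)"
  have "perm_avg n ?F = perm_avg n (\<lambda>\<pi>. ?F (\<pi> \<circ> Transposition.transpose i j))"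
    by (rule perm_avg_transpose[symmetric]) (use assms in auto)
  also have "\<dots> = perm_avg n (\<lambda>\<pi>. - (?F \<pi> * exp (- z * swap_diff a \<pi> i j)))"
    by (rule perm_avg_cong)
       (simp add: lin_stat_transpose[OF assms] swap_diff_transpose exp_add[symmetric] algebra_simps)
  finally have "perm_avg n ?F = - perm_avg n (\<lambda>\<pi>. ?F \<pi> * exp (- z * swap_diff a \<pi> i j))"
    by (simp only: perm_avg_uminus)
  moreover have "perm_avg n (\<lambda>\<pi>. ?F \<pi> * (1 - exp (- z * swap_diff a \<pi> i j)))
      = perm_avg n ?F - perm_avg n (\<lambda>\<pi>. ?F \<pi> * exp (- z * swap_diff a \<pi> i j))"
    by (simp add: perm_avg_diff[symmetric] right_diff_distrib)
  ultimately show ?thesis by simp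
qed

text \<open>Vanishing row and column sums are what makes a linear permutation statistic centred and its swap
  differences sum up to the statistic itself. The bound \<open>n \<ge> 4\<close> keeps the denominator \<open>n - 3\<close> in the
  decoupling of three indices comparable with \<open>n\<close>.\<close>

locale centred_array =
  fixes n :: nat and a :: "nat \<Rightarrow> nat \<Rightarrow> real" and C :: real
  assumes n4: "n \<ge> 4"
    and bound: "\<And>i j. i \<in> {1..n} \<Longrightarrow> j \<in> {1..n} \<Longrightarrow> \<bar>a i j\<bar> \<le> C"
    and row: "\<And>i. i \<in> {1..n} \<Longrightarrow> (\<Sum>j = 1..n. a i j) = 0"
    and col: "\<And>j. j \<in> {1..n} \<Longrightarrow> (\<Sum>i = 1..n. a i j) = 0"
begin

lemma C_nonneg: "0 \<le> C" using bound[of 1 1] n4 by simp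

lemma perm_bound: "\<pi> \<in> perms n \<Longrightarrow> i \<in> {1..n} \<Longrightarrow> j \<in> {1..n} \<Longrightarrow> \<bar>a i (\<pi> j)\<bar> \<le> C"
  using bound perms_range by blast

lemma perm_row: "\<pi> \<in> perms n \<Longrightarrow> i \<in> {1..n} \<Longrightarrow> (\<Sum>j = 1..n. a i (\<pi> j)) = 0"
  using sum_perms_reindex[of \<pi> n "a i"] row by simp

lemma perm_col: "\<pi> \<in> perms n \<Longrightarrow> j \<in> {1..n} \<Longrightarrow> (\<Sum>i = 1..n. a i (\<pi> j)) = 0"
  using col perms_range by blast

lemma swap_diff_bound:
  assumes "\<pi> \<in> perms n" "i \<in> {1..n}" "j \<in> {1..n}"
  shows "\<bar>swap_diff a \<pi> i j\<bar> \<le> 4 * C"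
  using perm_bound[OF assms(1,2,2)] perm_bound[OF assms(1,2,3)] perm_bound[OF assms(1,3,2)]
    perm_bound[OF assms(1,3,3)] by (simp add: swap_diff_def)

lemma sum_swap_diff:
  assumes "\<pi> \<in> perms n"
  shows "(\<Sum>i = 1..n. \<Sum>j = 1..n. swap_diff a \<pi> i j) = 2 * real n * lin_stat n a \<pi>"
proof -
  have "(\<Sum>i = 1..n. \<Sum>j = 1..n. a j (\<pi> i)) = 0"
    using perm_col[OF assms] by (simp del: atLeastAtMost_iff)
  moreover have "(\<Sum>i = 1..n. \<Sum>j = 1..n. a i (\<pi> j)) = 0"
    using perm_row[OF assms] by (simp del: atLeastAtMost_iff)
  ultimately show ?thesis
    unfolding swap_diff_def sum.distrib sum_subtractf
    by (simp add: lin_stat_def sum_distrib_left[symmetric])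
qed

text \<open>Of the ten kinds of products in the square, the four mixing a diagonal entry with an entry of its row or
  column vanish by centring.\<close>

lemma sum_swap_diff_sq:
  assumes \<pi>: "\<pi> \<in> perms n"
  shows "(\<Sum>i = 1..n. \<Sum>j = 1..n. (swap_diff a \<pi> i j)\<^sup>2)
    = 2 * real n * (\<Sum>i = 1..n. (a i (\<pi> i))\<^sup>2) + 2 * (\<Sum>i = 1..n. \<Sum>j = 1..n. (a i j)\<^sup>2)
      + 2 * (lin_stat n a \<pi>)\<^sup>2 + 2 * (\<Sum>i = 1..n. \<Sum>j = 1..n. a i (\<pi> j) * a j (\<pi> i))"
proof -
  let ?b = "\<lambda>i j. a i (\<pi> j)"
  have "(\<Sum>i = 1..n. \<Sum>j = 1..n. (swap_diff a \<pi> i j)\<^sup>2) =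
     (\<Sum>i = 1..n. \<Sum>j = 1..n. (?b i i)\<^sup>2) + (\<Sum>i = 1..n. \<Sum>j = 1..n. (?b j j)\<^sup>2)
   + (\<Sum>i = 1..n. \<Sum>j = 1..n. (?b i j)\<^sup>2) + (\<Sum>i = 1..n. \<Sum>j = 1..n. (?b j i)\<^sup>2)
   + 2 * (\<Sum>i = 1..n. \<Sum>j = 1..n. ?b i i * ?b j j) + 2 * (\<Sum>i = 1..n. \<Sum>j = 1..n. ?b i j * ?b j i)
   - 2 * (\<Sum>i = 1..n. \<Sum>j = 1..n. ?b i i * ?b i j) - 2 * (\<Sum>i = 1..n. \<Sum>j = 1..n. ?b i i * ?b j i)
   - 2 * (\<Sum>i = 1..n. \<Sum>j = 1..n. ?b j j * ?b i j) - 2 * (\<Sum>i = 1..n. \<Sum>j = 1..n. ?b j j * ?b j i)"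
    unfolding sum_distrib_left sum.distrib[symmetric] sum_subtractf[symmetric]
    by (intro sum.cong refl) (simp add: swap_diff_def power2_eq_square algebra_simps)
  moreover have "(\<Sum>i = 1..n. \<Sum>j = 1..n. ?b i i * ?b i j) = 0"
    using perm_row[OF \<pi>] by (simp add: sum_distrib_left[symmetric] del: atLeastAtMost_iff)
  moreover have "(\<Sum>i = 1..n. \<Sum>j = 1..n. ?b i i * ?b j i) = 0"
    using perm_col[OF \<pi>] by (simp add: sum_distrib_left[symmetric] del: atLeastAtMost_iff)
  moreover have "(\<Sum>i = 1..n. \<Sum>j = 1..n. ?b j j * ?b i j) = 0"
    using perm_col[OF \<pi>] by (subst sum.swap) (simp add: sum_distrib_left[symmetric] del: atLeastAtMost_iff)
  moreover have "(\<Sum>i = 1..n. \<Sum>j = 1..n. ?b j j * ?b j i) = 0"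
    using perm_row[OF \<pi>] by (subst sum.swap) (simp add: sum_distrib_left[symmetric] del: atLeastAtMost_iff)
  moreover have "(\<Sum>i = 1..n. \<Sum>j = 1..n. ?b i i * ?b j j) = (lin_stat n a \<pi>)\<^sup>2"
    by (simp add: lin_stat_def power2_eq_square sum_product)
  moreover have "(\<Sum>i = 1..n. \<Sum>j = 1..n. (?b i j)\<^sup>2) = (\<Sum>i = 1..n. \<Sum>j = 1..n. (a i j)\<^sup>2)"
    by (rule sum.cong[OF refl]) (rule sum_perms_reindex[OF \<pi>, of "\<lambda>j. (a _ j)\<^sup>2"])
  moreover have "(\<Sum>i = 1..n. \<Sum>j = 1..n. (?b j i)\<^sup>2) = (\<Sum>i = 1..n. \<Sum>j = 1..n. (?b i j)\<^sup>2)"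
    by (rule sum.swap)
  ultimately show ?thesis by (simp add: sum_distrib_left[symmetric])
qed

lemma array_var_nonneg: "0 \<le> array_var n a"
  by (simp add: array_var_def sum_nonneg)

lemma array_var_le: "array_var n a \<le> C\<^sup>2"
proof -
  have "(\<Sum>i = 1..n. \<Sum>j = 1..n. (a i j)\<^sup>2) \<le> (\<Sum>i = 1..n. \<Sum>j = 1..n. C\<^sup>2)"
    by (intro sum_mono abs_le_square_iff[THEN iffD1]) (use bound C_nonneg in fastforce)
  then show ?thesis using n4 by (simp add: array_var_def power2_eq_square field_simps)
qed

lemma swap_energy_nonneg: "0 \<le> swap_energy n a \<pi>"
  by (simp add: swap_energy_def sum_nonneg)

lemma swap_energy_le:
  assumes "\<pi> \<in> perms n"
  shows "swap_energy n a \<pi> \<le> 4 * C\<^sup>2"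
proof -
  have "(\<Sum>i = 1..n. \<Sum>j = 1..n. (swap_diff a \<pi> i j)\<^sup>2) \<le> (\<Sum>i = 1..n. \<Sum>j = 1..n. (4 * C)\<^sup>2)"
    by (intro sum_mono abs_le_square_iff[THEN iffD1]) (use swap_diff_bound[OF assms] C_nonneg in fastforce)
  then show ?thesis using n4 by (simp add: swap_energy_def power2_eq_square field_simps)
qed

lemma lin_stat_second_moment: "perm_avg n (\<lambda>\<pi>. (lin_stat n a \<pi>)\<^sup>2) \<le> 3 * real n * C\<^sup>2"
  unfolding lin_stat_def by (rule linear_statistic_second_moment) (use n4 bound row in auto)

lemma lin_stat_bound:
  assumes "\<pi> \<in> perms n" shows "\<bar>lin_stat n a \<pi>\<bar> \<le> real n * C"
proof -
  have "\<bar>lin_stat n a \<pi>\<bar> \<le> (\<Sum>i = 1..n. C)"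
    unfolding lin_stat_def by (rule order_trans[OF sum_abs sum_mono]) (use perm_bound[OF assms] in auto)
  then show ?thesis by simp
qed

text \<open>By the expansion of the swap energy, its deviation from the variance is the mean of three terms: a centred
  linear statistic of the squared entries, the square of the original statistic, and a quadratic
  statistic, each with second moment \<open>O(1 / n)\<close> after normalisation.\<close>

lemma swap_energy_concentration:
  "perm_avg n (\<lambda>\<pi>. (swap_energy n a \<pi> - array_var n a)\<^sup>2) \<le> 16 * C ^ 4 / real n"
proof -
  define c where "c i j = (a i j)\<^sup>2 - (\<Sum>m = 1..n. (a i m)\<^sup>2) / real n" for i j
  define X where "X \<pi> = (\<Sum>i = 1..n. c i (\<pi> i)) / real n" for \<pi>
  define Y where "Y \<pi> = (lin_stat n a \<pi>)\<^sup>2 / (real n)\<^sup>2" for \<pi>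
  define Q where "Q \<pi> = (\<Sum>i = 1..n. \<Sum>j = 1..n. a i (\<pi> j) * a j (\<pi> i)) / (real n)\<^sup>2" for \<pi>
  have n0: "real n > 0" using n4 by simp
  have C0: "0 \<le> C" by (rule C_nonneg)
  have sq: "0 \<le> (a i j)\<^sup>2 \<and> (a i j)\<^sup>2 \<le> C\<^sup>2" if "i \<in> {1..n}" "j \<in> {1..n}" for i j
    using abs_le_square_iff[THEN iffD1, of "a i j" C] bound[OF that] C0 by simp
  have cb: "\<bar>c i j\<bar> \<le> C\<^sup>2" if i: "i \<in> {1..n}" and j: "j \<in> {1..n}" for i j
  proof -
    have "(\<Sum>m = 1..n. (a i m)\<^sup>2) \<le> (\<Sum>m = 1..n. C\<^sup>2)" using sq i by (intro sum_mono) auto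
    then have "(\<Sum>m = 1..n. (a i m)\<^sup>2) / real n \<le> C\<^sup>2" using n0 by (simp add: field_simps)
    moreover have "0 \<le> (\<Sum>m = 1..n. (a i m)\<^sup>2) / real n" by (simp add: sum_nonneg)
    ultimately show ?thesis using sq[OF i j] unfolding c_def by linarith
  qed
  have c0: "(\<Sum>j = 1..n. c i j) = 0" for i
    using n0 by (simp add: c_def sum_subtractf)
  have EX: "perm_avg n (\<lambda>\<pi>. (X \<pi>)\<^sup>2) \<le> 3 * C ^ 4 / real n"
  proof -
    have "perm_avg n (\<lambda>\<pi>. (X \<pi>)\<^sup>2) = (1 / (real n)\<^sup>2) * perm_avg n (\<lambda>\<pi>. (\<Sum>i = 1..n. c i (\<pi> i))\<^sup>2)"
      by (simp add: X_def power_divide flip: perm_avg_cmult)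
    also have "\<dots> \<le> (1 / (real n)\<^sup>2) * (3 * real n * (C\<^sup>2)\<^sup>2)"
      by (intro mult_left_mono linear_statistic_second_moment) (use n4 cb c0 in auto)
    finally show ?thesis using n0 by (simp add: power2_eq_square field_simps power4_eq_xxxx)
  qed
  have EY: "perm_avg n (\<lambda>\<pi>. (Y \<pi>)\<^sup>2) \<le> 3 * C ^ 4 / real n"
  proof -
    have "perm_avg n (\<lambda>\<pi>. (Y \<pi>)\<^sup>2) \<le> perm_avg n (\<lambda>\<pi>. (C\<^sup>2 / (real n)\<^sup>2) * (lin_stat n a \<pi>)\<^sup>2)"
    proof (rule perm_avg_mono)
      fix \<pi> assume \<pi>: "\<pi> \<in> perms n"
      have "(lin_stat n a \<pi>)\<^sup>2 \<le> (real n * C)\<^sup>2"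
        using lin_stat_bound[OF \<pi>] C0 n0 by (intro abs_le_square_iff[THEN iffD1]) simp
      then have "(lin_stat n a \<pi>)\<^sup>2 * (lin_stat n a \<pi>)\<^sup>2 \<le> (real n * C)\<^sup>2 * (lin_stat n a \<pi>)\<^sup>2"
        by (intro mult_right_mono) auto
      then show "(Y \<pi>)\<^sup>2 \<le> (C\<^sup>2 / (real n)\<^sup>2) * (lin_stat n a \<pi>)\<^sup>2"
        using n0 by (simp add: Y_def power2_eq_square field_simps)
    qed
    also have "\<dots> \<le> (C\<^sup>2 / (real n)\<^sup>2) * (3 * real n * C\<^sup>2)"
      unfolding perm_avg_cmult by (intro mult_left_mono lin_stat_second_moment) auto
    finally show ?thesis using n0 by (simp add: power2_eq_square field_simps power4_eq_xxxx)
  qed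
  have EQ: "perm_avg n (\<lambda>\<pi>. (Q \<pi>)\<^sup>2) \<le> 15 * C ^ 4 / real n"
  proof -
    have "perm_avg n (\<lambda>\<pi>. (Q \<pi>)\<^sup>2) = (1 / (real n) ^ 4) *
       perm_avg n (\<lambda>\<pi>. (\<Sum>i = 1..n. \<Sum>j = 1..n. a i (\<pi> j) * a j (\<pi> i))\<^sup>2)"
      by (simp add: Q_def power_divide flip: perm_avg_cmult power_mult)
    also have "\<dots> \<le> (1 / (real n) ^ 4) * (15 * real n ^ 3 * C ^ 4)"
      by (intro mult_left_mono quadratic_statistic_second_moment) (use n4 bound row in auto)
    finally show ?thesis using n0 by (simp add: power3_eq_cube field_simps power4_eq_xxxx)
  qed
  have "perm_avg n (\<lambda>\<pi>. (swap_energy n a \<pi> - array_var n a)\<^sup>2)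
     \<le> perm_avg n (\<lambda>\<pi>. (3/4) * ((X \<pi>)\<^sup>2 + (Y \<pi>)\<^sup>2 + (Q \<pi>)\<^sup>2))"
  proof (rule perm_avg_mono)
    fix \<pi> assume \<pi>: "\<pi> \<in> perms n"
    have "swap_energy n a \<pi> - array_var n a = (X \<pi> + Y \<pi> + Q \<pi>) / 2"
      unfolding swap_energy_def sum_swap_diff_sq[OF \<pi>] array_var_def X_def Y_def Q_def c_def sum_subtractf
      using n0 by (simp add: field_simps power2_eq_square flip: sum_divide_distrib)
    moreover have "((x + y + q) / 2)\<^sup>2 \<le> (3/4) * (x\<^sup>2 + y\<^sup>2 + q\<^sup>2)" for x y q :: real
    proof -
      have "0 \<le> (x - y)\<^sup>2 + (y - q)\<^sup>2 + (x - q)\<^sup>2" by simp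
      then show ?thesis by (simp add: power2_eq_square field_simps)
    qed
    ultimately show "(swap_energy n a \<pi> - array_var n a)\<^sup>2 \<le> (3/4) * ((X \<pi>)\<^sup>2 + (Y \<pi>)\<^sup>2 + (Q \<pi>)\<^sup>2)"
      by (simp only:)
  qed
  also have "\<dots> \<le> (3/4) * (3 * C ^ 4 / real n + 3 * C ^ 4 / real n + 15 * C ^ 4 / real n)"
    unfolding perm_avg_cmult perm_avg_add by (intro mult_left_mono add_mono EX EY EQ) auto
  also have "\<dots> \<le> 16 * C ^ 4 / real n"
    using n0 C0 by (simp add: field_simps)
  finally show ?thesis .
qed

end

section \<open>Gaussian approximation of transforms by exchangeable pairs\<close>

text \<open>Taylor's theorem to first order, with the exponential in the remainder bounded by \<open>exp 1 \<le> 3\<close>.\<close>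

lemma exp_minus_quadratic:
  fixes u :: complex
  assumes "norm u \<le> 1"
  shows "norm (1 - exp (- u) - u) \<le> 3 * (norm u)\<^sup>2"
proof -
  have "norm (exp (- u) - (\<Sum>k\<le>1. (- u) ^ k / fact k)) \<le> exp \<bar>Re (- u)\<bar> * norm (- u) ^ Suc 1 / fact 1"
    by (rule Taylor_exp)
  moreover have "exp \<bar>Re u\<bar> \<le> 3"
    by (rule order_trans[OF _ exp_le]) (use abs_Re_le_cmod[of u] assms in simp)
  ultimately have A: "norm (exp (- u) - (1 - u)) \<le> exp \<bar>Re u\<bar> * (norm u)\<^sup>2"
    and B: "exp \<bar>Re u\<bar> \<le> 3"
    by (auto simp: power2_eq_square)
  have "norm (exp (- u) - (1 - u)) \<le> 3 * (norm u)\<^sup>2"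
    by (rule order_trans[OF A mult_right_mono[OF B]]) simp
  moreover have "1 - exp (- u) - u = - (exp (- u) - (1 - u))" by simp
  ultimately show ?thesis by (simp only: norm_minus_cancel)
qed

definition norm_stat :: "nat \<Rightarrow> (nat \<Rightarrow> nat \<Rightarrow> real) \<Rightarrow> (nat \<Rightarrow> nat) \<Rightarrow> real" where
  "norm_stat n a \<pi> = lin_stat n a \<pi> / sqrt (real n)"

text \<open>A bound for the moment generating function of \<open>norm_stat\<close> on \<open>{-2..2}\<close>, and below the resulting bound for the
  error in Stein's equation. They depend on the array through \<open>C\<close> only; all limits below are therefore
  uniform over families of arrays with a common bound.\<close>

definition mgf_const :: "real \<Rightarrow> real" where
  "mgf_const C = exp (2 * (8 * C\<^sup>2 + 192 * C ^ 3))"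

definition tilt_const :: "real \<Rightarrow> real" where
  "tilt_const C = (16 * C ^ 4 + mgf_const C) / 2 + 192 * C ^ 3 * mgf_const C"

context centred_array
begin

text \<open>The statistic is the normalised sum of its swap differences, and each swap difference obeys the
  exchange identity.\<close>

lemma stein_identity:
  fixes z :: complex
  shows "perm_avg n (\<lambda>\<pi>. norm_stat n a \<pi> * exp (z * norm_stat n a \<pi>)) =
    (\<Sum>i = 1..n. \<Sum>j = 1..n. perm_avg n (\<lambda>\<pi>. swap_diff a \<pi> i j * exp (z * norm_stat n a \<pi>)
       * (1 - exp (- (z * swap_diff a \<pi> i j / sqrt (real n)))))) / (4 * real n * sqrt (real n))"
proof -
  let ?r = "complex_of_real (sqrt (real n))"
  have n0: "real n > 0" using n4 by simp
  have "perm_avg n (\<lambda>\<pi>. norm_stat n a \<pi> * exp (z * norm_stat n a \<pi>)) =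
     perm_avg n (\<lambda>\<pi>. (1 / (2 * real n * sqrt (real n)))
        * ((\<Sum>i = 1..n. \<Sum>j = 1..n. swap_diff a \<pi> i j) * exp ((z / ?r) * lin_stat n a \<pi>)))"
    by (rule perm_avg_cong) (use n0 in \<open>simp add: sum_swap_diff norm_stat_def field_simps flip: of_real_sum del: One_nat_def\<close>)
  also have "\<dots> = (1 / (2 * real n * sqrt (real n))) * (\<Sum>i = 1..n. \<Sum>j = 1..n.
      perm_avg n (\<lambda>\<pi>. swap_diff a \<pi> i j * exp ((z / ?r) * lin_stat n a \<pi>)))"
    unfolding perm_avg_cmult by (simp add: sum_distrib_right perm_avg_sum)
  also have "(\<Sum>i = 1..n. \<Sum>j = 1..n. perm_avg n (\<lambda>\<pi>. swap_diff a \<pi> i j * exp ((z / ?r) * lin_stat n a \<pi>)))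
    = (1/2) * (\<Sum>i = 1..n. \<Sum>j = 1..n. perm_avg n (\<lambda>\<pi>. swap_diff a \<pi> i j * exp ((z / ?r) * lin_stat n a \<pi>)
       * (1 - exp (- (z / ?r) * swap_diff a \<pi> i j))))"
    unfolding sum_distrib_left
    by (intro sum.cong refl) (simp only: exchange_identity[symmetric], simp)
  finally show ?thesis
    by (simp add: norm_stat_def)
qed

text \<open>Expanding \<open>1 - exp (- u)\<close> to first order in Stein's identity produces the swap energy. The remainder is of
  size \<open>O(1 / n)\<close> in each of \<open>n\<^sup>2\<close> terms, against a denominator of order \<open>n * sqrt n\<close>.\<close>

lemma stein_approximation:
  fixes z :: complex
  assumes z: "norm z \<le> 2" and C8: "8 * C \<le> sqrt (real n)"
  shows "norm (perm_avg n (\<lambda>\<pi>. norm_stat n a \<pi> * exp (z * norm_stat n a \<pi>))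
        - z * perm_avg n (\<lambda>\<pi>. swap_energy n a \<pi> * exp (z * norm_stat n a \<pi>)))
      \<le> 192 * C ^ 3 / sqrt (real n) * perm_avg n (\<lambda>\<pi>. exp (Re z * norm_stat n a \<pi>))"
proof -
  let ?r = "sqrt (real n)"
  have n0: "real n > 0" using n4 by simp
  have r0: "?r > 0" and rr: "?r * ?r = real n" using n0 by auto
  define u where "u \<pi> i j = z * swap_diff a \<pi> i j / ?r" for \<pi> i j
  define e where "e \<pi> = exp (z * norm_stat n a \<pi>)" for \<pi>
  have ne: "norm (e \<pi>) = exp (Re z * norm_stat n a \<pi>)" for \<pi>
    by (simp add: e_def)
  have V: "z * perm_avg n (\<lambda>\<pi>. swap_energy n a \<pi> * e \<pi>) =
    (\<Sum>i = 1..n. \<Sum>j = 1..n. perm_avg n (\<lambda>\<pi>. swap_diff a \<pi> i j * e \<pi> * u \<pi> i j)) / (4 * real n * ?r)"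
  proof -
    have "(\<Sum>i = 1..n. \<Sum>j = 1..n. perm_avg n (\<lambda>\<pi>. swap_diff a \<pi> i j * e \<pi> * u \<pi> i j))
      = perm_avg n (\<lambda>\<pi>. \<Sum>i = 1..n. \<Sum>j = 1..n. swap_diff a \<pi> i j * e \<pi> * u \<pi> i j)"
      by (simp add: perm_avg_sum)
    also have "\<dots> = perm_avg n (\<lambda>\<pi>. (z * (4 * real n * ?r)) * (swap_energy n a \<pi> * e \<pi>))"
    proof (rule perm_avg_cong)
      fix \<pi>
      have "(\<Sum>i = 1..n. \<Sum>j = 1..n. swap_diff a \<pi> i j * e \<pi> * u \<pi> i j)
         = (\<Sum>i = 1..n. \<Sum>j = 1..n. (z * e \<pi> / ?r) * of_real ((swap_diff a \<pi> i j)\<^sup>2))"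
        by (intro sum.cong refl) (simp add: u_def power2_eq_square)
      also have "\<dots> = (z * e \<pi> / ?r) * of_real (\<Sum>i = 1..n. \<Sum>j = 1..n. (swap_diff a \<pi> i j)\<^sup>2)"
        by (simp add: sum_distrib_left)
      also have "(\<Sum>i = 1..n. \<Sum>j = 1..n. (swap_diff a \<pi> i j)\<^sup>2) = 4 * real n * ?r * ?r * swap_energy n a \<pi>"
      proof -
        have "4 * real n * ?r * ?r = 4 * (real n)\<^sup>2" by (simp add: power2_eq_square)
        then show ?thesis using n0 by (simp only: swap_energy_def) simp
      qed
      finally show "(\<Sum>i = 1..n. \<Sum>j = 1..n. swap_diff a \<pi> i j * e \<pi> * u \<pi> i j)
        = (z * (4 * real n * ?r)) * (swap_energy n a \<pi> * e \<pi>)"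
        using n0 by simp
    qed
    also have "\<dots> = (z * (4 * real n * ?r)) * perm_avg n (\<lambda>\<pi>. swap_energy n a \<pi> * e \<pi>)"
      by (rule perm_avg_cmult)
    finally show ?thesis using n0 by simp
  qed
  have S: "perm_avg n (\<lambda>\<pi>. norm_stat n a \<pi> * e \<pi>) =
    (\<Sum>i = 1..n. \<Sum>j = 1..n. perm_avg n (\<lambda>\<pi>. swap_diff a \<pi> i j * e \<pi> * (1 - exp (- u \<pi> i j)))) / (4 * real n * ?r)"
    unfolding e_def u_def by (rule stein_identity)
  have pair: "norm (perm_avg n (\<lambda>\<pi>. swap_diff a \<pi> i j * e \<pi> * (1 - exp (- u \<pi> i j)))
       - perm_avg n (\<lambda>\<pi>. swap_diff a \<pi> i j * e \<pi> * u \<pi> i j))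
     \<le> (768 * C ^ 3 / real n) * perm_avg n (\<lambda>\<pi>. exp (Re z * norm_stat n a \<pi>))"
    if i: "i \<in> {1..n}" and j: "j \<in> {1..n}" for i j
  proof -
    have "norm (perm_avg n (\<lambda>\<pi>. swap_diff a \<pi> i j * e \<pi> * (1 - exp (- u \<pi> i j)))
       - perm_avg n (\<lambda>\<pi>. swap_diff a \<pi> i j * e \<pi> * u \<pi> i j))
      = norm (perm_avg n (\<lambda>\<pi>. swap_diff a \<pi> i j * e \<pi> * (1 - exp (- u \<pi> i j) - u \<pi> i j)))"
      unfolding perm_avg_diff[symmetric] by (simp add: right_diff_distrib)
    also have "\<dots> \<le> perm_avg n (\<lambda>\<pi>. norm (swap_diff a \<pi> i j * e \<pi> * (1 - exp (- u \<pi> i j) - u \<pi> i j)))"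
      by (rule perm_avg_norm_le)
    also have "\<dots> \<le> perm_avg n (\<lambda>\<pi>. (768 * C ^ 3 / real n) * exp (Re z * norm_stat n a \<pi>))"
    proof (rule perm_avg_mono)
      fix \<pi> assume \<pi>: "\<pi> \<in> perms n"
      have y: "\<bar>swap_diff a \<pi> i j\<bar> \<le> 4 * C" by (rule swap_diff_bound[OF \<pi> i j])
      have "norm (u \<pi> i j) = norm z * \<bar>swap_diff a \<pi> i j\<bar> / ?r"
        by (simp add: u_def norm_mult norm_divide)
      also have "\<dots> \<le> 2 * (4 * C) / ?r"
        using z y r0 by (intro divide_right_mono mult_mono) auto
      finally have u: "norm (u \<pi> i j) \<le> 8 * C / ?r" by simp
      have u1: "norm (u \<pi> i j) \<le> 1" by (rule order_trans[OF u]) (use C8 r0 in \<open>simp add: divide_le_eq\<close>)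
      have "(norm (u \<pi> i j))\<^sup>2 \<le> (8 * C / ?r)\<^sup>2" by (intro power_mono u) simp
      also have "\<dots> = 64 * C\<^sup>2 / real n" using n0 by (simp add: power_divide power_mult_distrib)
      finally have u2: "(norm (u \<pi> i j))\<^sup>2 \<le> 64 * C\<^sup>2 / real n" .
      have "norm (1 - exp (- u \<pi> i j) - u \<pi> i j) \<le> 3 * (64 * C\<^sup>2 / real n)"
        using exp_minus_quadratic[OF u1] u2 by linarith
      then have "norm (swap_diff a \<pi> i j * e \<pi> * (1 - exp (- u \<pi> i j) - u \<pi> i j))
         \<le> (4 * C) * exp (Re z * norm_stat n a \<pi>) * (3 * (64 * C\<^sup>2 / real n))"
        unfolding norm_mult norm_of_real ne using y C_nonneg by (intro mult_mono) auto
      then show "norm (swap_diff a \<pi> i j * e \<pi> * (1 - exp (- u \<pi> i j) - u \<pi> i j))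
         \<le> (768 * C ^ 3 / real n) * exp (Re z * norm_stat n a \<pi>)"
        by (simp add: power2_eq_square power3_eq_cube mult_ac)
    qed
    finally show ?thesis by (simp only: perm_avg_cmult)
  qed
  let ?m = "perm_avg n (\<lambda>\<pi>. exp (Re z * norm_stat n a \<pi>))"
  have eq: "perm_avg n (\<lambda>\<pi>. norm_stat n a \<pi> * e \<pi>) - z * perm_avg n (\<lambda>\<pi>. swap_energy n a \<pi> * e \<pi>)
    = (\<Sum>i = 1..n. \<Sum>j = 1..n. perm_avg n (\<lambda>\<pi>. swap_diff a \<pi> i j * e \<pi> * (1 - exp (- u \<pi> i j)))
        - perm_avg n (\<lambda>\<pi>. swap_diff a \<pi> i j * e \<pi> * u \<pi> i j)) / (4 * real n * ?r)"
    unfolding V S by (simp add: sum_subtractf diff_divide_distrib)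
  have "norm (perm_avg n (\<lambda>\<pi>. norm_stat n a \<pi> * e \<pi>) - z * perm_avg n (\<lambda>\<pi>. swap_energy n a \<pi> * e \<pi>))
    = norm (\<Sum>i = 1..n. \<Sum>j = 1..n. perm_avg n (\<lambda>\<pi>. swap_diff a \<pi> i j * e \<pi> * (1 - exp (- u \<pi> i j)))
        - perm_avg n (\<lambda>\<pi>. swap_diff a \<pi> i j * e \<pi> * u \<pi> i j)) / (4 * real n * ?r)"
    unfolding eq by (simp add: norm_divide norm_mult)
  also have "\<dots> \<le> (\<Sum>i = 1..n. \<Sum>j = 1..n. (768 * C ^ 3 / real n) * ?m) / (4 * real n * ?r)"
    using r0 n0 by (intro divide_right_mono sum_norm_le pair) auto
  also have "\<dots> = 192 * C ^ 3 / ?r * ?m"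
    using n0 r0 by (simp add: field_simps)
  finally show ?thesis by (simp add: e_def)
qed

text \<open>A Gronwall argument: by Stein's approximation and the boundedness of the swap energy, the derivative of the
  moment generating function is at most a constant times the function.\<close>

lemma mgf_bound_nonneg:
  assumes C8: "8 * C \<le> sqrt (real n)" and s: "0 \<le> s" "s \<le> 2"
  shows "perm_avg n (\<lambda>\<pi>. exp (s * norm_stat n a \<pi>)) \<le> mgf_const C"
proof -
  define m where "m s = perm_avg n (\<lambda>\<pi>. exp (s * norm_stat n a \<pi>))" for s
  define K where "K = 8 * C\<^sup>2 + 192 * C ^ 3"
  have n0: "real n > 0" and r1: "sqrt (real n) \<ge> 1" using n4 by auto
  have K0: "0 \<le> K" using C_nonneg by (simp add: K_def)
  have m0: "0 \<le> m t" for t unfolding m_def by (rule perm_avg_nonneg) simp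
  have m': "(m has_real_derivative perm_avg n (\<lambda>\<pi>. norm_stat n a \<pi> * exp (t * norm_stat n a \<pi>))) (at t)" for t
    unfolding m_def[abs_def] perm_avg_def
    by (auto intro!: derivative_eq_intros sum.cong simp: mult_ac)
  have m'le: "perm_avg n (\<lambda>\<pi>. norm_stat n a \<pi> * exp (t * norm_stat n a \<pi>)) \<le> K * m t"
    if t: "0 \<le> t" "t \<le> 2" for t
  proof -
    let ?W = "perm_avg n (\<lambda>\<pi>. norm_stat n a \<pi> * exp (t * norm_stat n a \<pi>))"
    let ?V = "perm_avg n (\<lambda>\<pi>. swap_energy n a \<pi> * exp (t * norm_stat n a \<pi>))"
    have "\<bar>?W - t * ?V\<bar> = norm (complex_of_real ?W - of_real t * complex_of_real ?V)"
      by (simp only: of_real_mult[symmetric] of_real_diff[symmetric] norm_of_real)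
    also have "\<dots> \<le> 192 * C ^ 3 / sqrt (real n) * m t"
      unfolding m_def using stein_approximation[of "complex_of_real t", OF _ C8] t
      by (simp add: perm_avg_of_real exp_of_real[symmetric])
    also have "\<dots> \<le> 192 * C ^ 3 * m t"
      using r1 m0 C_nonneg by (intro mult_right_mono) (auto simp: divide_le_eq mult_le_cancel_left1)
    finally have 1: "?W \<le> t * ?V + 192 * C ^ 3 * m t" by linarith
    have "?V \<le> perm_avg n (\<lambda>\<pi>. 4 * C\<^sup>2 * exp (t * norm_stat n a \<pi>))"
      by (intro perm_avg_mono mult_right_mono swap_energy_le) auto
    also have "\<dots> = 4 * C\<^sup>2 * m t" unfolding m_def by (rule perm_avg_cmult)
    finally have "t * ?V \<le> 2 * (4 * C\<^sup>2 * m t)"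
      using t m0 swap_energy_nonneg by (intro mult_mono) (auto intro!: perm_avg_nonneg)
    with 1 show ?thesis by (simp add: K_def algebra_simps)
  qed
  have "m s * exp (- (K * s)) \<le> m 0 * exp (- (K * 0))"
  proof (rule DERIV_nonpos_imp_nonincreasing[OF s(1)])
    fix x assume x: "0 \<le> x" "x \<le> s"
    have "((\<lambda>s. m s * exp (- (K * s))) has_real_derivative
        (perm_avg n (\<lambda>\<pi>. norm_stat n a \<pi> * exp (x * norm_stat n a \<pi>)) - K * m x) * exp (- (K * x))) (at x)"
      by (auto intro!: derivative_eq_intros m' simp: algebra_simps)
    moreover have "(perm_avg n (\<lambda>\<pi>. norm_stat n a \<pi> * exp (x * norm_stat n a \<pi>)) - K * m x) * exp (- (K * x)) \<le> 0"
      using m'le[of x] x s by (intro mult_nonpos_nonneg) auto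
    ultimately show "\<exists>y. ((\<lambda>s. m s * exp (- (K * s))) has_real_derivative y) (at x) \<and> y \<le> 0" by blast
  qed
  also have "m 0 = 1" by (simp add: m_def)
  finally have "m s \<le> exp (K * s)" by (simp add: exp_minus field_simps)
  also have "\<dots> \<le> exp (K * 2)" using K0 s by (auto intro: mult_left_mono)
  finally show ?thesis by (simp add: m_def mgf_const_def K_def mult.commute)
qed

lemma uminus_array: "centred_array n (\<lambda>i j. - a i j) C"
  by unfold_locales (use n4 bound row col in \<open>auto simp: sum_negf\<close>)

lemma mgf_bound:
  assumes C8: "8 * C \<le> sqrt (real n)" and s: "\<bar>s\<bar> \<le> 2"
  shows "perm_avg n (\<lambda>\<pi>. exp (s * norm_stat n a \<pi>)) \<le> mgf_const C"
proof (cases "0 \<le> s")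
  case True
  then show ?thesis using mgf_bound_nonneg[OF C8] s by simp
next
  case False
  interpret neg: centred_array n "\<lambda>i j. - a i j" C by (rule uminus_array)
  have "norm_stat n (\<lambda>i j. - a i j) \<pi> = - norm_stat n a \<pi>" for \<pi>
    by (simp add: norm_stat_def lin_stat_def sum_negf)
  then show ?thesis using neg.mgf_bound_nonneg[OF C8, of "- s"] False s by simp
qed

text \<open>Replacing the swap energy by the variance inside the average costs \<open>O(1 / sqrt n)\<close>: the deviation is split
  from the exponential by \<open>2 * x * y \<le> r * x\<^sup>2 + y\<^sup>2 / r\<close> with \<open>r = sqrt n\<close>, and the square of the
  exponential is a moment generating function at \<open>2 * Re z\<close>. This is why the bound on
  \<open>{-2..2}\<close> is needed.\<close>

lemma stein_equation:
  fixes z :: complex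
  assumes z: "norm z \<le> 1" and C8: "8 * C \<le> sqrt (real n)"
  shows "norm (perm_avg n (\<lambda>\<pi>. norm_stat n a \<pi> * exp (z * norm_stat n a \<pi>))
        - z * array_var n a * perm_avg n (\<lambda>\<pi>. exp (z * norm_stat n a \<pi>)))
      \<le> tilt_const C / sqrt (real n)"
proof -
  let ?r = "sqrt (real n)"
  let ?M = "mgf_const C"
  let ?d = "\<lambda>\<pi>. swap_energy n a \<pi> - array_var n a"
  let ?E = "\<lambda>\<pi>. exp (z * norm_stat n a \<pi>)"
  let ?x = "\<lambda>\<pi>. exp (Re z * norm_stat n a \<pi>)"
  have n0: "real n > 0" using n4 by simp
  then have r0: "?r > 0" by simp
  have x: "\<bar>Re z\<bar> \<le> 1" using abs_Re_le_cmod[of z] z by linarith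
  have "norm (perm_avg n (\<lambda>\<pi>. norm_stat n a \<pi> * ?E \<pi>) - z * perm_avg n (\<lambda>\<pi>. swap_energy n a \<pi> * ?E \<pi>))
     \<le> 192 * C ^ 3 / ?r * perm_avg n ?x"
    by (rule stein_approximation) (use z C8 in auto)
  also have "\<dots> \<le> 192 * C ^ 3 / ?r * ?M"
    using x C_nonneg by (intro mult_left_mono mgf_bound C8) auto
  finally have 1: "norm (perm_avg n (\<lambda>\<pi>. norm_stat n a \<pi> * ?E \<pi>) - z * perm_avg n (\<lambda>\<pi>. swap_energy n a \<pi> * ?E \<pi>))
     \<le> 192 * C ^ 3 * ?M / ?r" by simp
  have eq: "z * perm_avg n (\<lambda>\<pi>. swap_energy n a \<pi> * ?E \<pi>) - z * array_var n a * perm_avg n ?E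
     = z * perm_avg n (\<lambda>\<pi>. ?d \<pi> * ?E \<pi>)"
    by (simp add: left_diff_distrib perm_avg_diff perm_avg_cmult right_diff_distrib)
  have "norm (z * perm_avg n (\<lambda>\<pi>. swap_energy n a \<pi> * ?E \<pi>) - z * array_var n a * perm_avg n ?E)
     \<le> 1 * perm_avg n (\<lambda>\<pi>. norm (?d \<pi> * ?E \<pi>))"
    unfolding eq norm_mult[of z] using z by (intro mult_mono perm_avg_norm_le) auto
  also have "\<dots> \<le> perm_avg n (\<lambda>\<pi>. (1/2) * (?r * (?d \<pi>)\<^sup>2 + (1 / ?r) * exp ((2 * Re z) * norm_stat n a \<pi>)))"
    unfolding mult_1
  proof (rule perm_avg_mono)
    fix \<pi>
    \<comment> \<open>The weight \<open>?r\<close> balances the variance \<open>O(1 / n)\<close> of the swap energy against the bounded exponential moment.\<close>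
    have "0 \<le> (?r * \<bar>?d \<pi>\<bar> - ?x \<pi>)\<^sup>2 / ?r" using r0 by simp
    also have "\<dots> = ?r * (?d \<pi>)\<^sup>2 + (1 / ?r) * exp ((2 * Re z) * norm_stat n a \<pi>) - 2 * (\<bar>?d \<pi>\<bar> * ?x \<pi>)"
      using r0 by (simp add: power2_eq_square field_simps flip: exp_add)
    finally show "norm (complex_of_real (?d \<pi>) * ?E \<pi>) \<le> (1/2) * (?r * (?d \<pi>)\<^sup>2 + (1 / ?r) * exp ((2 * Re z) * norm_stat n a \<pi>))"
      by (simp add: norm_mult flip: of_real_diff)
  qed
  also have "\<dots> \<le> (1/2) * (?r * (16 * C ^ 4 / real n) + (1 / ?r) * ?M)"
    unfolding perm_avg_cmult perm_avg_add
    using x r0 by (intro mult_left_mono add_mono swap_energy_concentration mgf_bound C8) auto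
  also have "?r * (16 * C ^ 4 / real n) = 16 * C ^ 4 / ?r"
    using r0 n0 by (simp add: field_simps)
  finally have 2: "norm (z * perm_avg n (\<lambda>\<pi>. swap_energy n a \<pi> * ?E \<pi>) - z * array_var n a * perm_avg n ?E)
      \<le> (1/2) * (16 * C ^ 4 / ?r + (1 / ?r) * ?M)" .
  have "norm (perm_avg n (\<lambda>\<pi>. norm_stat n a \<pi> * ?E \<pi>) - z * array_var n a * perm_avg n ?E)
     \<le> 192 * C ^ 3 * ?M / ?r + (1/2) * (16 * C ^ 4 / ?r + (1 / ?r) * ?M)"
    using norm_triangle_mono[OF 1 2] by simp
  also have "\<dots> = tilt_const C / ?r"
    using r0 by (simp add: tilt_const_def field_simps)
  finally show ?thesis .
qed

text \<open>Stein's equation says that the transform nearly solves \<open>\<phi>' = w * v * \<phi>\<close>. Multiplication with the integrating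
  factor \<open>exp (- w\<^sup>2 * v / 2)\<close> gives a function on the complex unit disc with derivative
  \<open>O(1 / sqrt n)\<close> and value \<open>1\<close> at the origin.\<close>

theorem transform_approximation:
  fixes z :: complex
  assumes z: "norm z \<le> 1" and C8: "8 * C \<le> sqrt (real n)"
  shows "norm (perm_avg n (\<lambda>\<pi>. exp (z * norm_stat n a \<pi>)) - exp (z\<^sup>2 * array_var n a / 2))
      \<le> exp (C\<^sup>2) * tilt_const C / sqrt (real n)"
proof -
  define v where "v = array_var n a"
  define \<phi> :: "complex \<Rightarrow> complex" where "\<phi> w = perm_avg n (\<lambda>\<pi>. exp (w * complex_of_real (norm_stat n a \<pi>)))" for w
  define \<phi>' :: "complex \<Rightarrow> complex" where "\<phi>' w = perm_avg n (\<lambda>\<pi>. norm_stat n a \<pi> * exp (w * complex_of_real (norm_stat n a \<pi>)))" for w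
  define \<psi> :: "complex \<Rightarrow> complex" where "\<psi> w = exp (- (w\<^sup>2 * v / 2)) * \<phi> w" for w
  have n0: "real n > 0" using n4 by simp
  have v: "0 \<le> v" "v \<le> C\<^sup>2" unfolding v_def by (rule array_var_nonneg, rule array_var_le)
  have d\<phi>: "(\<phi> has_field_derivative \<phi>' w) (at w)" for w :: complex
    unfolding \<phi>_def[abs_def] \<phi>'_def perm_avg_def scaleR_conv_of_real
    by (auto intro!: derivative_eq_intros sum.cong simp: mult_ac)
  have d\<psi>: "(\<psi> has_field_derivative exp (- (w\<^sup>2 * v / 2)) * (\<phi>' w - w * v * \<phi> w)) (at w)" for w :: complex
    unfolding \<psi>_def[abs_def]
    by (auto intro!: derivative_eq_intros d\<phi> simp: algebra_simps)
  have ex: "norm (exp (s * (w\<^sup>2 * v / 2))) \<le> exp (C\<^sup>2 / 2)" if "norm w \<le> 1" "\<bar>s\<bar> = 1" for w :: complex and s :: real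
  proof -
    have "norm (exp (s * (w\<^sup>2 * v / 2))) \<le> exp (norm (s * (w\<^sup>2 * v / 2)))" by (rule norm_exp)
    also have "norm (s * (w\<^sup>2 * v / 2)) = (norm w)\<^sup>2 * v / 2"
      using v that by (simp add: norm_mult norm_power norm_divide)
    also have "\<dots> \<le> 1 * C\<^sup>2 / 2"
      using v that by (intro divide_right_mono mult_mono) (auto simp: power_le_one)
    finally show ?thesis by simp
  qed
  have T0: "0 \<le> tilt_const C" using C_nonneg by (simp add: tilt_const_def mgf_const_def)
  have "norm (\<psi> z - \<psi> 0) \<le> (exp (C\<^sup>2 / 2) * (tilt_const C / sqrt (real n))) * norm (z - 0)"
  proof (rule field_differentiable_bound[of "cball 0 1"])
    fix w :: complex assume "w \<in> cball 0 1"
    then have w: "norm w \<le> 1" by simp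
    show "(\<psi> has_field_derivative exp (- (w\<^sup>2 * v / 2)) * (\<phi>' w - w * v * \<phi> w)) (at w within cball 0 1)"
      using d\<psi> by (rule has_field_derivative_at_within)
    show "norm (exp (- (w\<^sup>2 * v / 2)) * (\<phi>' w - w * v * \<phi> w)) \<le> exp (C\<^sup>2 / 2) * (tilt_const C / sqrt (real n))"
      unfolding norm_mult[of "exp _"]
      using ex[OF w, of "-1"] stein_equation[OF w C8]
      by (intro mult_mono) (auto simp: \<phi>_def \<phi>'_def v_def)
  qed (use z in auto)
  also have "\<dots> \<le> (exp (C\<^sup>2 / 2) * (tilt_const C / sqrt (real n))) * 1"
    using z T0 by (intro mult_left_mono) auto
  finally have d: "norm (\<psi> z - 1) \<le> exp (C\<^sup>2 / 2) * (tilt_const C / sqrt (real n))"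
    by (simp add: \<psi>_def \<phi>_def)
  have "\<phi> z - exp (z\<^sup>2 * v / 2) = exp (z\<^sup>2 * v / 2) * (\<psi> z - 1)"
    by (simp add: \<psi>_def exp_minus right_diff_distrib)
  then have "norm (\<phi> z - exp (z\<^sup>2 * v / 2)) = norm (exp (z\<^sup>2 * v / 2)) * norm (\<psi> z - 1)"
    by (simp add: norm_mult)
  also have "\<dots> \<le> exp (C\<^sup>2 / 2) * (exp (C\<^sup>2 / 2) * (tilt_const C / sqrt (real n)))"
    using ex[OF z, of 1] by (intro mult_mono d) auto
  also have "\<dots> = exp (C\<^sup>2) * tilt_const C / sqrt (real n)"
    by (simp flip: exp_add mult.assoc)
  finally show ?thesis by (simp add: \<phi>_def v_def)
qed

end

section \<open>The optimal permuton at parameter zero\<close>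

text \<open>Restriction commutes with products. The nontrivial part is that restrictions of Borel sets of the plane
  are measurable for the product of the restricted spaces, which holds because the inclusion map
  is measurable.\<close>

lemma restrict_space_lborel_Times:
  fixes A :: "real set" and B :: "real set"
  assumes [measurable]: "A \<in> sets borel" "B \<in> sets borel"
  shows "restrict_space lborel A \<Otimes>\<^sub>M restrict_space lborel B = restrict_space lborel (A \<times> B)"
proof (rule pair_measure_eqI)
  show "sigma_finite_measure (restrict_space lborel A)" "sigma_finite_measure (restrict_space lborel B)"
    using assms by (auto intro!: sigma_finite_measure_restrict_space sigma_finite_lborel)
  have AB: "A \<times> B \<in> sets (lborel :: (real \<times> real) measure)"
    by (simp add: lborel_prod[symmetric])
  show "sets (restrict_space lborel A \<Otimes>\<^sub>M restrict_space lborel B) = sets (restrict_space lborel (A \<times> B))"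
  proof (intro equalityI subsetI)
    fix S assume "S \<in> sets (restrict_space lborel (A \<times> B))"
    then obtain S' where S': "S' \<in> sets borel" "S = (A \<times> B) \<inter> S'"
      by (auto simp: sets_restrict_space)
    have "(\<lambda>z. (fst z, snd z)) \<in> restrict_space lborel A \<Otimes>\<^sub>M restrict_space lborel B \<rightarrow>\<^sub>M (borel \<Otimes>\<^sub>M borel :: (real \<times> real) measure)"
    proof (rule measurable_Pair)
      show "fst \<in> restrict_space lborel A \<Otimes>\<^sub>M restrict_space lborel B \<rightarrow>\<^sub>M borel"
        by (rule measurable_compose[OF measurable_fst]) (auto intro: measurable_restrict_space1)
      show "snd \<in> restrict_space lborel A \<Otimes>\<^sub>M restrict_space lborel B \<rightarrow>\<^sub>M borel"
        by (rule measurable_compose[OF measurable_snd]) (auto intro: measurable_restrict_space1)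
    qed
    from measurable_sets[OF this S'(1)[folded borel_prod]]
    show "S \<in> sets (restrict_space lborel A \<Otimes>\<^sub>M restrict_space lborel B)"
      by (simp add: S'(2) space_pair_measure space_restrict_space Int_commute vimage_def)
  next
    fix S assume "S \<in> sets (restrict_space lborel A \<Otimes>\<^sub>M restrict_space lborel B)"
    moreover have "sets (restrict_space lborel A \<Otimes>\<^sub>M restrict_space lborel B) \<subseteq> sets (restrict_space lborel (A \<times> B))"
      unfolding sets_pair_measure
    proof (rule sets.sigma_sets_subset')
      have Times: "X \<times> Y \<in> sets (restrict_space lborel (A \<times> B))"
        if "X \<in> sets (restrict_space lborel A)" "Y \<in> sets (restrict_space lborel B)" for X Y
        using that AB assms by (auto simp: sets_restrict_space_iff lborel_prod[symmetric])
      then show "{a \<times> b |a b. a \<in> sets (restrict_space lborel A) \<and> b \<in> sets (restrict_space lborel B)}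
        \<subseteq> sets (restrict_space lborel (A \<times> B))" by blast
      show "space (restrict_space lborel A) \<times> space (restrict_space lborel B) \<in> sets (restrict_space lborel (A \<times> B))"
        by (intro Times sets.top)
    qed
    ultimately show "S \<in> sets (restrict_space lborel (A \<times> B))" by blast
  qed
  fix X Y assume "X \<in> sets (restrict_space lborel A)" "Y \<in> sets (restrict_space lborel B)"
  then have XY: "X \<in> sets lborel" "X \<subseteq> A" "Y \<in> sets lborel" "Y \<subseteq> B"
    using assms by (auto simp: sets_restrict_space_iff)
  then have "emeasure (lborel \<Otimes>\<^sub>M lborel) (X \<times> Y) = emeasure lborel X * emeasure lborel Y"
    by (intro lborel.emeasure_pair_measure_Times) auto
  with XY show "emeasure (restrict_space lborel A) X * emeasure (restrict_space lborel B) Y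
    = emeasure (restrict_space lborel (A \<times> B)) (X \<times> Y)"
    using AB assms by (subst (1 2 3) emeasure_restrict_space) (auto simp: lborel_prod)
qed

lemma unif_square_eq: "unif_square = unif_interval \<Otimes>\<^sub>M unif_interval"
  unfolding unif_square_def unif_interval_def unit_square_def
  by (rule restrict_space_lborel_Times[symmetric]) auto

lemma prob_space_unif_interval: "prob_space unif_interval"
  by (rule prob_spaceI) (simp add: unif_interval_def space_restrict_space emeasure_restrict_space)

lemma space_unif_interval [simp]: "space unif_interval = {0..1}"
  by (simp add: unif_interval_def space_restrict_space)

lemma space_unif_square [simp]: "space unif_square = unit_square"
  by (simp add: unif_square_def space_restrict_space)

interpretation UI: prob_space unif_interval by (rule prob_space_unif_interval)
interpretation UII: pair_prob_space unif_interval unif_interval ..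
interpretation US: prob_space unif_square unfolding unif_square_eq by (rule UII.prob_space_axioms)
interpretation UUS: pair_prob_space unif_square unif_square ..
interpretation UUUS: pair_prob_space unif_square "unif_square \<Otimes>\<^sub>M unif_square" ..

lemma sets_unif_interval: "sets unif_interval = sets (restrict_space borel {0..1})"
  unfolding unif_interval_def by (rule sets_restrict_space_cong) simp

lemma sets_unif_square: "sets unif_square = sets (restrict_space borel unit_square)"
  unfolding unif_square_def by (rule sets_restrict_space_cong) simp

lemma unif_square_permuton: "unif_square \<in> permutons"
proof -
  have "distr unif_square (restrict_space borel {0..1}) fst = distr unif_square unif_interval fst"
    by (rule distr_cong) (auto simp: sets_unif_interval)
  also have "\<dots> = unif_interval"
    unfolding unif_square_eq by (rule UI.distr_pair_fst)
  finally have 1: "distr unif_square (restrict_space borel {0..1}) fst = unif_interval" .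
  have "distr unif_square (restrict_space borel {0..1}) snd = distr unif_square unif_interval snd"
    by (rule distr_cong) (auto simp: sets_unif_interval)
  also have "\<dots> = distr (unif_interval \<Otimes>\<^sub>M unif_interval) unif_interval (fst \<circ> (\<lambda>(x, y). (y, x)))"
    unfolding unif_square_eq by (rule distr_cong) auto
  also have "\<dots> = distr (distr (unif_interval \<Otimes>\<^sub>M unif_interval) (unif_interval \<Otimes>\<^sub>M unif_interval) (\<lambda>(x, y). (y, x))) unif_interval fst"
    by (rule distr_distr[symmetric]) auto
  also have "\<dots> = unif_interval"
    unfolding UII.distr_pair_swap[symmetric] by (rule UI.distr_pair_fst)
  finally have 2: "distr unif_square (restrict_space borel {0..1}) snd = unif_interval" .
  show ?thesis
    using 1 2 by (simp add: permutons_def US.prob_space_axioms sets_unif_square)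
qed

text \<open>Gibbs' inequality for a measure given only as absolutely continuous, reduced to the case of a measure
  given by a density through a real-valued Radon--Nikodym derivative.\<close>

lemma (in information_space) KL_pos_ac:
  assumes "prob_space N" and ac: "absolutely_continuous M N" "sets N = sets M"
    and int: "integrable N (entropy_density b M N)" and ne: "N \<noteq> M"
  shows "0 < KL_divergence b M N"
proof -
  interpret N: prob_space N by fact
  have "finite_measure N" by unfold_locales
  from real_RN_deriv[OF this ac] obtain D
    where D: "random_variable borel D" "AE x in M. RN_deriv M N x = ennreal (D x)"
      "AE x in N. 0 < D x" "\<And>x. 0 \<le> D x"
    by this auto
  have "N = density M (RN_deriv M N)" using ac by (rule density_RN_deriv[symmetric])
  also have "\<dots> = density M D" using D by (auto intro!: density_cong)
  finally have N: "N = density M D" .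
  from absolutely_continuous_AE[OF ac(2,1) D(2)] D b_gt_1 ac measurable_entropy_density
  have "integrable N (\<lambda>x. log b (D x))"
    by (intro integrable_cong_AE[THEN iffD2, OF _ _ _ int]) (auto simp: N entropy_density_def)
  with D b_gt_1 have "integrable M (\<lambda>x. D x * log b (D x))"
    by (subst integrable_real_density[symmetric]) (auto simp: N[symmetric] comp_def)
  with \<open>prob_space N\<close> D ne show ?thesis
    unfolding N by (intro KL_gt_0) auto
qed

text \<open>At parameter zero the objective is the negative divergence from the uniform distribution, which is
  uniquely maximised by that distribution itself.\<close>

lemma opt_permuton_0: "opt_permuton f 0 = unif_square"
proof -
  interpret information_space unif_square "exp 1"
    by unfold_locales simp
  have KL0: "KL unif_square unif_square = 0"
  proof -
    have "AE x in unif_square. 1 = RN_deriv unif_square unif_square x"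
      by (rule US.RN_deriv_unique) (auto simp: density_1)
    then have ae: "AE x in unif_square. entropy_density (exp 1) unif_square unif_square x = 0"
      by eventually_elim (simp add: entropy_density_def flip: one_ennreal.rep_eq)
    have "integrable unif_square (entropy_density (exp 1) unif_square unif_square)"
      by (rule integrable_cong_AE[THEN iffD2, OF _ _ ae]) auto
    then show ?thesis
      by (simp add: KL_def absolutely_continuous_def US.KL_same_eq_0 zero_ereal_def)
  qed
  have KLpos: "KL \<nu> unif_square > 0" if "\<nu> \<in> permutons" "\<nu> \<noteq> unif_square" for \<nu>
    using that KL_pos_ac[of \<nu>] by (auto simp: KL_def permutons_def sets_unif_square)
  have obj: "objective f 0 \<mu> = - KL \<mu> unif_square" for \<mu>
    by (simp add: objective_def zero_ereal_def[symmetric])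
  show ?thesis
    unfolding opt_permuton_def
  proof (rule the_equality)
    show "unif_square \<in> permutons \<and> (\<forall>\<nu>\<in>permutons. objective f 0 \<nu> \<le> objective f 0 unif_square)"
      using unif_square_permuton KLpos less_imp_le
      unfolding obj KL0 by (metis KL0 ereal_minus_le_minus order_refl)
    fix \<mu> assume \<mu>: "\<mu> \<in> permutons \<and> (\<forall>\<nu>\<in>permutons. objective f 0 \<nu> \<le> objective f 0 \<mu>)"
    then have "- KL unif_square unif_square \<le> - KL \<mu> unif_square"
      using unif_square_permuton unfolding obj by blast
    then have "KL \<mu> unif_square \<le> 0" by (simp only: KL0 ereal_minus_le_minus)
    with KLpos[of \<mu>] \<mu> show "\<mu> = unif_square" by (meson leD)
  qed
qed

section \<open>The matrices at parameter zero\<close>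

lemma compact_unit_square: "compact unit_square"
  unfolding unit_square_def by (intro compact_Times compact_Icc)

lemma prob_unif_interval [simp]: "measure unif_interval {0..1} = 1"
  using UI.prob_space by simp

lemma prob_unif_square [simp]: "measure unif_square unit_square = 1"
  using US.prob_space by simp

lemma mem_unit_square: "(x, y) \<in> unit_square \<longleftrightarrow> x \<in> {0..1} \<and> y \<in> {0..1}"
  by (simp add: unit_square_def)

lemma continuous_bounded_square:
  fixes h :: "real \<times> real \<Rightarrow> 'a::real_normed_vector"
  assumes "continuous_on unit_square h"
  obtains B where "B \<ge> 0" "\<And>z. z \<in> unit_square \<Longrightarrow> norm (h z) \<le> B"
proof -
  have "bounded (h ` unit_square)"
    by (intro compact_imp_bounded compact_continuous_image assms compact_unit_square)
  then obtain B where B: "\<And>z. z \<in> unit_square \<Longrightarrow> norm (h z) \<le> B"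
    by (auto simp: bounded_iff)
  show ?thesis
  proof
    show "0 \<le> B" by (rule order_trans[OF norm_ge_zero B[of "(0,0)"]]) (simp add: mem_unit_square)
  qed (rule B)
qed

lemma continuous_measurable_square:
  fixes h :: "real \<times> real \<Rightarrow> real"
  assumes "continuous_on unit_square h" shows "h \<in> borel_measurable unif_square"
  using borel_measurable_continuous_on_restrict[OF assms]
  by (simp cong: measurable_cong_sets add: sets_unif_square)

lemma continuous_integrable_square:
  fixes h :: "real \<times> real \<Rightarrow> real"
  assumes "continuous_on unit_square h" shows "integrable unif_square h"
proof -
  obtain B where "\<And>z. z \<in> unit_square \<Longrightarrow> norm (h z) \<le> B"
    using continuous_bounded_square[OF assms] by blast
  then show ?thesis
    by (intro US.integrable_const_bound[of _ B] continuous_measurable_square assms AE_I2) auto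
qed

lemma integral_square_xy:
  fixes h :: "real \<times> real \<Rightarrow> real"
  assumes "continuous_on unit_square h"
  shows "(\<integral>z. h z \<partial>unif_square) = (\<integral>x. (\<integral>y. h (x, y) \<partial>unif_interval) \<partial>unif_interval)"
  unfolding unif_square_eq
  by (rule UII.integral_fst'[symmetric])
     (use continuous_integrable_square[OF assms] in \<open>simp add: unif_square_eq\<close>)

lemma integral_square_yx:
  fixes h :: "real \<times> real \<Rightarrow> real"
  assumes "continuous_on unit_square h"
  shows "(\<integral>z. h z \<partial>unif_square) = (\<integral>y. (\<integral>x. h (x, y) \<partial>unif_interval) \<partial>unif_interval)"
  using UII.integral_snd[of "\<lambda>x y. h (x, y)"] continuous_integrable_square[OF assms]
  by (simp add: unif_square_eq)

lemma integral_interval_cong: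
  fixes h :: "real \<Rightarrow> real"
  shows "(\<And>x. x \<in> {0..1} \<Longrightarrow> h x = k x) \<Longrightarrow> (\<integral>x. h x \<partial>unif_interval) = (\<integral>x. k x \<partial>unif_interval)"
  by (rule Bochner_Integration.integral_cong) auto

locale permuton_family =
  fixes f :: "real \<times> real \<Rightarrow> real ^ 'l"
  assumes class_C: "\<And>r. (\<lambda>z. f z $ r) \<in> class_C"
    and lin_indep: "lin_indep f"
begin

lemma cont_comp: "continuous_on unit_square (\<lambda>z. f z $ r)"
  using class_C[of r] by (simp add: class_C_def)

lemma cont: "continuous_on unit_square f"
  using cont_comp by (subst continuous_on_componentwise) (auto simp: Basis_vec_def inner_axis)

lemma row0: "x \<in> {0..1} \<Longrightarrow> (\<integral>y. f (x, y) $ r \<partial>unif_interval) = 0"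
  using class_C[of r] unfolding class_C_def by blast

lemma col0: "y \<in> {0..1} \<Longrightarrow> (\<integral>x. f (x, y) $ r \<partial>unif_interval) = 0"
  using class_C[of r] unfolding class_C_def by blast

lemma integral_f: "(\<integral>z. f z $ r \<partial>unif_square) = 0"
proof -
  have "(\<integral>z. f z $ r \<partial>unif_square) = (\<integral>x. (\<integral>y. f (x, y) $ r \<partial>unif_interval) \<partial>unif_interval)"
    by (rule integral_square_xy[OF cont_comp])
  also have "\<dots> = (\<integral>x. 0 \<partial>unif_interval)"
    by (rule integral_interval_cong[OF row0])
  finally show ?thesis by simp
qed

lemma cont_row: "x \<in> {0..1} \<Longrightarrow> continuous_on unit_square (\<lambda>z. f (x, snd z) $ r)"
  by (rule continuous_on_compose2[OF cont_comp, of _ "\<lambda>z. (x, snd z)"])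
     (auto intro!: continuous_intros simp: unit_square_def)

lemma cont_col: "y \<in> {0..1} \<Longrightarrow> continuous_on unit_square (\<lambda>z. f (fst z, y) $ r)"
  by (rule continuous_on_compose2[OF cont_comp, of _ "\<lambda>z. (fst z, y)"])
     (auto intro!: continuous_intros simp: unit_square_def)

text \<open>Three of the four terms of the kernel integrate to zero because \<open>f\<close> has zero marginals.\<close>

lemma integral_swap_fun:
  assumes "z1 \<in> unit_square"
  shows "(\<integral>z. swap_fun f z1 z $ p \<partial>unif_square) = f z1 $ p"
proof -
  obtain x y where z1: "z1 = (x, y)" and xy: "x \<in> {0..1}" "y \<in> {0..1}"
    using assms by (auto simp: unit_square_def)
  note cs = cont_comp cont_row[OF xy(1)] cont_col[OF xy(2)]
  note int = cs[THEN continuous_integrable_square]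
  have 1: "(\<integral>z. f z $ p \<partial>unif_square) = 0"
    by (rule integral_f)
  have 2: "(\<integral>z. f (x, snd z) $ p \<partial>unif_square) = 0"
    by (simp add: integral_square_xy[OF cs(2)] row0[OF xy(1)])
  have 3: "(\<integral>z. f (fst z, y) $ p \<partial>unif_square) = 0"
    by (simp add: integral_square_yx[OF cs(3)] col0[OF xy(2)])
  have "(\<integral>z. swap_fun f z1 z $ p \<partial>unif_square)
     = (\<integral>z. f z1 $ p + f z $ p - f (x, snd z) $ p - f (fst z, y) $ p \<partial>unif_square)"
    by (simp add: swap_fun_def z1 split_beta)
  also have "\<dots> = f z1 $ p + 0 - 0 - 0"
    using int by (simp add: 1 2 3 US.prob_space)
  finally show ?thesis by simp
qed

text \<open>Of the sixteen products, those pairing two different terms of the kernel vanish by the zero marginals.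
  The remaining four depend on both, one or none of the coordinates of \<open>z1\<close>.\<close>

lemma integral_swap_fun_mult:
  assumes "z1 \<in> unit_square"
  shows "(\<integral>z. swap_fun f z1 z $ p * swap_fun f z1 z $ q \<partial>unif_square)
    = f z1 $ p * f z1 $ q + Gamma_mat f $ p $ q
      + (\<integral>y. f (fst z1, y) $ p * f (fst z1, y) $ q \<partial>unif_interval)
      + (\<integral>x. f (x, snd z1) $ p * f (x, snd z1) $ q \<partial>unif_interval)"
proof -
  obtain x y where z1: "z1 = (x, y)" and xy: "x \<in> {0..1}" "y \<in> {0..1}"
    using assms by (auto simp: unit_square_def)
  note cs = cont_comp cont_row[OF xy(1)] cont_col[OF xy(2)]
  have cm: "continuous_on unit_square (\<lambda>z. h z * k z)" 
    if "continuous_on unit_square h" "continuous_on unit_square k" for h k :: "real \<times> real \<Rightarrow> real"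
    using that by (intro continuous_intros)
  note int1 = cs[THEN continuous_integrable_square]
  note int2 = cm[OF cs(1) cs(1), THEN continuous_integrable_square] cm[OF cs(1) cs(2), THEN continuous_integrable_square]
    cm[OF cs(1) cs(3), THEN continuous_integrable_square] cm[OF cs(2) cs(1), THEN continuous_integrable_square]
    cm[OF cs(2) cs(2), THEN continuous_integrable_square] cm[OF cs(2) cs(3), THEN continuous_integrable_square]
    cm[OF cs(3) cs(1), THEN continuous_integrable_square] cm[OF cs(3) cs(2), THEN continuous_integrable_square]
    cm[OF cs(3) cs(3), THEN continuous_integrable_square]
  have b: "(\<integral>z. f z $ r \<partial>unif_square) = 0" for r
    by (rule integral_f)
  have c: "(\<integral>z. f (x, snd z) $ r \<partial>unif_square) = 0" for r
    by (simp add: integral_square_xy[OF cs(2)] row0[OF xy(1)])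
  have d: "(\<integral>z. f (fst z, y) $ r \<partial>unif_square) = 0" for r
    by (simp add: integral_square_yx[OF cs(3)] col0[OF xy(2)])
  have bc: "(\<integral>z. f z $ r * f (x, snd z) $ s \<partial>unif_square) = 0" for r s
  proof -
    have "(\<integral>z. f z $ r * f (x, snd z) $ s \<partial>unif_square) = (\<integral>v. 0 \<partial>unif_interval)"
      by (subst integral_square_yx[OF cm[OF cs(1) cs(2)]], rule integral_interval_cong) (simp add: col0)
    then show ?thesis by simp
  qed
  have cb: "(\<integral>z. f (x, snd z) $ s * f z $ r \<partial>unif_square) = 0" for r s
    using bc[of r s] by (simp add: mult.commute)
  have bd: "(\<integral>z. f z $ r * f (fst z, y) $ s \<partial>unif_square) = 0" for r s
  proof -
    have "(\<integral>z. f z $ r * f (fst z, y) $ s \<partial>unif_square) = (\<integral>v. 0 \<partial>unif_interval)"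
      by (subst integral_square_xy[OF cm[OF cs(1) cs(3)]], rule integral_interval_cong) (simp add: row0)
    then show ?thesis by simp
  qed
  have db: "(\<integral>z. f (fst z, y) $ s * f z $ r \<partial>unif_square) = 0" for r s
    using bd[of r s] by (simp add: mult.commute)
  have cd: "(\<integral>z. f (x, snd z) $ r * f (fst z, y) $ s \<partial>unif_square) = 0" for r s
    by (subst integral_square_xy[OF cm[OF cs(2) cs(3)]]) (simp add: row0[OF xy(1)])
  have dc: "(\<integral>z. f (fst z, y) $ s * f (x, snd z) $ r \<partial>unif_square) = 0" for r s
    using cd[of r s] by (simp add: mult.commute)
  have cc: "(\<integral>z. f (x, snd z) $ p * f (x, snd z) $ q \<partial>unif_square)
      = (\<integral>y. f (x, y) $ p * f (x, y) $ q \<partial>unif_interval)"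
    by (subst integral_square_xy[OF cm[OF cs(2) cs(2)]]) (simp add: UI.prob_space)
  have dd: "(\<integral>z. f (fst z, y) $ p * f (fst z, y) $ q \<partial>unif_square)
      = (\<integral>x. f (x, y) $ p * f (x, y) $ q \<partial>unif_interval)"
    by (subst integral_square_yx[OF cm[OF cs(3) cs(3)]]) (simp add: UI.prob_space)
  have bb: "(\<integral>z. f z $ p * f z $ q \<partial>unif_square) = Gamma_mat f $ p $ q"
    by (simp add: Gamma_mat_def)
  have "(\<integral>z. swap_fun f z1 z $ p * swap_fun f z1 z $ q \<partial>unif_square)
     = (\<integral>z. f z1 $ p * f z1 $ q
         + f z1 $ p * f z $ q - f z1 $ p * f (x, snd z) $ q - f z1 $ p * f (fst z, y) $ q
         + f z1 $ q * f z $ p - f z1 $ q * f (x, snd z) $ p - f z1 $ q * f (fst z, y) $ p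
         + f z $ p * f z $ q - f z $ p * f (x, snd z) $ q - f z $ p * f (fst z, y) $ q
         - f (x, snd z) $ p * f z $ q + f (x, snd z) $ p * f (x, snd z) $ q + f (x, snd z) $ p * f (fst z, y) $ q
         - f (fst z, y) $ p * f z $ q + f (fst z, y) $ p * f (x, snd z) $ q + f (fst z, y) $ p * f (fst z, y) $ q
        \<partial>unif_square)"
    by (rule Bochner_Integration.integral_cong) (simp_all add: swap_fun_def z1 split_beta algebra_simps)
  also have "\<dots> = f z1 $ p * f z1 $ q + Gamma_mat f $ p $ q
      + (\<integral>y. f (x, y) $ p * f (x, y) $ q \<partial>unif_interval)
      + (\<integral>x. f (x, y) $ p * f (x, y) $ q \<partial>unif_interval)"
    using int1 int2 by (simp add: b c d bb bc cb bd db cd dc cc dd US.prob_space)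
  finally show ?thesis by (simp add: z1)
qed

lemma swap_fun_bound:
  obtains B where "B \<ge> 0" "\<And>z1 z2 p. z1 \<in> unit_square \<Longrightarrow> z2 \<in> unit_square \<Longrightarrow> \<bar>swap_fun f z1 z2 $ p\<bar> \<le> B"
proof -
  obtain B where B: "B \<ge> 0" "\<And>z. z \<in> unit_square \<Longrightarrow> norm (f z) \<le> B"
    using continuous_bounded_square[OF cont] by blast
  have B': "\<bar>f (x, y) $ p\<bar> \<le> B" if "x \<in> {0..1}" "y \<in> {0..1}" for x y p
    using that B(2)[of "(x, y)"] component_le_norm_cart[of "f (x, y)" p] by (force simp: mem_unit_square)
  have "\<bar>swap_fun f z1 z2 $ p\<bar> \<le> 4 * B" if "z1 \<in> unit_square" "z2 \<in> unit_square" for z1 z2 p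
  proof -
    obtain x1 y1 x2 y2 where z: "z1 = (x1, y1)" "z2 = (x2, y2)" by fastforce
    show ?thesis
      using that B'[of x1 y1 p] B'[of x2 y2 p] B'[of x1 y2 p] B'[of x2 y1 p]
      unfolding z mem_unit_square swap_fun_def by (auto simp: abs_le_iff)
  qed
  with B(1) show ?thesis by (intro that[of "4 * B"]) auto
qed

lemma swap_fun_measurable:
  "(\<lambda>(z1, z2). swap_fun f z1 z2 $ p) \<in> borel_measurable (unif_square \<Otimes>\<^sub>M unif_square)"
proof -
  have F[measurable]: "(\<lambda>z. f z $ p) \<in> borel_measurable (unif_interval \<Otimes>\<^sub>M unif_interval)"
    using continuous_measurable_square[OF cont_comp] by (simp add: unif_square_eq)
  have [measurable]: "(\<lambda>w. f (a w, b w) $ p) \<in> borel_measurable M"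
    if "a \<in> M \<rightarrow>\<^sub>M unif_interval" "b \<in> M \<rightarrow>\<^sub>M unif_interval" for M :: "'b measure" and a b
    by (rule measurable_compose[OF measurable_Pair[OF that] F])
  show ?thesis
    unfolding unif_square_eq by (simp add: swap_fun_def split_beta) measurable
qed

text \<open>Averaging the remaining coordinate turns each one-coordinate term into a full integral, so each of the four
  surviving terms contributes the same entry of \<open>\<Gamma>\<close>.\<close>

lemma Gamma_eq_rows:
  "(\<integral>z. (\<integral>y. f (fst z, y) $ p * f (fst z, y) $ q \<partial>unif_interval) \<partial>unif_square) = Gamma_mat f $ p $ q"
  "integrable unif_square (\<lambda>z. (\<integral>y. f (fst z, y) $ p * f (fst z, y) $ q \<partial>unif_interval))"
proof -
  have c: "continuous_on unit_square (\<lambda>z. f z $ p * f z $ q)" by (intro continuous_intros cont_comp)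
  let ?R = "\<lambda>x. \<integral>y. f (x, y) $ p * f (x, y) $ q \<partial>unif_interval"
  have R: "integrable unif_interval ?R"
    using UII.integrable_fst'[of "\<lambda>z. f z $ p * f z $ q"] continuous_integrable_square[OF c]
    by (simp add: unif_square_eq)
  have "integrable (distr unif_square unif_interval fst) ?R"
    unfolding unif_square_eq UI.distr_pair_fst by (rule R)
  then show int: "integrable unif_square (\<lambda>z. ?R (fst z))"
    by (subst (asm) integrable_distr_eq) (use R in \<open>auto simp: unif_square_eq\<close>)
  show "(\<integral>z. ?R (fst z) \<partial>unif_square) = Gamma_mat f $ p $ q"
    using UII.integral_fst'[of "\<lambda>z. ?R (fst z)"] int
    by (simp add: unif_square_eq UI.prob_space Gamma_mat_def integral_square_xy[OF c, unfolded unif_square_eq])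
qed

lemma Gamma_eq_cols:
  "(\<integral>z. (\<integral>x. f (x, snd z) $ p * f (x, snd z) $ q \<partial>unif_interval) \<partial>unif_square) = Gamma_mat f $ p $ q"
  "integrable unif_square (\<lambda>z. (\<integral>x. f (x, snd z) $ p * f (x, snd z) $ q \<partial>unif_interval))"
proof -
  have c: "continuous_on unit_square (\<lambda>z. f z $ p * f z $ q)" by (intro continuous_intros cont_comp)
  let ?R = "\<lambda>y. \<integral>x. f (x, y) $ p * f (x, y) $ q \<partial>unif_interval"
  have R: "integrable unif_interval ?R"
    using UII.integrable_snd[of "\<lambda>x y. f (x, y) $ p * f (x, y) $ q"] continuous_integrable_square[OF c]
    by (simp add: unif_square_eq case_prod_unfold)
  have sw: "distr unif_square unif_interval snd = unif_interval"
    using unif_square_permuton by (simp add: permutons_def cong: distr_cong) 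
      (metis distr_cong sets_unif_interval)
  then have "integrable (distr unif_square unif_interval snd) ?R" using R by simp
  then show int: "integrable unif_square (\<lambda>z. ?R (snd z))"
    by (subst (asm) integrable_distr_eq) (use R in \<open>auto simp: unif_square_eq\<close>)
  show "(\<integral>z. ?R (snd z) \<partial>unif_square) = Gamma_mat f $ p $ q"
    using UII.integral_snd[of "\<lambda>x y. ?R y"] int
    by (simp add: unif_square_eq UI.prob_space Gamma_mat_def integral_square_yx[OF c, unfolded unif_square_eq] case_prod_unfold)
qed

text \<open>The second moment of the kernel is \<open>4 * \<Gamma>\<close>, the logistic weight at zero is \<open>1 / 4\<close>, and the definition carries
  a factor \<open>1 / 2\<close>.\<close>

lemma A_mat_0: "A_mat f 0 = (1/2) *\<^sub>R Gamma_mat f"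
proof -
  obtain B where B: "B \<ge> 0" "\<And>z1 z2 p. z1 \<in> unit_square \<Longrightarrow> z2 \<in> unit_square \<Longrightarrow> \<bar>swap_fun f z1 z2 $ p\<bar> \<le> B"
    using swap_fun_bound by blast
  have "(\<integral>z. (case z of (z1, z2) \<Rightarrow> swap_fun f z1 z2 $ p * swap_fun f z1 z2 $ q) \<partial>(unif_square \<Otimes>\<^sub>M unif_square))
      = 4 * Gamma_mat f $ p $ q" for p q
  proof -
    let ?h = "\<lambda>z. case z of (z1, z2) \<Rightarrow> swap_fun f z1 z2 $ p * swap_fun f z1 z2 $ q"
    have meas: "?h \<in> borel_measurable (unif_square \<Otimes>\<^sub>M unif_square)"
      using borel_measurable_times[OF swap_fun_measurable[of p] swap_fun_measurable[of q]]
      by (simp add: split_beta)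
    have int: "integrable (unif_square \<Otimes>\<^sub>M unif_square) ?h"
    proof (rule UUS.integrable_const_bound[of _ "B * B"])
      show "AE z in unif_square \<Otimes>\<^sub>M unif_square. norm (?h z) \<le> B * B"
        by (rule AE_I2) (auto simp: space_pair_measure abs_mult intro!: mult_mono B)
    qed (rule meas)
    have cm: "continuous_on unit_square (\<lambda>z. f z $ p * f z $ q)" by (intro continuous_intros cont_comp)
    have "(\<integral>z. ?h z \<partial>(unif_square \<Otimes>\<^sub>M unif_square)) = (\<integral>z1. (\<integral>z2. ?h (z1, z2) \<partial>unif_square) \<partial>unif_square)"
      by (rule UUS.integral_fst'[OF int, symmetric])
    also have "\<dots> = (\<integral>z1. f z1 $ p * f z1 $ q + Gamma_mat f $ p $ q
      + (\<integral>y. f (fst z1, y) $ p * f (fst z1, y) $ q \<partial>unif_interval)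
      + (\<integral>x. f (x, snd z1) $ p * f (x, snd z1) $ q \<partial>unif_interval) \<partial>unif_square)"
      by (rule Bochner_Integration.integral_cong) (auto simp: integral_swap_fun_mult)
    also have "\<dots> = 4 * Gamma_mat f $ p $ q"
      using Gamma_eq_rows Gamma_eq_cols continuous_integrable_square[OF cm]
      by (simp add: US.prob_space) (simp add: Gamma_mat_def)
    finally show ?thesis .
  qed
  then show ?thesis
    by (simp add: A_mat_def opt_permuton_0 Let_def vec_eq_iff case_prod_unfold power2_eq_square)
qed

text \<open>Given \<open>z1\<close>, the variables \<open>z2\<close> and \<open>z3\<close> are independent and each factor has conditional mean \<open>f z1\<close>; the
  logistic weights are both \<open>1 / 2\<close>.\<close>

lemma Sigma_mat_0: "Sigma_mat f 0 = (1/4) *\<^sub>R Gamma_mat f"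
proof -
  obtain B where B: "B \<ge> 0" "\<And>z1 z2 p. z1 \<in> unit_square \<Longrightarrow> z2 \<in> unit_square \<Longrightarrow> \<bar>swap_fun f z1 z2 $ p\<bar> \<le> B"
    using swap_fun_bound by blast
  let ?U = "unif_square"
  have "(\<integral>z. (case z of (z1, z2, z3) \<Rightarrow> swap_fun f z1 z2 $ p * swap_fun f z1 z3 $ q) \<partial>(?U \<Otimes>\<^sub>M ?U \<Otimes>\<^sub>M ?U))
      = Gamma_mat f $ p $ q" for p q
  proof -
    let ?h = "\<lambda>z. case z of (z1, z2, z3) \<Rightarrow> swap_fun f z1 z2 $ p * swap_fun f z1 z3 $ q"
    have m[measurable]: "(\<lambda>w. swap_fun f (a w) (b w) $ r) \<in> borel_measurable M"
      if "a \<in> M \<rightarrow>\<^sub>M ?U" "b \<in> M \<rightarrow>\<^sub>M ?U" for M :: "'b measure" and a b r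
      using measurable_compose[OF measurable_Pair[OF that] swap_fun_measurable[of r]] by simp
    have meas: "?h \<in> borel_measurable (?U \<Otimes>\<^sub>M ?U \<Otimes>\<^sub>M ?U)"
      unfolding split_beta by measurable
    have int: "integrable (?U \<Otimes>\<^sub>M ?U \<Otimes>\<^sub>M ?U) ?h"
    proof (rule UUUS.integrable_const_bound[of _ "B * B"])
      show "AE z in ?U \<Otimes>\<^sub>M ?U \<Otimes>\<^sub>M ?U. norm (?h z) \<le> B * B"
        by (rule AE_I2) (auto simp: space_pair_measure abs_mult intro!: mult_mono B)
    qed (rule meas)
    have inner: "(\<integral>w. ?h (z1, w) \<partial>(?U \<Otimes>\<^sub>M ?U)) = f z1 $ p * f z1 $ q" if z1: "z1 \<in> unit_square" for z1
    proof -
      have c: "(\<lambda>_. z1) \<in> M \<rightarrow>\<^sub>M ?U" for M :: "'b measure" using z1 by (intro measurable_const) simp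
      note c[measurable]
      have int: "integrable (?U \<Otimes>\<^sub>M ?U) (\<lambda>w. ?h (z1, w))"
      proof (rule UUS.integrable_const_bound[of _ "B * B"])
        show "AE z in ?U \<Otimes>\<^sub>M ?U. norm (?h (z1, z)) \<le> B * B"
          by (rule AE_I2) (use z1 in \<open>auto simp: space_pair_measure abs_mult intro!: mult_mono B\<close>)
        show "(\<lambda>w. ?h (z1, w)) \<in> borel_measurable (?U \<Otimes>\<^sub>M ?U)"
          unfolding split_beta fst_conv snd_conv by (intro borel_measurable_times m measurable_const) (auto simp: z1)
      qed
      have "(\<integral>w. ?h (z1, w) \<partial>(?U \<Otimes>\<^sub>M ?U))
        = (\<integral>z2. (\<integral>z3. swap_fun f z1 z2 $ p * swap_fun f z1 z3 $ q \<partial>?U) \<partial>?U)"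
        using UUS.integral_fst'[OF int] by simp
      also have "\<dots> = f z1 $ p * f z1 $ q"
        by (simp add: integral_swap_fun[OF z1])
      finally show ?thesis .
    qed
    have "(\<integral>z. ?h z \<partial>(?U \<Otimes>\<^sub>M ?U \<Otimes>\<^sub>M ?U)) = (\<integral>z1. (\<integral>w. ?h (z1, w) \<partial>(?U \<Otimes>\<^sub>M ?U)) \<partial>?U)"
      by (rule UUUS.integral_fst'[OF int, symmetric])
    also have "\<dots> = (\<integral>z1. f z1 $ p * f z1 $ q \<partial>?U)"
      by (rule Bochner_Integration.integral_cong[OF refl inner]) simp
    finally show ?thesis by (simp add: Gamma_mat_def)
  qed
  then show ?thesis
    by (simp add: Sigma_mat_def opt_permuton_0 Let_def vec_eq_iff case_prod_unfold)
qed

lemma Gamma_quadratic: "d \<bullet> (Gamma_mat f *v e) = (\<integral>z. (d \<bullet> f z) * (e \<bullet> f z) \<partial>unif_square)"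
proof -
  have int: "integrable unif_square (\<lambda>z. f z $ p * f z $ q)" for p q
    by (intro continuous_integrable_square continuous_intros cont_comp)
  have "(\<integral>z. (d \<bullet> f z) * (e \<bullet> f z) \<partial>unif_square)
     = (\<integral>z. (\<Sum>p\<in>UNIV. \<Sum>q\<in>UNIV. (d $ p * e $ q) * (f z $ p * f z $ q)) \<partial>unif_square)"
    by (simp add: inner_vec_def sum_product mult_ac)
  also have "\<dots> = (\<Sum>p\<in>UNIV. \<Sum>q\<in>UNIV. (d $ p * e $ q) * Gamma_mat f $ p $ q)"
    using int by (simp add: Gamma_mat_def)
  also have "\<dots> = d \<bullet> (Gamma_mat f *v e)"
    by (simp add: inner_vec_def matrix_vector_mult_def sum_distrib_left mult_ac)
  finally show ?thesis by simp
qed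

text \<open>A vanishing quadratic form would make \<open>d \<bullet> f\<close> zero almost everywhere, against linear independence.\<close>

lemma Gamma_pos: assumes "d \<noteq> 0" shows "0 < d \<bullet> (Gamma_mat f *v d)"
proof -
  have c: "continuous_on unit_square (\<lambda>z. (d \<bullet> f z) * (d \<bullet> f z))"
    by (intro continuous_intros cont)
  have "0 \<le> (\<integral>z. (d \<bullet> f z) * (d \<bullet> f z) \<partial>unif_square)" by simp
  moreover have "(\<integral>z. (d \<bullet> f z) * (d \<bullet> f z) \<partial>unif_square) \<noteq> 0"
  proof
    assume "(\<integral>z. (d \<bullet> f z) * (d \<bullet> f z) \<partial>unif_square) = 0"
    then have "AE z in unif_square. (d \<bullet> f z) * (d \<bullet> f z) = 0"
      by (subst (asm) integral_nonneg_eq_0_iff_AE[OF continuous_integrable_square[OF c]]) auto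
    then have "AE z in unif_square. d \<bullet> f z = 0" by simp
    with lin_indep assms show False unfolding lin_indep_def by blast
  qed
  ultimately show ?thesis unfolding Gamma_quadratic by linarith
qed

lemma Gamma_symmetric: "d \<bullet> (Gamma_mat f *v e) = e \<bullet> (Gamma_mat f *v d)"
  by (simp add: Gamma_quadratic mult.commute)

lemma Gamma_lower_bound:
  obtains c where "c > 0" "\<And>d. c * (norm d)\<^sup>2 \<le> d \<bullet> (Gamma_mat f *v d)"
proof -
  have cont: "continuous_on (sphere 0 1) (\<lambda>d. d \<bullet> (Gamma_mat f *v d))"
    by (intro continuous_intros matrix_vector_mult_linear_continuous_on)
  obtain u :: "real ^ 'l" where "norm u = 1" using vector_choose_size[of 1] by auto
  then have "sphere 0 1 \<noteq> ({} :: (real ^ 'l) set)" by auto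
  from continuous_attains_inf[OF compact_sphere this cont]
  obtain m where m: "m \<in> sphere 0 1" "\<And>d. d \<in> sphere 0 1 \<Longrightarrow> m \<bullet> (Gamma_mat f *v m) \<le> d \<bullet> (Gamma_mat f *v d)"
    by blast
  show ?thesis
  proof
    show "0 < m \<bullet> (Gamma_mat f *v m)" using m(1) by (intro Gamma_pos) auto
    fix d :: "real ^ 'l"
    show "m \<bullet> (Gamma_mat f *v m) * (norm d)\<^sup>2 \<le> d \<bullet> (Gamma_mat f *v d)"
    proof (cases "d = 0")
      case False
      let ?e = "(1 / norm d) *\<^sub>R d"
      have "m \<bullet> (Gamma_mat f *v m) \<le> ?e \<bullet> (Gamma_mat f *v ?e)"
        using False by (intro m(2)) simp
      also have "\<dots> = (d \<bullet> (Gamma_mat f *v d)) / (norm d)\<^sup>2"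
        by (simp add: matrix_vector_mult_scaleR power2_eq_square)
      finally show ?thesis using False by (simp add: field_simps)
    qed simp
  qed
qed

lemma invertible_Gamma: "invertible (Gamma_mat f)"
proof -
  have "x = 0" if "Gamma_mat f *v x = 0" for x
    using Gamma_pos[of x] that by auto
  then show ?thesis
    unfolding invertible_left_inverse matrix_left_invertible_ker by blast
qed

end

lemma matrix_inv_eqI:
  fixes A :: "real ^ 'n ^ 'n"
  assumes "A ** B = mat 1" "B ** A = mat 1"
  shows "matrix_inv A = B"
proof -
  have "A ** matrix_inv A = mat 1"
    using assms unfolding matrix_inv_def by (rule_tac someI2[of _ B]) auto
  then have "B ** (A ** matrix_inv A) = B" by simp
  then show ?thesis by (simp add: matrix_mul_assoc assms)
qed

lemma matrix_inv_mult:
  fixes A :: "real ^ 'n ^ 'n"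
  assumes "invertible A"
  shows "A ** matrix_inv A = mat 1" "matrix_inv A ** A = mat 1"
proof -
  obtain B where B: "A ** B = mat 1" "B ** A = mat 1" using assms unfolding invertible_def by blast
  show "A ** matrix_inv A = mat 1" "matrix_inv A ** A = mat 1"
    using B matrix_inv_eqI[OF B] by auto
qed

context permuton_family
begin

lemma sandwich_identity:
  "invertible (A_mat f 0)"
  "matrix_inv (A_mat f 0) ** Sigma_mat f 0 ** matrix_inv (A_mat f 0) = matrix_inv (Gamma_mat f)"
proof -
  let ?G = "Gamma_mat f" and ?H = "matrix_inv (Gamma_mat f)"
  note inv = matrix_inv_mult[OF invertible_Gamma]
  have 1: "A_mat f 0 ** (2 *\<^sub>R ?H) = mat 1" "(2 *\<^sub>R ?H) ** A_mat f 0 = mat 1"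
    by (simp_all add: A_mat_0 matrix_scalar_ac inv flip: scalar_matrix_assoc)
  then show "invertible (A_mat f 0)" unfolding invertible_def by blast
  have "matrix_inv (A_mat f 0) = 2 *\<^sub>R ?H" using 1 by (rule matrix_inv_eqI)
  then show "matrix_inv (A_mat f 0) ** Sigma_mat f 0 ** matrix_inv (A_mat f 0) = ?H"
    by (simp add: Sigma_mat_0 matrix_scalar_ac inv flip: scalar_matrix_assoc)
qed

end

section \<open>Riemann sums on the unit square\<close>

text \<open>The error is accumulated interval by interval; each of the \<open>n\<close> intervals contributes at most \<open>e / n\<close>.\<close>

lemma riemann_sum_error:
  fixes h :: "real \<Rightarrow> real"
  assumes h: "continuous_on {0..1} h" and n: "n > 0"
    and osc: "\<And>x y. x \<in> {0..1} \<Longrightarrow> y \<in> {0..1} \<Longrightarrow> \<bar>x - y\<bar> \<le> 1 / real n \<Longrightarrow> \<bar>h x - h y\<bar> \<le> e"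
  shows "\<bar>(\<integral>x. h x \<partial>unif_interval) - (\<Sum>j = 1..n. h (real j / real n)) / real n\<bar> \<le> e"
proof -
  have n0: "real n > 0" using n by simp
  have part: "\<bar>integral {0..real k / real n} h - (\<Sum>j = 1..k. h (real j / real n)) / real n\<bar> \<le> real k * (e / real n)"
    if "k \<le> n" for k
    using that
  proof (induction k)
    case 0
    then show ?case by simp
  next
    case (Suc k)
    let ?a = "real k / real n" and ?b = "real (Suc k) / real n"
    have ab: "0 \<le> ?a" "?a \<le> ?b" "?b \<le> 1" "?b - ?a = 1 / real n"
      using Suc.prems n0 by (auto simp: field_simps)
    have hab: "continuous_on {?a..?b} h" by (rule continuous_on_subset[OF h]) (use ab in auto)
    have split: "integral {0..?b} h = integral {0..?a} h + integral {?a..?b} h"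
      by (rule Henstock_Kurzweil_Integration.integral_combine[symmetric])
         (use ab in \<open>auto intro!: integrable_continuous_interval continuous_on_subset[OF h]\<close>)
    have "integral {?a..?b} (\<lambda>x. h x - h ?b) = integral {?a..?b} h - integral {?a..?b} (\<lambda>x. h ?b)"
      using hab by (intro Henstock_Kurzweil_Integration.integral_diff integrable_continuous_interval) auto
    then have eq: "integral {?a..?b} (\<lambda>x. h x - h ?b) = integral {?a..?b} h - h ?b / real n"
      using ab by simp
    have "norm (integral {?a..?b} (\<lambda>x. h x - h ?b)) \<le> e * (?b - ?a)"
    proof (rule integral_bound)
      show "continuous_on {?a..?b} (\<lambda>x. h x - h ?b)" using hab by (intro continuous_intros)
      show "norm (h t - h ?b) \<le> e" if "t \<in> {?a..?b}" for t
        unfolding real_norm_def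
      proof (rule osc)
        show "t \<in> {0..1}" "?b \<in> {0..1}" "\<bar>t - ?b\<bar> \<le> 1 / real n"
          using that ab unfolding atLeastAtMost_iff by linarith+
      qed
    qed (use ab in simp)
    then have "\<bar>integral {?a..?b} h - h ?b / real n\<bar> \<le> e / real n" unfolding eq using ab by simp
    moreover have "(\<Sum>j = 1..Suc k. h (real j / real n)) / real n
      = (\<Sum>j = 1..k. h (real j / real n)) / real n + h ?b / real n"
      by (simp add: add_divide_distrib)
    moreover have "real (Suc k) * (e / real n) = real k * (e / real n) + e / real n"
      by (simp add: distrib_right add_divide_distrib)
    moreover have "\<bar>integral {0..?a} h - (\<Sum>j = 1..k. h (real j / real n)) / real n\<bar> \<le> real k * (e / real n)"
      using Suc by simp
    ultimately show ?case unfolding split by linarith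
  qed
  have "(\<integral>x. h x \<partial>unif_interval) = (LINT x:{0..1}|lborel. h x)"
    by (simp add: unif_interval_def integral_restrict_space set_lebesgue_integral_def)
  also have "\<dots> = integral {0..1} h"
    by (rule set_borel_integral_eq_integral(2)) (rule borel_integrable_atLeastAtMost'[OF h])
  finally show ?thesis using part[of n] n0 by simp
qed

lemma grid_mem: "n > 0 \<Longrightarrow> j \<in> {1..n} \<Longrightarrow> real j / real n \<in> {0..1}"
  by (auto simp: field_simps)

lemma uniform_oscillation:
  fixes K :: "real \<times> real \<Rightarrow> real"
  assumes K: "continuous_on unit_square K" and e: "e > 0"
  obtains d where "d > 0" "\<And>z z'. z \<in> unit_square \<Longrightarrow> z' \<in> unit_square \<Longrightarrow> dist z z' < d \<Longrightarrow> \<bar>K z - K z'\<bar> \<le> e"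
proof -
  have "uniformly_continuous_on unit_square K"
    by (rule compact_uniformly_continuous[OF K compact_unit_square])
  then obtain d where d: "d > 0" "\<And>z z'. z \<in> unit_square \<Longrightarrow> z' \<in> unit_square \<Longrightarrow> dist z' z < d \<Longrightarrow> dist (K z') (K z) < e"
    using e unfolding uniformly_continuous_on_def by meson
  show ?thesis
    by (rule that[OF d(1)]) (use d(2) in \<open>force simp: dist_real_def dist_commute\<close>)
qed

lemma continuous_on_section:
  fixes K :: "real \<times> real \<Rightarrow> real"
  assumes K: "continuous_on unit_square K"
  shows "x \<in> {0..1} \<Longrightarrow> continuous_on {0..1} (\<lambda>y. K (x, y))" "y \<in> {0..1} \<Longrightarrow> continuous_on {0..1} (\<lambda>x. K (x, y))"
  by (auto intro!: continuous_on_compose2[OF K] continuous_intros simp: mem_unit_square)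

lemma integrable_section:
  fixes h :: "real \<Rightarrow> real"
  assumes "continuous_on {0..1} h" shows "integrable unif_interval h"
proof -
  have "set_integrable lborel {0..1} h" by (rule borel_integrable_atLeastAtMost'[OF assms])
  then show ?thesis
    by (simp add: unif_interval_def integrable_restrict_space set_integrable_def)
qed

lemma riemann_rows:
  fixes K :: "real \<times> real \<Rightarrow> real"
  assumes K: "continuous_on unit_square K" and e: "e > 0"
  shows "\<forall>\<^sub>F n in sequentially. \<forall>x\<in>{0..1}.
    \<bar>(\<integral>y. K (x, y) \<partial>unif_interval) - (\<Sum>j = 1..n. K (x, real j / real n)) / real n\<bar> \<le> e"
    "\<forall>\<^sub>F n in sequentially. \<forall>y\<in>{0..1}.
    \<bar>(\<integral>x. K (x, y) \<partial>unif_interval) - (\<Sum>j = 1..n. K (real j / real n, y)) / real n\<bar> \<le> e"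
proof -
  obtain d where d: "d > 0" "\<And>z z'. z \<in> unit_square \<Longrightarrow> z' \<in> unit_square \<Longrightarrow> dist z z' < d \<Longrightarrow> \<bar>K z - K z'\<bar> \<le> e"
    using uniform_oscillation[OF K e] by blast
  have large: "\<forall>\<^sub>F n in sequentially. n > 0 \<and> 1 / real n < d"
    using d(1) by (intro eventually_conj eventually_gt_at_top order_tendstoD(2)[OF lim_1_over_n]) auto
  then show "\<forall>\<^sub>F n in sequentially. \<forall>x\<in>{0..1}.
    \<bar>(\<integral>y. K (x, y) \<partial>unif_interval) - (\<Sum>j = 1..n. K (x, real j / real n)) / real n\<bar> \<le> e"
  proof eventually_elim
    case (elim n)
    show ?case
    proof
      fix x :: real assume x: "x \<in> {0..1}"
      show "\<bar>(\<integral>y. K (x, y) \<partial>unif_interval) - (\<Sum>j = 1..n. K (x, real j / real n)) / real n\<bar> \<le> e"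
        by (rule riemann_sum_error[OF continuous_on_section(1)[OF K x]])
           (use elim x in \<open>auto intro!: d(2) simp: mem_unit_square dist_Pair_Pair dist_real_def\<close>)
    qed
  qed
  from large show "\<forall>\<^sub>F n in sequentially. \<forall>y\<in>{0..1}.
    \<bar>(\<integral>x. K (x, y) \<partial>unif_interval) - (\<Sum>j = 1..n. K (real j / real n, y)) / real n\<bar> \<le> e"
  proof eventually_elim
    case (elim n)
    show ?case
    proof
      fix y :: real assume y: "y \<in> {0..1}"
      show "\<bar>(\<integral>x. K (x, y) \<partial>unif_interval) - (\<Sum>j = 1..n. K (real j / real n, y)) / real n\<bar> \<le> e"
        by (rule riemann_sum_error[OF continuous_on_section(2)[OF K y]])
           (use elim y in \<open>auto intro!: d(2) simp: mem_unit_square dist_Pair_Pair dist_real_def\<close>)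
    qed
  qed
qed

text \<open>The one-dimensional estimate is applied to the rows, uniformly in the row, and then to the function
  of row integrals, which inherits the modulus of continuity.\<close>

lemma riemann_square:
  fixes K :: "real \<times> real \<Rightarrow> real"
  assumes K: "continuous_on unit_square K"
  shows "(\<lambda>n. (\<Sum>i = 1..n. \<Sum>j = 1..n. K (real i / real n, real j / real n)) / (real n)\<^sup>2)
    \<longlonglongrightarrow> (\<integral>z. K z \<partial>unif_square)"
proof (rule tendstoI)
  fix e :: real assume e: "e > 0"
  define h where "h x = (\<integral>y. K (x, y) \<partial>unif_interval)" for x
  have hc: "\<bar>h x - h x'\<bar> \<le> r" 
    if "x \<in> {0..1}" "x' \<in> {0..1}" "\<And>y. y \<in> {0..1} \<Longrightarrow> \<bar>K (x, y) - K (x', y)\<bar> \<le> r" for x x' r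
  proof -
    have i: "integrable unif_interval (\<lambda>y. K (x, y))" "integrable unif_interval (\<lambda>y. K (x', y))"
      using that by (auto intro!: integrable_section continuous_on_section K)
    have "\<bar>h x - h x'\<bar> = \<bar>\<integral>y. K (x, y) - K (x', y) \<partial>unif_interval\<bar>"
      using i by (simp add: h_def)
    also have "\<dots> \<le> (\<integral>y. \<bar>K (x, y) - K (x', y)\<bar> \<partial>unif_interval)" by (rule integral_abs_bound)
    also have "\<dots> \<le> (\<integral>y. r \<partial>unif_interval)"
      using i that(3) by (intro integral_mono) auto
    finally show ?thesis by simp
  qed
  have cont: "continuous_on {0..1} h"
    unfolding continuous_on_iff
  proof (intro ballI allI impI)
    fix x r :: real assume x: "x \<in> {0..1}" and r: "r > 0"
    then obtain d where d: "d > 0" "\<And>z z'. z \<in> unit_square \<Longrightarrow> z' \<in> unit_square \<Longrightarrow> dist z z' < d \<Longrightarrow> \<bar>K z - K z'\<bar> \<le> r / 2"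
      using uniform_oscillation[OF K, of "r / 2"] by auto
    show "\<exists>d>0. \<forall>x'\<in>{0..1}. dist x' x < d \<longrightarrow> dist (h x') (h x) < r"
    proof (intro exI conjI ballI impI)
      fix x' assume x': "x' \<in> {0..1}" "dist x' x < d"
      have "\<bar>h x' - h x\<bar> \<le> r / 2"
      proof (rule hc[OF x'(1) x])
        fix y :: real assume "y \<in> {0..1}"
        then show "\<bar>K (x', y) - K (x, y)\<bar> \<le> r / 2"
          by (intro d(2)) (use x x' in \<open>simp_all add: mem_unit_square dist_Pair_Pair\<close>)
      qed
      then show "dist (h x') (h x) < r" using r by (simp add: dist_real_def)
    qed (rule d)
  qed
  obtain d where d: "d > 0" "\<And>z z'. z \<in> unit_square \<Longrightarrow> z' \<in> unit_square \<Longrightarrow> dist z z' < d \<Longrightarrow> \<bar>K z - K z'\<bar> \<le> e / 3"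
    using uniform_oscillation[OF K, of "e / 3"] e by auto
  have "\<forall>\<^sub>F n in sequentially. n > 0 \<and> 1 / real n < d"
    using d(1) by (intro eventually_conj eventually_gt_at_top order_tendstoD(2)[OF lim_1_over_n]) auto
  moreover have "\<forall>\<^sub>F n in sequentially. \<forall>x\<in>{0..1}.
    \<bar>h x - (\<Sum>j = 1..n. K (x, real j / real n)) / real n\<bar> \<le> e / 3"
    unfolding h_def by (rule riemann_rows(1)[OF K]) (use e in simp)
  ultimately show "\<forall>\<^sub>F n in sequentially. dist ((\<Sum>i = 1..n. \<Sum>j = 1..n. K (real i / real n, real j / real n)) / (real n)\<^sup>2)
     (\<integral>z. K z \<partial>unif_square) < e"
  proof eventually_elim
    case (elim n)
    then have n0: "real n > 0" by simp
    have 1: "\<bar>(\<integral>x. h x \<partial>unif_interval) - (\<Sum>i = 1..n. h (real i / real n)) / real n\<bar> \<le> e / 3"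
    proof (rule riemann_sum_error[OF cont])
      fix x x' :: real assume x: "x \<in> {0..1}" "x' \<in> {0..1}" "\<bar>x - x'\<bar> \<le> 1 / real n"
      show "\<bar>h x - h x'\<bar> \<le> e / 3"
      proof (rule hc[OF x(1,2)])
        fix y :: real assume "y \<in> {0..1}"
        then show "\<bar>K (x, y) - K (x', y)\<bar> \<le> e / 3"
          by (intro d(2)) (use x elim in \<open>simp_all add: mem_unit_square dist_Pair_Pair dist_real_def\<close>)
      qed
    qed (use elim in simp)
    have "\<bar>(\<Sum>i = 1..n. h (real i / real n)) / real n - (\<Sum>i = 1..n. (\<Sum>j = 1..n. K (real i / real n, real j / real n)) / real n) / real n\<bar>
      = \<bar>\<Sum>i = 1..n. h (real i / real n) - (\<Sum>j = 1..n. K (real i / real n, real j / real n)) / real n\<bar> / real n"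
      unfolding sum_subtractf diff_divide_distrib[symmetric] abs_divide by simp
    also have "\<dots> \<le> (\<Sum>i = 1..n. e / 3) / real n"
    proof (intro divide_right_mono order_trans[OF sum_abs] sum_mono)
      fix i assume "i \<in> {1..n}"
      then have "real i / real n \<in> {0..1}" using elim(1) by (intro grid_mem) auto
      with elim(2) show "\<bar>h (real i / real n) - (\<Sum>j = 1..n. K (real i / real n, real j / real n)) / real n\<bar> \<le> e / 3" by blast
    qed (use n0 in simp)
    finally have 2: "\<bar>(\<Sum>i = 1..n. h (real i / real n)) / real n - (\<Sum>i = 1..n. (\<Sum>j = 1..n. K (real i / real n, real j / real n)) / real n) / real n\<bar> \<le> e / 3"
      using n0 by simp
    have 3: "(\<Sum>i = 1..n. (\<Sum>j = 1..n. K (real i / real n, real j / real n)) / real n) / real n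
      = (\<Sum>i = 1..n. \<Sum>j = 1..n. K (real i / real n, real j / real n)) / (real n)\<^sup>2"
      by (simp add: power2_eq_square sum_divide_distrib)
    have 4: "(\<integral>z. K z \<partial>unif_square) = (\<integral>x. h x \<partial>unif_interval)"
      unfolding h_def by (rule integral_square_xy[OF K])
    show ?case using 1 2 e unfolding 3 4 dist_real_def by linarith
  qed
qed

section \<open>The centred grid of function values\<close>

definition grid :: "(real \<times> real \<Rightarrow> real ^ 'l) \<Rightarrow> nat \<Rightarrow> nat \<Rightarrow> nat \<Rightarrow> real ^ 'l" where
  "grid f n i j = f (real i / real n, real j / real n)"

definition row_mean :: "(real \<times> real \<Rightarrow> real ^ 'l) \<Rightarrow> nat \<Rightarrow> nat \<Rightarrow> real ^ 'l" where
  "row_mean f n i = (\<Sum>j = 1..n. grid f n i j) /\<^sub>R real n"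

definition col_mean :: "(real \<times> real \<Rightarrow> real ^ 'l) \<Rightarrow> nat \<Rightarrow> nat \<Rightarrow> real ^ 'l" where
  "col_mean f n j = (\<Sum>i = 1..n. grid f n i j) /\<^sub>R real n"

definition grid_mean :: "(real \<times> real \<Rightarrow> real ^ 'l) \<Rightarrow> nat \<Rightarrow> real ^ 'l" where
  "grid_mean f n = (\<Sum>i = 1..n. \<Sum>j = 1..n. grid f n i j) /\<^sub>R (real n)\<^sup>2"

text \<open>Double centring of the grid. It changes neither the swap statistics nor, up to its mean, the sufficient
  statistic, but makes all row and column sums vanish exactly; the Riemann sums of \<open>f\<close> over rows and
  columns vanish only asymptotically and without any rate.\<close>

definition cgrid :: "(real \<times> real \<Rightarrow> real ^ 'l) \<Rightarrow> nat \<Rightarrow> nat \<Rightarrow> nat \<Rightarrow> real ^ 'l" where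
  "cgrid f n i j = grid f n i j - row_mean f n i - col_mean f n j + grid_mean f n"

text \<open>The vector subtracted is the exact mean of \<open>suff_stat\<close> under the uniform distribution.\<close>

definition fluct :: "(real \<times> real \<Rightarrow> real ^ 'l) \<Rightarrow> nat \<Rightarrow> (nat \<Rightarrow> nat) \<Rightarrow> real ^ 'l" where
  "fluct f n \<pi> = (suff_stat f n \<pi> - real n *\<^sub>R grid_mean f n) /\<^sub>R sqrt (real n)"

definition energy_mat :: "(real \<times> real \<Rightarrow> real ^ 'l) \<Rightarrow> nat \<Rightarrow> (nat \<Rightarrow> nat) \<Rightarrow> real ^ 'l ^ 'l" where
  "energy_mat f n \<pi> = (\<chi> p q. (\<Sum>i = 1..n. \<Sum>j = 1..n.
     swap_stat f n \<pi> i j $ p * swap_stat f n \<pi> i j $ q) / (4 * (real n)\<^sup>2))"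

definition cov_mat :: "(real \<times> real \<Rightarrow> real ^ 'l) \<Rightarrow> nat \<Rightarrow> real ^ 'l ^ 'l" where
  "cov_mat f n = (\<chi> p q. (\<Sum>i = 1..n. \<Sum>j = 1..n. cgrid f n i j $ p * cgrid f n i j $ q) / (real n)\<^sup>2)"

text \<open>The entrywise \<open>l\<^sup>1\<close> norm, chosen because its average over permutations is the sum of the averages of the entries.\<close>

definition mat_l1 :: "real ^ 'n ^ 'm \<Rightarrow> real" where
  "mat_l1 M = (\<Sum>p\<in>UNIV. \<Sum>q\<in>UNIV. \<bar>M $ p $ q\<bar>)"

lemma mat_l1_nonneg: "0 \<le> mat_l1 M"
  by (simp add: mat_l1_def sum_nonneg)

lemma mat_l1_triangle: "mat_l1 (M - K) \<le> mat_l1 (M - N) + mat_l1 (N - K)"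
  unfolding mat_l1_def sum.distrib[symmetric] by (intro sum_mono) simp

lemma bilinear_form_expand: "t \<bullet> (M *v s) = (\<Sum>p\<in>UNIV. \<Sum>q\<in>UNIV. t $ p * s $ q * M $ p $ q)"
  for M :: "real ^ 'n ^ 'm"
  by (simp add: inner_vec_def matrix_vector_mult_def sum_distrib_left mult_ac)

lemma bilinear_form_bound: "\<bar>t \<bullet> (M *v s)\<bar> \<le> norm t * norm s * mat_l1 M"
  for M :: "real ^ 'n ^ 'm"
proof -
  have "\<bar>t \<bullet> (M *v s)\<bar> \<le> (\<Sum>p\<in>UNIV. \<Sum>q\<in>UNIV. \<bar>t $ p * s $ q * M $ p $ q\<bar>)"
    unfolding bilinear_form_expand by (intro order_trans[OF sum_abs] sum_mono sum_abs)
  also have "\<dots> \<le> (\<Sum>p\<in>UNIV. \<Sum>q\<in>UNIV. norm t * norm s * \<bar>M $ p $ q\<bar>)"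
    unfolding abs_mult
    by (intro sum_mono mult_right_mono mult_mono component_le_norm_cart) auto
  finally show ?thesis by (simp add: mat_l1_def sum_distrib_left)
qed

lemma gram_form:
  fixes u :: "nat \<Rightarrow> nat \<Rightarrow> real ^ 'l"
  shows "t \<bullet> ((\<chi> p q. (\<Sum>i = 1..n. \<Sum>j = 1..n. u i j $ p * u i j $ q) / c) *v s)
    = (\<Sum>i = 1..n. \<Sum>j = 1..n. (t \<bullet> u i j) * (s \<bullet> u i j)) / c"
proof -
  have "t \<bullet> ((\<chi> p q. (\<Sum>i = 1..n. \<Sum>j = 1..n. u i j $ p * u i j $ q) / c) *v s)
    = (\<Sum>p\<in>UNIV. \<Sum>q\<in>UNIV. \<Sum>i = 1..n. \<Sum>j = 1..n. (t $ p * u i j $ p) * (s $ q * u i j $ q)) / c"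
    by (simp add: bilinear_form_expand sum_divide_distrib sum_distrib_left mult_ac)
  also have "(\<Sum>p\<in>UNIV. \<Sum>q\<in>UNIV. \<Sum>i = 1..n. \<Sum>j = 1..n. (t $ p * u i j $ p) * (s $ q * u i j $ q))
    = (\<Sum>p\<in>UNIV. \<Sum>i = 1..n. \<Sum>q\<in>UNIV. \<Sum>j = 1..n. (t $ p * u i j $ p) * (s $ q * u i j $ q))"
    by (intro sum.cong refl sum.swap)
  also have "\<dots> = (\<Sum>i = 1..n. \<Sum>p\<in>UNIV. \<Sum>q\<in>UNIV. \<Sum>j = 1..n. (t $ p * u i j $ p) * (s $ q * u i j $ q))"
    by (rule sum.swap)
  also have "\<dots> = (\<Sum>i = 1..n. \<Sum>p\<in>UNIV. \<Sum>j = 1..n. \<Sum>q\<in>UNIV. (t $ p * u i j $ p) * (s $ q * u i j $ q))"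
    by (intro sum.cong refl sum.swap)
  also have "\<dots> = (\<Sum>i = 1..n. \<Sum>j = 1..n. \<Sum>p\<in>UNIV. \<Sum>q\<in>UNIV. (t $ p * u i j $ p) * (s $ q * u i j $ q))"
    by (intro sum.cong refl sum.swap)
  finally show ?thesis by (simp add: inner_vec_def sum_product)
qed

lemma sum_row_mean: assumes "n > 0" shows "(\<Sum>i = 1..n. row_mean f n i) = real n *\<^sub>R grid_mean f n"
proof -
  have "real n * inverse ((real n)\<^sup>2) = inverse (real n)"
    using assms by (simp add: power2_eq_square field_simps)
  then show ?thesis
    unfolding row_mean_def grid_mean_def scaleR_right.sum[symmetric] scaleR_scaleR by simp
qed

lemma sum_col_mean: assumes "n > 0" shows "(\<Sum>j = 1..n. col_mean f n j) = real n *\<^sub>R grid_mean f n"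
proof -
  have "(\<Sum>j = 1..n. \<Sum>i = 1..n. grid f n i j) = (\<Sum>i = 1..n. \<Sum>j = 1..n. grid f n i j)"
    by (rule sum.swap)
  moreover have "real n * inverse ((real n)\<^sup>2) = inverse (real n)"
    using assms by (simp add: power2_eq_square field_simps)
  ultimately show ?thesis
    unfolding col_mean_def grid_mean_def scaleR_right.sum[symmetric] scaleR_scaleR by simp
qed

lemma cgrid_row_sum: assumes "n > 0" shows "(\<Sum>j = 1..n. cgrid f n i j) = 0"
proof -
  have "(\<Sum>j = 1..n. col_mean f n j) = real n *\<^sub>R grid_mean f n"
    by (rule sum_col_mean[OF assms])
  moreover have "(\<Sum>j = 1..n. grid f n i j) = real n *\<^sub>R row_mean f n i"
    using assms by (simp add: row_mean_def)
  ultimately show ?thesis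
    by (simp add: cgrid_def sum.distrib sum_subtractf sum_constant_scaleR del: sum_constant)
qed

lemma cgrid_col_sum: assumes "n > 0" shows "(\<Sum>i = 1..n. cgrid f n i j) = 0"
proof -
  have "(\<Sum>i = 1..n. row_mean f n i) = real n *\<^sub>R grid_mean f n"
    by (rule sum_row_mean[OF assms])
  moreover have "(\<Sum>i = 1..n. grid f n i j) = real n *\<^sub>R col_mean f n j"
    using assms by (simp add: col_mean_def)
  ultimately show ?thesis
    by (simp add: cgrid_def sum.distrib sum_subtractf sum_constant_scaleR del: sum_constant)
qed

lemma sum_cgrid_perm:
  assumes \<pi>: "\<pi> \<in> perms n" and n: "n > 0"
  shows "(\<Sum>i = 1..n. cgrid f n i (\<pi> i)) = suff_stat f n \<pi> - real n *\<^sub>R grid_mean f n"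
proof -
  have "(\<Sum>i = 1..n. row_mean f n i) = real n *\<^sub>R grid_mean f n"
    by (rule sum_row_mean[OF n])
  moreover have "(\<Sum>i = 1..n. col_mean f n (\<pi> i)) = (\<Sum>j = 1..n. col_mean f n j)"
    by (rule sum.reindex_bij_betw[OF perms_bij[OF \<pi>]])
  moreover have "(\<Sum>j = 1..n. col_mean f n j) = real n *\<^sub>R grid_mean f n"
    by (rule sum_col_mean[OF n])
  moreover have "(\<Sum>i = 1..n. grid f n i (\<pi> i)) = suff_stat f n \<pi>"
    by (simp add: suff_stat_def grid_def)
  ultimately show ?thesis
    by (simp add: cgrid_def sum.distrib sum_subtractf sum_constant_scaleR del: sum_constant)
qed

lemma swap_stat_cgrid:
  "swap_stat f n \<pi> i j = cgrid f n i (\<pi> i) + cgrid f n j (\<pi> j) - cgrid f n i (\<pi> j) - cgrid f n j (\<pi> i)"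
  by (simp add: swap_stat_def cgrid_def grid_def)

abbreviation proj :: "(real \<times> real \<Rightarrow> real ^ 'l) \<Rightarrow> nat \<Rightarrow> real ^ 'l \<Rightarrow> nat \<Rightarrow> nat \<Rightarrow> real" where
  "proj f n t \<equiv> (\<lambda>i j. t \<bullet> cgrid f n i j)"

lemma swap_diff_proj: "swap_diff (proj f n t) \<pi> i j = t \<bullet> swap_stat f n \<pi> i j"
  by (simp add: swap_diff_def swap_stat_cgrid inner_add_right inner_diff_right)

lemma norm_stat_proj:
  assumes "\<pi> \<in> perms n" "n > 0"
  shows "norm_stat n (proj f n t) \<pi> = t \<bullet> fluct f n \<pi>"
  using assms by (simp add: norm_stat_def lin_stat_def fluct_def inner_sum_right[symmetric] 
      sum_cgrid_perm divide_inverse mult.commute del: One_nat_def)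

lemma swap_energy_proj: "swap_energy n (proj f n t) \<pi> = t \<bullet> (energy_mat f n \<pi> *v t)"
  unfolding energy_mat_def gram_form swap_energy_def swap_diff_proj power2_eq_square ..

lemma array_var_proj: "array_var n (proj f n t) = t \<bullet> (cov_mat f n *v t)"
  unfolding cov_mat_def gram_form array_var_def by (simp add: power2_eq_square)

text \<open>Entries of a symmetric matrix are recovered from the quadratic form at finitely many vectors. This transfers
  the concentration of the swap energy, known for each fixed direction, to the whole matrix.\<close>

lemma polarization:
  fixes M :: "real ^ 'l ^ 'l"
  assumes sym: "\<And>p q. M $ p $ q = M $ q $ p"
  defines "Q \<equiv> \<lambda>t. t \<bullet> (M *v t)"
  shows "M $ p $ q = (Q (axis p 1 + axis q 1) - Q (axis p 1) - Q (axis q 1)) / 2"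
proof -
  have "axis r 1 \<bullet> (M *v axis s 1) = M $ r $ s" for r s
    by (simp add: inner_axis' inner_axis matrix_vector_mul_component)
  then show ?thesis
    using sym[of p q] by (simp add: Q_def matrix_vector_right_distrib inner_add_left inner_add_right)
qed

context permuton_family
begin

lemma grid_bound:
  "\<exists>B\<ge>0. \<forall>n>0. \<forall>i\<in>{1..n}. \<forall>j\<in>{1..n}. norm (grid f n i j) \<le> B \<and> norm (cgrid f n i j) \<le> 4 * B"
proof -
  obtain B where B: "B \<ge> 0" "\<And>z. z \<in> unit_square \<Longrightarrow> norm (f z) \<le> B"
    using continuous_bounded_square[OF cont] by blast
  have g: "norm (grid f n i j) \<le> B" if "n > 0" "i \<in> {1..n}" "j \<in> {1..n}" for n i j
    using grid_mem[OF that(1,2)] grid_mem[OF that(1,3)] by (auto simp: grid_def mem_unit_square intro!: B)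
  have avg: "norm (sum u {1..n} /\<^sub>R real n) \<le> B" if "n > 0" "\<And>i. i \<in> {1..n} \<Longrightarrow> norm (u i) \<le> B" for u :: "nat \<Rightarrow> real ^ 'l" and n
  proof -
    have "norm (sum u {1..n}) \<le> (\<Sum>i = 1..n. B)" by (rule sum_norm_le) (rule that(2))
    then show ?thesis using that(1) by (simp add: field_simps)
  qed
  have c: "norm (cgrid f n i j) \<le> 4 * B" if "n > 0" "i \<in> {1..n}" "j \<in> {1..n}" for n i j
  proof -
    have r: "norm (row_mean f n i) \<le> B" if "i \<in> {1..n}" for i
      unfolding row_mean_def using \<open>n > 0\<close> that g by (intro avg) auto
    have cm: "norm (col_mean f n j) \<le> B"
      unfolding col_mean_def using that g by (intro avg) auto
    have "grid_mean f n = sum (row_mean f n) {1..n} /\<^sub>R real n"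
      by (simp add: grid_mean_def row_mean_def power2_eq_square scaleR_right.sum)
    then have m: "norm (grid_mean f n) \<le> B" using avg[OF that(1) r] by simp
    show ?thesis
      unfolding cgrid_def
      using g[OF that] r[OF that(2)] cm m norm_triangle_ineq[of "grid f n i j - row_mean f n i - col_mean f n j" "grid_mean f n"]
        norm_triangle_ineq4[of "grid f n i j - row_mean f n i" "col_mean f n j"]
        norm_triangle_ineq4[of "grid f n i j" "row_mean f n i"] by linarith
  qed
  show ?thesis using B(1) g c by (intro exI[of _ B] conjI allI impI ballI)
qed

lemma proj_centred_array:
  assumes n: "n \<ge> 4" and c: "\<And>i j. i \<in> {1..n} \<Longrightarrow> j \<in> {1..n} \<Longrightarrow> norm (cgrid f n i j) \<le> B"
    and t: "norm t * B \<le> C"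
  shows "centred_array n (proj f n t) C"
proof
  show "\<bar>proj f n t i j\<bar> \<le> C" if "i \<in> {1..n}" "j \<in> {1..n}" for i j
  proof -
    have "\<bar>t \<bullet> cgrid f n i j\<bar> \<le> norm t * norm (cgrid f n i j)" by (rule Cauchy_Schwarz_ineq2)
    also have "\<dots> \<le> norm t * B" by (intro mult_left_mono c that) auto
    finally show ?thesis using t by simp
  qed
  show "(\<Sum>j = 1..n. proj f n t i j) = 0" for i
    using n by (simp add: inner_sum_right[symmetric] cgrid_row_sum del: One_nat_def)
  show "(\<Sum>i = 1..n. proj f n t i j) = 0" for j
    using n by (simp add: inner_sum_right[symmetric] cgrid_col_sum del: One_nat_def)
qed (rule n)

text \<open>Without centring the entries are Riemann sums of products of two components of \<open>f\<close>, and the centring terms are uniformly small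
  because row and column integrals of \<open>f\<close> vanish.\<close>

lemma cov_mat_tendsto: "(\<lambda>n. mat_l1 (cov_mat f n - Gamma_mat f)) \<longlonglongrightarrow> 0"
proof -
  obtain B where "B \<ge> 0 \<and> (\<forall>n>0. \<forall>i\<in>{1..n}. \<forall>j\<in>{1..n}. norm (grid f n i j) \<le> B \<and> norm (cgrid f n i j) \<le> 4 * B)"
    using grid_bound by blast
  then have B: "B \<ge> 0" "\<And>n i j. n > 0 \<Longrightarrow> i \<in> {1..n} \<Longrightarrow> j \<in> {1..n} \<Longrightarrow> norm (grid f n i j) \<le> B"
    "\<And>n i j. n > 0 \<Longrightarrow> i \<in> {1..n} \<Longrightarrow> j \<in> {1..n} \<Longrightarrow> norm (cgrid f n i j) \<le> 4 * B"
    by (blast+)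
  have "(\<lambda>n. cov_mat f n $ p $ q - Gamma_mat f $ p $ q) \<longlonglongrightarrow> 0" for p q
  proof -
    let ?G = "\<lambda>n. (\<Sum>i = 1..n. \<Sum>j = 1..n. grid f n i j $ p * grid f n i j $ q) / (real n)\<^sup>2"
    have lim: "?G \<longlonglongrightarrow> Gamma_mat f $ p $ q"
      unfolding grid_def Gamma_mat_def vec_lambda_beta
      by (rule riemann_square[of "\<lambda>z. f z $ p * f z $ q"]) (intro continuous_intros cont_comp)
    have diff: "(\<lambda>n. cov_mat f n $ p $ q - ?G n) \<longlonglongrightarrow> 0"
    proof (rule tendstoI)
      fix e :: real assume e: "e > 0"
      \<comment> \<open>If all means are at most \<open>d\<close>, centring moves an entry by at most \<open>3 * d\<close> and a product of two entries by
        at most \<open>3 * d * (4 * B + B)\<close>.\<close>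
      define d where "d = e / (2 * (15 * B + 1))"
      have d: "d > 0" using e B(1) by (simp add: d_def)
      have de: "15 * B * d < e" 
      proof -
        have "15 * B * d \<le> (15 * B + 1) * d" using d by (intro mult_right_mono) auto
        also have "\<dots> = e / 2" using B(1) by (simp add: d_def divide_simps)
        finally show ?thesis using e by simp
      qed
      have rows: "\<forall>\<^sub>F n in sequentially. \<forall>x\<in>{0..1}. \<bar>(\<Sum>j = 1..n. f (x, real j / real n) $ r) / real n\<bar> \<le> d" for r
        using riemann_rows(1)[OF cont_comp[of r] d] by (simp add: row0)
      have cols: "\<forall>\<^sub>F n in sequentially. \<forall>y\<in>{0..1}. \<bar>(\<Sum>i = 1..n. f (real i / real n, y) $ r) / real n\<bar> \<le> d" for r
        using riemann_rows(2)[OF cont_comp[of r] d] by (simp add: col0)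
      show "\<forall>\<^sub>F n in sequentially. dist (cov_mat f n $ p $ q - ?G n) 0 < e"
        using rows[of p] rows[of q] cols[of p] cols[of q] eventually_gt_at_top[of 0]
      proof eventually_elim
        case (elim n)
        then have n: "n > 0" and n0: "real n > 0" by auto
        have r: "\<bar>row_mean f n i $ s\<bar> \<le> d" if "i \<in> {1..n}" "s = p \<or> s = q" for i s
          using elim(1,2) grid_mem[OF n that(1)] that(2) by (auto simp: row_mean_def grid_def divide_inverse mult.commute)
        have c: "\<bar>col_mean f n j $ s\<bar> \<le> d" if "j \<in> {1..n}" "s = p \<or> s = q" for j s
          using elim(3,4) grid_mem[OF n that(1)] that(2) by (auto simp: col_mean_def grid_def divide_inverse mult.commute)
        have m: "\<bar>grid_mean f n $ s\<bar> \<le> d" if "s = p \<or> s = q" for s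
        proof -
          have "grid_mean f n = sum (row_mean f n) {1..n} /\<^sub>R real n"
            by (simp add: grid_mean_def row_mean_def power2_eq_square scaleR_right.sum)
          then have "\<bar>grid_mean f n $ s\<bar> = \<bar>\<Sum>i = 1..n. row_mean f n i $ s\<bar> / real n"
            by (simp add: abs_mult divide_inverse mult.commute)
          also have "\<dots> \<le> (\<Sum>i = 1..n. d) / real n"
            using n0 that r by (intro divide_right_mono order_trans[OF sum_abs] sum_mono) auto
          finally show ?thesis using n0 by simp
        qed
        have ent: "\<bar>cgrid f n i j $ p * cgrid f n i j $ q - grid f n i j $ p * grid f n i j $ q\<bar> \<le> 15 * B * d"
          if i: "i \<in> {1..n}" and j: "j \<in> {1..n}" for i j
        proof -
          have cd: "\<bar>cgrid f n i j $ s - grid f n i j $ s\<bar> \<le> 3 * d" if "s = p \<or> s = q" for s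
            using r[OF i that] c[OF j that] m[OF that] by (simp add: cgrid_def)
          have "\<bar>cgrid f n i j $ q\<bar> \<le> 4 * B" "\<bar>grid f n i j $ p\<bar> \<le> B"
            using B(3)[OF n i j] B(2)[OF n i j] component_le_norm_cart[of "cgrid f n i j" q]
              component_le_norm_cart[of "grid f n i j" p] by linarith+
          then have "\<bar>cgrid f n i j $ p - grid f n i j $ p\<bar> * \<bar>cgrid f n i j $ q\<bar>
             + \<bar>grid f n i j $ p\<bar> * \<bar>cgrid f n i j $ q - grid f n i j $ q\<bar> \<le> (3 * d) * (4 * B) + B * (3 * d)"
            using cd[of p] cd[of q] B(1) d by (intro add_mono mult_mono) auto
          moreover have "cgrid f n i j $ p * cgrid f n i j $ q - grid f n i j $ p * grid f n i j $ q
            = (cgrid f n i j $ p - grid f n i j $ p) * cgrid f n i j $ q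
             + grid f n i j $ p * (cgrid f n i j $ q - grid f n i j $ q)"
            by (simp add: algebra_simps)
          ultimately show ?thesis
            using abs_triangle_ineq[of "(cgrid f n i j $ p - grid f n i j $ p) * cgrid f n i j $ q"
                "grid f n i j $ p * (cgrid f n i j $ q - grid f n i j $ q)"]
            by (simp add: abs_mult mult_ac)
        qed
        have "\<bar>cov_mat f n $ p $ q - ?G n\<bar> = \<bar>\<Sum>i = 1..n. \<Sum>j = 1..n. 
            cgrid f n i j $ p * cgrid f n i j $ q - grid f n i j $ p * grid f n i j $ q\<bar> / (real n)\<^sup>2"
          unfolding cov_mat_def vec_lambda_beta diff_divide_distrib[symmetric] sum_subtractf[symmetric] abs_divide
          by simp
        also have "\<dots> \<le> (\<Sum>i = 1..n. \<Sum>j = 1..n. 15 * B * d) / (real n)\<^sup>2"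
          by (intro divide_right_mono order_trans[OF sum_abs] sum_mono order_trans[OF sum_abs] ent) auto
        also have "\<dots> = 15 * B * d" using n0 by (simp add: power2_eq_square)
        finally show ?case using de by (simp add: dist_real_def)
      qed
    qed
    show ?thesis using tendsto_add[OF diff LIM_zero[OF lim]] by simp
  qed
  then have "(\<lambda>n. \<Sum>p\<in>UNIV. \<Sum>q\<in>UNIV. \<bar>cov_mat f n $ p $ q - Gamma_mat f $ p $ q\<bar>) \<longlonglongrightarrow> (\<Sum>p\<in>(UNIV :: 'l set). \<Sum>q\<in>(UNIV :: 'l set). 0)"
    by (intro tendsto_sum tendsto_rabs_zero)
  then show ?thesis by (simp add: mat_l1_def)
qed

text \<open>For a fixed direction the deviation from \<open>cov_mat\<close> is \<open>O(1 / sqrt n)\<close> in mean; polarization gives all entries.\<close>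

lemma energy_mat_tendsto:
  "(\<lambda>n. perm_avg n (\<lambda>\<pi>. mat_l1 (energy_mat f n \<pi> - Gamma_mat f))) \<longlonglongrightarrow> 0"
proof -
  obtain B where "B \<ge> 0 \<and> (\<forall>n>0. \<forall>i\<in>{1..n}. \<forall>j\<in>{1..n}. norm (grid f n i j) \<le> B \<and> norm (cgrid f n i j) \<le> 4 * B)"
    using grid_bound by blast
  then have B: "B \<ge> 0" 
    "\<And>n i j. n > 0 \<Longrightarrow> i \<in> {1..n} \<Longrightarrow> j \<in> {1..n} \<Longrightarrow> norm (cgrid f n i j) \<le> 4 * B"
    by (blast+)
  define L where "L = real (CARD('l))"
  define C where "C = 8 * B"
  define D where "D = (16 * C ^ 4 + 1) / 2"
  have quad: "perm_avg n (\<lambda>\<pi>. \<bar>t \<bullet> ((energy_mat f n \<pi> - cov_mat f n) *v t)\<bar>) \<le> D / sqrt (real n)"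
    if n: "n \<ge> 4" and t: "norm t \<le> 2" for n and t :: "real ^ 'l"
  proof -
    have n0: "real n > 0" using n by simp
    interpret centred_array n "proj f n t" C
    proof (rule proj_centred_array[OF n, of "4 * B"])
      show "norm t * (4 * B) \<le> C" using mult_right_mono[OF t, of "4 * B"] B(1) by (simp add: C_def)
    qed (use B(2) n in auto)
    have "perm_avg n (\<lambda>\<pi>. \<bar>t \<bullet> ((energy_mat f n \<pi> - cov_mat f n) *v t)\<bar>)
      \<le> perm_avg n (\<lambda>\<pi>. (1/2) * (sqrt (real n) * (swap_energy n (proj f n t) \<pi> - array_var n (proj f n t))\<^sup>2 + 1 / sqrt (real n)))"
    proof (rule perm_avg_mono)
      fix \<pi>
      let ?x = "swap_energy n (proj f n t) \<pi> - array_var n (proj f n t)"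
      have "0 \<le> (sqrt (real n) * \<bar>?x\<bar> - 1)\<^sup>2 / sqrt (real n)" by simp
      also have "\<dots> = sqrt (real n) * ?x\<^sup>2 + 1 / sqrt (real n) - 2 * \<bar>?x\<bar>"
        using n0 by (simp add: power2_eq_square field_simps)
      finally have "\<bar>?x\<bar> \<le> (1/2) * (sqrt (real n) * ?x\<^sup>2 + 1 / sqrt (real n))" by simp
      moreover have "t \<bullet> ((energy_mat f n \<pi> - cov_mat f n) *v t) = ?x"
        unfolding swap_energy_proj array_var_proj
        by (simp add: matrix_vector_mult_diff_rdistrib inner_diff_right)
      ultimately show "\<bar>t \<bullet> ((energy_mat f n \<pi> - cov_mat f n) *v t)\<bar> \<le> (1/2) * (sqrt (real n) * ?x\<^sup>2 + 1 / sqrt (real n))"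
        by simp
    qed
    also have "\<dots> \<le> (1/2) * (sqrt (real n) * (16 * C ^ 4 / real n) + 1 / sqrt (real n))"
      unfolding perm_avg_cmult perm_avg_add perm_avg_const
      by (intro mult_left_mono add_right_mono swap_energy_concentration) auto
    also have "\<dots> = D / sqrt (real n)"
      using n0 by (simp add: D_def field_simps)
    finally show ?thesis .
  qed
  have bound: "perm_avg n (\<lambda>\<pi>. mat_l1 (energy_mat f n \<pi> - Gamma_mat f))
      \<le> L * L * (3 * (D / sqrt (real n)) / 2) + mat_l1 (cov_mat f n - Gamma_mat f)" if n: "n \<ge> 4" for n
  proof -
    let ?M = "\<lambda>\<pi>. energy_mat f n \<pi> - cov_mat f n"
    have ent: "perm_avg n (\<lambda>\<pi>. \<bar>?M \<pi> $ p $ q\<bar>) \<le> 3 * (D / sqrt (real n)) / 2" for p q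
    proof -
      let ?Q = "\<lambda>t \<pi>. \<bar>t \<bullet> (?M \<pi> *v t)\<bar>"
      have nm: "norm (axis r 1 + axis s 1 :: real ^ 'l) \<le> 2" for r s
        using norm_triangle_ineq[of "axis r 1 :: real ^ 'l" "axis s 1"] by simp
      have "perm_avg n (\<lambda>\<pi>. \<bar>?M \<pi> $ p $ q\<bar>) 
         \<le> perm_avg n (\<lambda>\<pi>. (1/2) * (?Q (axis p 1 + axis q 1) \<pi> + ?Q (axis p 1) \<pi> + ?Q (axis q 1) \<pi>))"
      proof (rule perm_avg_mono)
        fix \<pi>
        have "?M \<pi> $ r $ s = ?M \<pi> $ s $ r" for r s
          by (simp add: energy_mat_def cov_mat_def mult.commute)
        note eq = polarization[of "?M \<pi>", OF this, of p q]
        have abs3: "\<bar>(a - b - c) / 2\<bar> \<le> (1/2) * (\<bar>a\<bar> + \<bar>b\<bar> + \<bar>c\<bar>)" for a b c :: real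
          using abs_triangle_ineq4[of "a - b" c] abs_triangle_ineq4[of a b] by simp
        show "\<bar>?M \<pi> $ p $ q\<bar> \<le> (1/2) * (?Q (axis p 1 + axis q 1) \<pi> + ?Q (axis p 1) \<pi> + ?Q (axis q 1) \<pi>)"
          unfolding eq by (rule abs3)
      qed
      also have "\<dots> \<le> (1/2) * (D / sqrt (real n) + D / sqrt (real n) + D / sqrt (real n))"
        unfolding perm_avg_cmult perm_avg_add
        by (intro mult_left_mono add_mono quad[OF n] nm) auto
      finally show ?thesis by simp
    qed
    have "perm_avg n (\<lambda>\<pi>. mat_l1 (energy_mat f n \<pi> - Gamma_mat f))
       \<le> perm_avg n (\<lambda>\<pi>. mat_l1 (?M \<pi>) + mat_l1 (cov_mat f n - Gamma_mat f))"
      by (rule perm_avg_mono) (rule mat_l1_triangle)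
    also have "\<dots> = (\<Sum>p\<in>UNIV. \<Sum>q\<in>UNIV. perm_avg n (\<lambda>\<pi>. \<bar>?M \<pi> $ p $ q\<bar>)) + mat_l1 (cov_mat f n - Gamma_mat f)"
      unfolding perm_avg_add perm_avg_const by (simp only: mat_l1_def perm_avg_sum)
    also have "(\<Sum>p\<in>UNIV. \<Sum>q\<in>UNIV. perm_avg n (\<lambda>\<pi>. \<bar>?M \<pi> $ p $ q\<bar>)) \<le> (\<Sum>p\<in>(UNIV :: 'l set). \<Sum>q\<in>(UNIV :: 'l set). 3 * (D / sqrt (real n)) / 2)"
      by (intro sum_mono ent)
    finally show ?thesis by (simp add: L_def)
  qed
  have "(\<lambda>n. D / sqrt (real n)) \<longlonglongrightarrow> 0"
    by (intro tendsto_divide_0[OF tendsto_const] filterlim_at_top_imp_at_infinity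
        filterlim_compose[OF sqrt_at_top filterlim_real_sequentially])
  then have "(\<lambda>n. L * L * (3 * (D / sqrt (real n)) / 2) + mat_l1 (cov_mat f n - Gamma_mat f)) \<longlonglongrightarrow> L * L * (3 * 0 / 2) + 0"
    by (intro tendsto_intros cov_mat_tendsto) auto
  then have lim: "(\<lambda>n. L * L * (3 * (D / sqrt (real n)) / 2) + mat_l1 (cov_mat f n - Gamma_mat f)) \<longlonglongrightarrow> 0" by simp
  show ?thesis
  proof (rule tendsto_sandwich[OF _ _ tendsto_const lim])
    show "\<forall>\<^sub>F n in sequentially. 0 \<le> perm_avg n (\<lambda>\<pi>. mat_l1 (energy_mat f n \<pi> - Gamma_mat f))"
      by (intro always_eventually allI perm_avg_nonneg mat_l1_nonneg)
    show "\<forall>\<^sub>F n in sequentially. perm_avg n (\<lambda>\<pi>. mat_l1 (energy_mat f n \<pi> - Gamma_mat f))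
      \<le> L * L * (3 * (D / sqrt (real n)) / 2) + mat_l1 (cov_mat f n - Gamma_mat f)"
      using eventually_ge_at_top[of 4] by eventually_elim (rule bound)
  qed
qed

lemma fluct_second_moment:
  obtains D where "\<And>n. n \<ge> 4 \<Longrightarrow> perm_avg n (\<lambda>\<pi>. (norm (fluct f n \<pi>))\<^sup>2) \<le> D"
proof -
  obtain B where "B \<ge> 0 \<and> (\<forall>n>0. \<forall>i\<in>{1..n}. \<forall>j\<in>{1..n}. norm (grid f n i j) \<le> B \<and> norm (cgrid f n i j) \<le> 4 * B)"
    using grid_bound by blast
  then have B: "B \<ge> 0" 
    "\<And>n i j. n > 0 \<Longrightarrow> i \<in> {1..n} \<Longrightarrow> j \<in> {1..n} \<Longrightarrow> norm (cgrid f n i j) \<le> 4 * B"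
    by (blast+)
  have "perm_avg n (\<lambda>\<pi>. (norm (fluct f n \<pi>))\<^sup>2) \<le> real (CARD('l)) * (3 * (4 * B)\<^sup>2)" if n: "n \<ge> 4" for n
  proof -
    have n0: "real n > 0" using n by simp
    have comp: "perm_avg n (\<lambda>\<pi>. (fluct f n \<pi> $ p)\<^sup>2) \<le> 3 * (4 * B)\<^sup>2" for p
    proof -
      interpret centred_array n "proj f n (axis p 1)" "4 * B"
        by (rule proj_centred_array[OF n, of "4 * B"]) (use B(2) n in auto)
      have "perm_avg n (\<lambda>\<pi>. (fluct f n \<pi> $ p)\<^sup>2) = perm_avg n (\<lambda>\<pi>. (1 / real n) * (lin_stat n (proj f n (axis p 1)) \<pi>)\<^sup>2)"
      proof (rule perm_avg_cong)
        fix \<pi> assume "\<pi> \<in> perms n"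
        then have "fluct f n \<pi> $ p = norm_stat n (proj f n (axis p 1)) \<pi>"
          using norm_stat_proj[of \<pi> n "axis p 1" f] n by (simp add: inner_axis')
        then show "(fluct f n \<pi> $ p)\<^sup>2 = (1 / real n) * (lin_stat n (proj f n (axis p 1)) \<pi>)\<^sup>2"
          by (simp add: norm_stat_def power_divide)
      qed
      also have "\<dots> \<le> (1 / real n) * (3 * real n * (4 * B)\<^sup>2)"
        unfolding perm_avg_cmult by (intro mult_left_mono lin_stat_second_moment) auto
      finally show ?thesis using n0 by simp
    qed
    have "perm_avg n (\<lambda>\<pi>. (norm (fluct f n \<pi>))\<^sup>2) = (\<Sum>p\<in>UNIV. perm_avg n (\<lambda>\<pi>. (fluct f n \<pi> $ p)\<^sup>2))"
      unfolding perm_avg_sum[symmetric] power2_norm_eq_inner by (simp add: inner_vec_def power2_eq_square)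
    also have "\<dots> \<le> (\<Sum>p\<in>(UNIV :: 'l set). 3 * (4 * B)\<^sup>2)" by (intro sum_mono comp)
    finally show ?thesis by simp
  qed
  then show ?thesis by (rule that)
qed

text \<open>The Gaussian approximation is uniform in bounded directions \<open>t\<close>, since the projected arrays have a common bound.\<close>

lemma transform_uniform:
  fixes K :: real
  assumes K: "K \<ge> 0"
  shows "\<exists>D. \<forall>n t z. n \<ge> 4 \<longrightarrow> D \<le> sqrt (real n) \<longrightarrow> norm t \<le> K \<longrightarrow> norm (z :: complex) \<le> 1 \<longrightarrow>
    norm (perm_avg n (\<lambda>\<pi>. exp (z * complex_of_real (t \<bullet> fluct f n \<pi>)))
       - exp (z\<^sup>2 * complex_of_real (t \<bullet> (cov_mat f n *v t)) / 2)) \<le> D / sqrt (real n)"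
proof -
  obtain B where "B \<ge> 0 \<and> (\<forall>n>0. \<forall>i\<in>{1..n}. \<forall>j\<in>{1..n}. norm (grid f n i j) \<le> B \<and> norm (cgrid f n i j) \<le> 4 * B)"
    using grid_bound by blast
  then have B: "B \<ge> 0" 
    "\<And>n i j. n > 0 \<Longrightarrow> i \<in> {1..n} \<Longrightarrow> j \<in> {1..n} \<Longrightarrow> norm (cgrid f n i j) \<le> 4 * B"
    by (blast+)
  define C where "C = K * (4 * B)"
  have C0: "0 \<le> C" using B K by (simp add: C_def)
  have T0: "0 \<le> exp (C\<^sup>2) * tilt_const C" using C0 by (simp add: tilt_const_def mgf_const_def)
  define D where "D = exp (C\<^sup>2) * tilt_const C + 8 * C"
  show ?thesis
  proof (intro exI[of _ D] allI impI)
    fix n and t :: "real ^ 'l" and z :: complex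
    assume n: "n \<ge> 4" and Dn: "D \<le> sqrt (real n)" and t: "norm t \<le> K" and z: "norm z \<le> 1"
    interpret centred_array n "proj f n t" C
    proof (rule proj_centred_array[OF n, of "4 * B"])
      show "norm t * (4 * B) \<le> C" unfolding C_def using t B(1) by (intro mult_right_mono) auto
    qed (use B(2) n in auto)
    have "8 * C \<le> sqrt (real n)" using Dn T0 by (simp add: D_def)
    from transform_approximation[OF z this]
    have "norm (perm_avg n (\<lambda>\<pi>. exp (z * norm_stat n (proj f n t) \<pi>)) - exp (z\<^sup>2 * array_var n (proj f n t) / 2))
      \<le> exp (C\<^sup>2) * tilt_const C / sqrt (real n)" .
    also have "\<dots> \<le> D / sqrt (real n)" using C0 by (intro divide_right_mono) (auto simp: D_def)
    also have "perm_avg n (\<lambda>\<pi>. exp (z * complex_of_real (norm_stat n (proj f n t) \<pi>))) = perm_avg n (\<lambda>\<pi>. exp (z * complex_of_real (t \<bullet> fluct f n \<pi>)))"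
      using n by (intro perm_avg_cong) (simp add: norm_stat_proj)
    finally show "norm (perm_avg n (\<lambda>\<pi>. exp (z * complex_of_real (t \<bullet> fluct f n \<pi>)))
       - exp (z\<^sup>2 * complex_of_real (t \<bullet> (cov_mat f n *v t)) / 2)) \<le> D / sqrt (real n)"
      unfolding array_var_proj .
  qed
qed

end

section \<open>Local quadratic approximation\<close>

lemma abs_ln_1_plus: "\<bar>u\<bar> \<le> 1/2 \<Longrightarrow> \<bar>ln (1 + u)\<bar> \<le> 2 * \<bar>u\<bar>" for u :: real
proof -
  assume u: "\<bar>u\<bar> \<le> 1/2"
  have "\<bar>ln (1 + u) - u\<bar> \<le> 2 * u\<^sup>2" by (rule abs_ln_one_plus_x_minus_x_bound[OF u])
  also have "2 * u\<^sup>2 = (2 * \<bar>u\<bar>) * \<bar>u\<bar>" by (simp add: power2_eq_square)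
  also have "\<dots> \<le> 1 * \<bar>u\<bar>" using u by (intro mult_right_mono) auto
  finally show ?thesis by linarith
qed

text \<open>On the sphere of radius \<open>r\<close> around \<open>h0\<close> the quadratic exceeds its minimum by \<open>c * r\<^sup>2 / 2 > 2 * e\<close>, so the minimum of
  \<open>A\<close> over the ball is attained in the interior, where the gradient vanishes.\<close>

lemma interior_critical_point:
  fixes A :: "real ^ 'l \<Rightarrow> real" and M :: "real ^ 'l ^ 'l"
  assumes grad: "\<And>h. (A has_derivative (\<lambda>x. x \<bullet> G h)) (at h)"
    and sym: "\<And>d e. d \<bullet> (M *v e) = e \<bullet> (M *v d)"
    and pos: "\<And>d. c * (norm d)\<^sup>2 \<le> d \<bullet> (M *v d)"
    and h0: "M *v h0 = w" and r: "r > 0" and e: "4 * e < c * r\<^sup>2"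
    and approx: "\<And>h. h \<in> cball h0 r \<Longrightarrow> \<bar>A h - (h \<bullet> (M *v h) / 2 - h \<bullet> w)\<bar> \<le> e"
  shows "\<exists>h\<in>ball h0 r. G h = 0"
proof -
  let ?q = "\<lambda>h. h \<bullet> (M *v h) / 2 - h \<bullet> w"
  have quad: "?q (h0 + d) = ?q h0 + d \<bullet> (M *v d) / 2" for d
  proof -
    have "(h0 + d) \<bullet> (M *v (h0 + d)) = h0 \<bullet> w + h0 \<bullet> (M *v d) + (d \<bullet> w + d \<bullet> (M *v d))"
      by (simp only: matrix_vector_right_distrib inner_add_left inner_add_right h0 add_ac)
    moreover have "h0 \<bullet> (M *v d) = d \<bullet> w" using sym[of h0 d] h0 by simp
    moreover have "(h0 + d) \<bullet> w = h0 \<bullet> w + d \<bullet> w" by (rule inner_add_left)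
    ultimately show ?thesis using h0 by (simp add: field_simps)
  qed
  have cont: "continuous_on (cball h0 r) A"
    by (intro continuous_at_imp_continuous_on ballI has_derivative_continuous[OF grad])
  have "cball h0 r \<noteq> {}" using r by simp
  from continuous_attains_inf[OF compact_cball this cont]
  obtain m where m: "m \<in> cball h0 r" "\<And>y. y \<in> cball h0 r \<Longrightarrow> A m \<le> A y" by blast
  have "m \<in> ball h0 r"
  proof (rule ccontr)
    assume "m \<notin> ball h0 r"
    with m(1) have nm: "norm (m - h0) = r" by (simp add: dist_norm norm_minus_commute)
    have "?q m = ?q h0 + (m - h0) \<bullet> (M *v (m - h0)) / 2" using quad[of "m - h0"] by simp
    moreover have "c * r\<^sup>2 \<le> (m - h0) \<bullet> (M *v (m - h0))" using pos[of "m - h0"] nm by simp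
    moreover have "\<bar>A m - ?q m\<bar> \<le> e" by (rule approx[OF m(1)])
    moreover have "\<bar>A h0 - ?q h0\<bar> \<le> e" by (rule approx) (use r in simp)
    moreover have "A m \<le> A h0" by (rule m(2)) (use r in simp)
    ultimately show False using e by linarith
  qed
  then have "(\<lambda>x. x \<bullet> G m) = (\<lambda>v. 0)"
    by (rule differential_zero_maxmin[OF _ open_ball grad]) (use m(2) in auto)
  then have "G m \<bullet> G m = 0" by (rule fun_cong)
  then have "G m = 0" by simp
  with \<open>m \<in> ball h0 r\<close> show ?thesis by blast
qed

context permuton_family
begin

lemma cov_mat_nonneg: "0 \<le> t \<bullet> (cov_mat f n *v t)"
  unfolding array_var_proj[symmetric] by (simp add: array_var_def sum_nonneg)

text \<open>The case \<open>z = 1\<close> of the transform approximation. The Gaussian transform is at least \<open>1\<close>, so taking logarithms at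
  most doubles the error.\<close>

lemma log_mgf_limit:
  assumes K: "K \<ge> 0" and e: "e > 0"
  shows "\<forall>\<^sub>F n in sequentially. \<forall>t. norm t \<le> K \<longrightarrow>
    \<bar>ln (perm_avg n (\<lambda>\<pi>. exp (t \<bullet> fluct f n \<pi>))) - t \<bullet> (Gamma_mat f *v t) / 2\<bar> \<le> e"
proof -
  obtain D where D: "\<And>n t z. n \<ge> 4 \<Longrightarrow> D \<le> sqrt (real n) \<Longrightarrow> norm t \<le> K \<Longrightarrow> norm (z::complex) \<le> 1 \<Longrightarrow>
    norm (perm_avg n (\<lambda>\<pi>. exp (z * complex_of_real (t \<bullet> fluct f n \<pi>)))
       - exp (z\<^sup>2 * complex_of_real (t \<bullet> (cov_mat f n *v t)) / 2)) \<le> D / sqrt (real n)"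
    using transform_uniform[OF K] by blast
  have s: "filterlim (\<lambda>n. sqrt (real n)) at_top sequentially"
    by (rule filterlim_compose[OF sqrt_at_top filterlim_real_sequentially])
  have lim: "(\<lambda>n. D / sqrt (real n)) \<longlonglongrightarrow> 0"
    by (intro tendsto_divide_0[OF tendsto_const] filterlim_at_top_imp_at_infinity s)
  have "(\<lambda>n. 2 * (D / sqrt (real n)) + K * K * mat_l1 (cov_mat f n - Gamma_mat f) / 2) \<longlonglongrightarrow> 2 * 0 + K * K * 0 / 2"
    by (intro tendsto_intros lim cov_mat_tendsto) auto
  then have "\<forall>\<^sub>F n in sequentially. 2 * (D / sqrt (real n)) + K * K * mat_l1 (cov_mat f n - Gamma_mat f) / 2 < e"
    using e by (intro order_tendstoD(2)[where y = 0]) auto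
  moreover have "\<forall>\<^sub>F n in sequentially. D / sqrt (real n) < 1/2"
    by (rule order_tendstoD(2)[OF lim]) simp
  moreover have "\<forall>\<^sub>F n in sequentially. D \<le> sqrt (real n)"
    using s unfolding filterlim_at_top by blast
  ultimately show ?thesis using eventually_ge_at_top[of 4]
  proof eventually_elim
    case (elim n)
    show ?case
    proof (intro allI impI)
      fix t :: "real ^ 'l" assume t: "norm t \<le> K"
      let ?x = "perm_avg n (\<lambda>\<pi>. exp (t \<bullet> fluct f n \<pi>))"
      let ?v = "t \<bullet> (cov_mat f n *v t)"
      define u where "u = ?x / exp (?v / 2) - 1"
      have "norm (complex_of_real ?x - complex_of_real (exp (?v / 2))) \<le> D / sqrt (real n)"
        using D[OF elim(4,3) t, of 1] by (simp add: perm_avg_of_real flip: exp_of_real)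
      then have xy: "\<bar>?x - exp (?v / 2)\<bar> \<le> D / sqrt (real n)"
        by (simp only: of_real_diff[symmetric] norm_of_real)
      have y1: "1 \<le> exp (?v / 2)" using cov_mat_nonneg[of t n] by simp
      have "\<bar>u\<bar> = \<bar>?x - exp (?v / 2)\<bar> / exp (?v / 2)"
        unfolding u_def by (subst abs_div_pos) (simp_all add: diff_divide_distrib)
      also have "\<dots> \<le> \<bar>?x - exp (?v / 2)\<bar>" using y1 by (simp add: divide_le_eq mult_le_cancel_left1)
      finally have u: "\<bar>u\<bar> \<le> D / sqrt (real n)" using xy by linarith
      then have l: "\<bar>ln (1 + u)\<bar> \<le> 2 * (D / sqrt (real n))"
        using abs_ln_1_plus[of u] elim(2) by linarith
      have "1 + u > 0" using u elim(2) by linarith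
      have xeq: "?x = exp (?v / 2) * (1 + u)" by (simp add: u_def)
      have "ln ?x = ?v / 2 + ln (1 + u)"
        unfolding xeq using \<open>1 + u > 0\<close> by (subst ln_mult) auto
      moreover have "\<bar>?v - t \<bullet> (Gamma_mat f *v t)\<bar> \<le> K * K * mat_l1 (cov_mat f n - Gamma_mat f)"
      proof -
        have "\<bar>?v - t \<bullet> (Gamma_mat f *v t)\<bar> = \<bar>t \<bullet> ((cov_mat f n - Gamma_mat f) *v t)\<bar>"
          by (simp add: matrix_vector_mult_diff_rdistrib inner_diff_right)
        also have "\<dots> \<le> norm t * norm t * mat_l1 (cov_mat f n - Gamma_mat f)" by (rule bilinear_form_bound)
        also have "\<dots> \<le> K * K * mat_l1 (cov_mat f n - Gamma_mat f)"
          using t K by (intro mult_right_mono mult_mono mat_l1_nonneg) auto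
        finally show ?thesis .
      qed
      ultimately show "\<bar>ln ?x - t \<bullet> (Gamma_mat f *v t) / 2\<bar> \<le> e"
        using l elim(1) unfolding abs_le_iff by argo
    qed
  qed
qed

text \<open>The case \<open>z = \<i>\<close> of the transform approximation.\<close>

lemma char_limit:
  "(\<lambda>n. perm_avg n (\<lambda>\<pi>. exp (\<i> * complex_of_real (t \<bullet> fluct f n \<pi>))))
    \<longlonglongrightarrow> complex_of_real (exp (- (t \<bullet> (Gamma_mat f *v t)) / 2))"
proof -
  obtain D where D': "\<And>n s z. n \<ge> 4 \<Longrightarrow> D \<le> sqrt (real n) \<Longrightarrow> norm s \<le> norm t \<Longrightarrow> norm (z::complex) \<le> 1 \<Longrightarrow>
    norm (perm_avg n (\<lambda>\<pi>. exp (z * complex_of_real (s \<bullet> fluct f n \<pi>)))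
       - exp (z\<^sup>2 * complex_of_real (s \<bullet> (cov_mat f n *v s)) / 2)) \<le> D / sqrt (real n)"
    using transform_uniform[OF norm_ge_zero[of t]] by blast
  have D: "norm (perm_avg n (\<lambda>\<pi>. exp (\<i> * complex_of_real (t \<bullet> fluct f n \<pi>)))
       - exp (\<i>\<^sup>2 * complex_of_real (t \<bullet> (cov_mat f n *v t)) / 2)) \<le> D / sqrt (real n)"
    if "n \<ge> 4" "D \<le> sqrt (real n)" for n
    by (rule D'[OF that]) auto
  have s: "filterlim (\<lambda>n. sqrt (real n)) at_top sequentially"
    by (rule filterlim_compose[OF sqrt_at_top filterlim_real_sequentially])
  have lim: "(\<lambda>n. D / sqrt (real n)) \<longlonglongrightarrow> 0"
    by (intro tendsto_divide_0[OF tendsto_const] filterlim_at_top_imp_at_infinity s)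
  have "(\<lambda>n. t \<bullet> (cov_mat f n *v t) - t \<bullet> (Gamma_mat f *v t)) \<longlonglongrightarrow> 0"
  proof (rule Lim_null_comparison)
    show "\<forall>\<^sub>F n in sequentially. norm (t \<bullet> (cov_mat f n *v t) - t \<bullet> (Gamma_mat f *v t))
      \<le> norm t * norm t * mat_l1 (cov_mat f n - Gamma_mat f)"
      using bilinear_form_bound[of t "cov_mat f _ - Gamma_mat f" t]
      by (simp add: matrix_vector_mult_diff_rdistrib inner_diff_right)
    show "(\<lambda>n. norm t * norm t * mat_l1 (cov_mat f n - Gamma_mat f)) \<longlonglongrightarrow> 0"
      using tendsto_mult_left[OF cov_mat_tendsto, of "norm t * norm t"] by simp
  qed
  then have v: "(\<lambda>n. t \<bullet> (cov_mat f n *v t)) \<longlonglongrightarrow> t \<bullet> (Gamma_mat f *v t)" by (rule LIM_zero_cancel)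
  have "(\<lambda>n. exp (\<i>\<^sup>2 * complex_of_real (t \<bullet> (cov_mat f n *v t)) / 2))
    \<longlonglongrightarrow> exp (\<i>\<^sup>2 * complex_of_real (t \<bullet> (Gamma_mat f *v t)) / 2)"
    by (intro tendsto_intros v) auto
  moreover have "(\<lambda>n. perm_avg n (\<lambda>\<pi>. exp (\<i> * complex_of_real (t \<bullet> fluct f n \<pi>)))
       - exp (\<i>\<^sup>2 * complex_of_real (t \<bullet> (cov_mat f n *v t)) / 2)) \<longlonglongrightarrow> 0"
  proof (rule Lim_null_comparison[OF _ lim])
    have "\<forall>\<^sub>F n in sequentially. D \<le> sqrt (real n)"
      using s unfolding filterlim_at_top by blast
    then show "\<forall>\<^sub>F n in sequentially. norm (perm_avg n (\<lambda>\<pi>. exp (\<i> * complex_of_real (t \<bullet> fluct f n \<pi>)))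
       - exp (\<i>\<^sup>2 * complex_of_real (t \<bullet> (cov_mat f n *v t)) / 2)) \<le> D / sqrt (real n)"
      using eventually_ge_at_top[of 4] by eventually_elim (rule D)
  qed
  ultimately have "(\<lambda>n. perm_avg n (\<lambda>\<pi>. exp (\<i> * complex_of_real (t \<bullet> fluct f n \<pi>))))
    \<longlonglongrightarrow> exp (\<i>\<^sup>2 * complex_of_real (t \<bullet> (Gamma_mat f *v t)) / 2)"
    by (rule Lim_transform)
  moreover have "exp (\<i>\<^sup>2 * complex_of_real (t \<bullet> (Gamma_mat f *v t)) / 2)
     = complex_of_real (exp (- (t \<bullet> (Gamma_mat f *v t)) / 2))"
    by (simp add: exp_of_real[symmetric])
  ultimately show ?thesis by simp
qed

end

section \<open>The two estimating equations\<close>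

definition pairs :: "nat \<Rightarrow> (nat \<times> nat) set" where
  "pairs n = {(i, j). 1 \<le> i \<and> i < j \<and> j \<le> n}"

lemma finite_pairs [simp]: "finite (pairs n)"
  by (rule finite_subset[of _ "{1..n} \<times> {1..n}"]) (auto simp: pairs_def)

lemma sum_symmetric_pairs:
  fixes g :: "nat \<Rightarrow> nat \<Rightarrow> 'a::real_vector"
  assumes sym: "\<And>i j. g i j = g j i" and diag: "\<And>i. g i i = 0"
  shows "(\<Sum>i = 1..n. \<Sum>j = 1..n. g i j) = 2 *\<^sub>R (\<Sum>(i, j)\<in>pairs n. g i j)"
proof -
  let ?D = "(\<lambda>i. (i, i)) ` {1..n}"
  have split: "{1..n} \<times> {1..n} = pairs n \<union> (prod.swap ` pairs n \<union> ?D)"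
  proof (intro equalityI subsetI)
    fix p assume "p \<in> {1..n} \<times> {1..n}"
    then obtain i j where p: "p = (i, j)" "1 \<le> i" "i \<le> n" "1 \<le> j" "j \<le> n" by auto
    consider "i < j" | "j < i" | "i = j" by linarith
    then show "p \<in> pairs n \<union> (prod.swap ` pairs n \<union> ?D)"
    proof cases
      case 2
      then have "p = prod.swap (j, i)" "(j, i) \<in> pairs n" using p by (auto simp: pairs_def)
      then show ?thesis by blast
    qed (use p in \<open>auto simp: pairs_def\<close>)
  qed (auto simp: pairs_def)
  have "(\<Sum>i = 1..n. \<Sum>j = 1..n. g i j) = (\<Sum>(i, j)\<in>{1..n} \<times> {1..n}. g i j)"
    by (rule sum.cartesian_product)
  also have "\<dots> = (\<Sum>(i, j)\<in>pairs n. g i j) + ((\<Sum>(i, j)\<in>prod.swap ` pairs n. g i j) + (\<Sum>(i, j)\<in>?D. g i j))"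
    unfolding split by (subst sum.union_disjoint, simp, simp, force simp: pairs_def)+ simp
  also have "(\<Sum>(i, j)\<in>?D. g i j) = 0"
    by (rule sum.neutral) (auto simp: diag)
  also have "(\<Sum>(i, j)\<in>prod.swap ` pairs n. g i j) = (\<Sum>(i, j)\<in>pairs n. g i j)"
    by (subst sum.reindex) (auto simp: inj_on_def prod.swap_def split_beta sym intro!: sum.cong)
  finally show ?thesis by (simp add: scaleR_2)
qed

lemma swap_stat_sym: "swap_stat f n \<pi> i j = swap_stat f n \<pi> j i"
  by (simp add: swap_stat_def algebra_simps)

lemma swap_stat_diag: "swap_stat f n \<pi> i i = 0"
  by (simp add: swap_stat_def)

text \<open>Its derivative is minus the weight \<open>1 / (1 + exp u)\<close> of the pseudo-likelihood equation.\<close>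

definition logistic_loss :: "real \<Rightarrow> real" where
  "logistic_loss u = ln (1 + exp (- u))"

lemma logistic_loss_deriv: "(logistic_loss has_real_derivative - (1 / (1 + exp u))) (at u)"
proof -
  have "1 + exp (- u) \<noteq> (0::real)" using exp_gt_zero[of "- u"] by linarith
  then show ?thesis
    unfolding logistic_loss_def[abs_def]
    by (auto intro!: derivative_eq_intros simp: add_pos_pos exp_minus field_simps)
qed

lemma logistic_deriv: "((\<lambda>u. - (1 / (1 + exp u))) has_real_derivative exp u / (1 + exp u)\<^sup>2) (at u)"
proof -
  have "1 + exp u \<noteq> (0::real)" using exp_gt_zero[of u] by linarith
  then show ?thesis
    by (auto intro!: derivative_eq_intros simp: power2_eq_square)
qed

text \<open>The deviation is minus one quarter of the square of \<open>(exp t - 1) / (exp t + 1)\<close>, which is bounded by \<open>\<bar>t\<bar>\<close>.\<close>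

lemma logistic_second_deriv_bound: "\<bar>exp t / (1 + exp t)\<^sup>2 - 1 / 4\<bar> \<le> t\<^sup>2 / 4" for t :: real
proof -
  have p: "1 + exp t > 0" using exp_gt_zero[of t] by linarith
  have "\<bar>(exp t - 1) / (1 + exp t)\<bar> \<le> \<bar>t\<bar>"
  proof (cases "t \<ge> 0")
    case True
    have "1 - t \<le> exp (- t)" using exp_ge_add_one_self[of "- t"] by simp
    then have "(1 - t) * exp t \<le> exp (- t) * exp t" by (intro mult_right_mono) auto
    then have "exp t - 1 \<le> t * exp t" by (simp add: left_diff_distrib flip: exp_add)
    also have "\<dots> \<le> t * (1 + exp t)" using True by (intro mult_left_mono) auto
    finally show ?thesis using True p by (simp add: divide_le_eq)
  next
    case False
    have "1 - exp t \<le> - t" using exp_ge_add_one_self[of t] by linarith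
    also have "\<dots> \<le> - t * (1 + exp t)" using False by (simp add: mult_le_0_iff distrib_left)
    finally have "(1 - exp t) / (1 + exp t) \<le> - t" using p by (simp add: divide_le_eq)
    moreover have "\<bar>(exp t - 1) / (1 + exp t)\<bar> = (1 - exp t) / (1 + exp t)"
      using False p by (simp add: abs_divide)
    ultimately show ?thesis using False by simp
  qed
  then have "((exp t - 1) / (1 + exp t))\<^sup>2 \<le> t\<^sup>2" by (simp only: abs_le_square_iff)
  moreover have "exp t / (1 + exp t)\<^sup>2 - 1 / 4 = - (((exp t - 1) / (1 + exp t))\<^sup>2 / 4)"
  proof -
    have "exp t / (1 + exp t)\<^sup>2 - 1 / 4 = (4 * exp t - (1 + exp t)\<^sup>2) / (4 * (1 + exp t)\<^sup>2)"
      using p by (simp add: diff_divide_distrib)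
    also have "4 * exp t - (1 + exp t)\<^sup>2 = - ((exp t - 1)\<^sup>2)"
      by (simp add: power2_eq_square algebra_simps)
    finally show ?thesis by (simp add: power_divide)
  qed
  ultimately show ?thesis by simp
qed

lemma logistic_loss_expansion: "\<bar>logistic_loss u - (ln 2 - u / 2 + u\<^sup>2 / 8)\<bar> \<le> u ^ 4 / 8"
proof -
  define diff where "diff m = (if m = 0 then logistic_loss else if m = 1 then (\<lambda>u. - (1 / (1 + exp u)))
     else (\<lambda>u. exp u / (1 + exp u)\<^sup>2))" for m :: nat
  have "\<exists>t. \<bar>t\<bar> \<le> \<bar>u\<bar> \<and> logistic_loss u = (\<Sum>m<2. diff m 0 / fact m * u ^ m) + diff 2 t / fact 2 * u ^ 2"
  proof (rule Maclaurin_bi_le)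
    show "\<forall>m t. m < 2 \<and> \<bar>t\<bar> \<le> \<bar>u\<bar> \<longrightarrow> (diff m has_real_derivative diff (Suc m) t) (at t)"
      using logistic_loss_deriv logistic_deriv by (auto simp: diff_def less_2_cases_iff)
  qed (simp add: diff_def)
  then obtain t where t: "\<bar>t\<bar> \<le> \<bar>u\<bar>"
    and eq: "logistic_loss u = ln 2 - u / 2 + exp t / (1 + exp t)\<^sup>2 / 2 * u\<^sup>2"
    by (auto simp: diff_def numeral_2_eq_2 logistic_loss_def)
  have "logistic_loss u - (ln 2 - u / 2 + u\<^sup>2 / 8) = (exp t / (1 + exp t)\<^sup>2 - 1 / 4) * (u\<^sup>2 / 2)"
    unfolding eq by (simp add: algebra_simps)
  also have "\<bar>\<dots>\<bar> \<le> (t\<^sup>2 / 4) * (u\<^sup>2 / 2)"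
    unfolding abs_mult by (intro mult_mono logistic_second_deriv_bound) auto
  also have "\<dots> \<le> (u\<^sup>2 / 4) * (u\<^sup>2 / 2)"
    using t by (intro mult_right_mono) (auto simp: abs_le_square_iff)
  finally show ?thesis by (simp add: power4_eq_xxxx power2_eq_square)
qed

text \<open>The negative log-pseudo-likelihood: the root condition is that its gradient, \<open>- pl_score\<close>, vanishes.\<close>

definition pl_potential :: "(real \<times> real \<Rightarrow> real ^ 'l) \<Rightarrow> nat \<Rightarrow> (nat \<Rightarrow> nat) \<Rightarrow> real ^ 'l \<Rightarrow> real" where
  "pl_potential f n \<pi> \<theta> = (\<Sum>(i, j)\<in>pairs n. logistic_loss (\<theta> \<bullet> swap_stat f n \<pi> i j))"

definition pl_score :: "(real \<times> real \<Rightarrow> real ^ 'l) \<Rightarrow> nat \<Rightarrow> (nat \<Rightarrow> nat) \<Rightarrow> real ^ 'l \<Rightarrow> real ^ 'l" where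
  "pl_score f n \<pi> \<theta> = (\<Sum>(i, j)\<in>pairs n.
     (1 / (1 + exp (\<theta> \<bullet> swap_stat f n \<pi> i j))) *\<^sub>R swap_stat f n \<pi> i j)"

lemma is_root_PL_iff: "is_root_PL f n \<pi> \<theta> \<longleftrightarrow> pl_score f n \<pi> \<theta> = 0"
  by (simp add: is_root_PL_def pl_score_def pairs_def)

lemma pl_potential_deriv:
  "(pl_potential f n \<pi> has_derivative (\<lambda>x. x \<bullet> (- pl_score f n \<pi> \<theta>))) (at \<theta>)"
proof -
  have "((\<lambda>\<theta>. logistic_loss (\<theta> \<bullet> y)) has_derivative (\<lambda>x. x \<bullet> (- ((1 / (1 + exp (\<theta> \<bullet> y))) *\<^sub>R y)))) (at \<theta>)" for y
  proof -
    have "((\<lambda>\<theta>. \<theta> \<bullet> y) has_derivative (\<lambda>x. x \<bullet> y)) (at \<theta>)" by (auto intro!: derivative_eq_intros)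
    from has_derivative_compose[OF this logistic_loss_deriv[of "\<theta> \<bullet> y", unfolded has_field_derivative_def]]
    show ?thesis by (simp add: mult.commute)
  qed
  then show ?thesis
    unfolding pl_potential_def[abs_def] pl_score_def sum_negf[symmetric] inner_sum_right split_beta
    by (intro has_derivative_sum)
qed

lemma energy_form: "d \<bullet> (energy_mat f n \<pi> *v d) = (\<Sum>i = 1..n. \<Sum>j = 1..n. (d \<bullet> swap_stat f n \<pi> i j)\<^sup>2) / (4 * (real n)\<^sup>2)"
  unfolding energy_mat_def gram_form by (simp add: power2_eq_square)

lemma energy_form_pairs: "d \<bullet> (energy_mat f n \<pi> *v d) = (\<Sum>(i, j)\<in>pairs n. (d \<bullet> swap_stat f n \<pi> i j)\<^sup>2) / (2 * (real n)\<^sup>2)"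
  unfolding energy_form
  by (subst sum_symmetric_pairs) (auto simp: swap_stat_diag swap_stat_sym[of _ _ _ _ "_::nat"])

text \<open>The logistic weight is strictly decreasing, so the inner product of the difference of the scores with
  the difference of the roots is a sum of terms of one sign. If it is zero, the two roots agree on every
  swap statistic, and nondegeneracy of the swap energy forces them to be equal.\<close>

lemma pl_root_unique:
  assumes nondeg: "\<And>d. d \<noteq> 0 \<Longrightarrow> 0 < d \<bullet> (energy_mat f n \<pi> *v d)"
    and r1: "is_root_PL f n \<pi> \<theta>1" and r2: "is_root_PL f n \<pi> \<theta>2"
  shows "\<theta>1 = \<theta>2"
proof (rule ccontr)
  assume ne: "\<theta>1 \<noteq> \<theta>2"
  let ?d = "\<theta>1 - \<theta>2" and ?y = "\<lambda>p. swap_stat f n \<pi> (fst p) (snd p)"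
  let ?g = "\<lambda>u::real. 1 / (1 + exp u)"
  have sc: "(\<Sum>p\<in>pairs n. ?g (\<theta> \<bullet> ?y p) * (?d \<bullet> ?y p)) = ?d \<bullet> pl_score f n \<pi> \<theta>" for \<theta>
    by (simp add: pl_score_def inner_sum_right split_beta)
  have "(\<Sum>p\<in>pairs n. (?g (\<theta>2 \<bullet> ?y p) - ?g (\<theta>1 \<bullet> ?y p)) * (\<theta>1 \<bullet> ?y p - \<theta>2 \<bullet> ?y p)) = 0"
    using sc[of \<theta>1] sc[of \<theta>2] r1 r2
    by (simp add: is_root_PL_iff left_diff_distrib sum_subtractf inner_diff_left)
  moreover have mono: "0 < (?g b - ?g a) * (a - b)" if "a \<noteq> b" for a b :: real
  proof -
    have g: "?g a < ?g b" if "b < a" for a b :: real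
      using that by (intro divide_strict_left_mono) (auto intro!: add_pos_pos mult_pos_pos)
    show ?thesis
    proof (cases "b < a")
      case True
      then show ?thesis using g[OF True] by (intro mult_pos_pos) auto
    next
      case False
      then have "a < b" using that by simp
      then show ?thesis using g by (intro mult_neg_neg) auto
    qed
  qed
  then have nn: "0 \<le> (?g b - ?g a) * (a - b)" for a b :: real
    by (cases "a = b") (auto intro: less_imp_le)
  ultimately have "\<forall>p\<in>pairs n. (?g (\<theta>2 \<bullet> ?y p) - ?g (\<theta>1 \<bullet> ?y p)) * (\<theta>1 \<bullet> ?y p - \<theta>2 \<bullet> ?y p) = 0"
    by (subst (asm) sum_nonneg_eq_0_iff) auto
  then have "\<theta>1 \<bullet> ?y p = \<theta>2 \<bullet> ?y p" if "p \<in> pairs n" for p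
    using mono[of "\<theta>1 \<bullet> ?y p" "\<theta>2 \<bullet> ?y p"] that by force
  then have "?d \<bullet> (energy_mat f n \<pi> *v ?d) = 0"
    unfolding energy_form_pairs by (simp add: split_beta inner_diff_left)
  with nondeg[of ?d] ne show False by simp
qed

text \<open>The terms of the swap statistics that mix two indices sum to the total over the centred grid, which is zero.
  Hence the pseudo-likelihood score at zero is a multiple of the centred sufficient statistic, exactly
  and not just asymptotically.\<close>

lemma sum_swap_stat_pairs:
  assumes \<pi>: "\<pi> \<in> perms n" and n: "n > 0"
  shows "(\<Sum>(i, j)\<in>pairs n. swap_stat f n \<pi> i j) = (real n * sqrt (real n)) *\<^sub>R fluct f n \<pi>"
proof -
  let ?b = "\<lambda>i j. cgrid f n i (\<pi> j)"
  have rows: "(\<Sum>j = 1..n. ?b i j) = 0" for i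
    using sum.reindex_bij_betw[OF perms_bij[OF \<pi>], of "cgrid f n i"] cgrid_row_sum[OF n] by simp
  have cols: "(\<Sum>i = 1..n. ?b i j) = 0" for j
    using cgrid_col_sum[OF n] by simp
  have cols': "(\<Sum>i = 1..n. \<Sum>j = 1..n. ?b j i) = 0"
    using cols by simp
  have "2 *\<^sub>R (\<Sum>(i, j)\<in>pairs n. swap_stat f n \<pi> i j) = (\<Sum>i = 1..n. \<Sum>j = 1..n. swap_stat f n \<pi> i j)"
    by (rule sum_symmetric_pairs[symmetric]) (rule swap_stat_sym, rule swap_stat_diag)
  also have "\<dots> = (\<Sum>i = 1..n. \<Sum>j = 1..n. ?b i i) + (\<Sum>i = 1..n. \<Sum>j = 1..n. ?b j j)"
    unfolding swap_stat_cgrid sum.distrib sum_subtractf using rows cols' by simp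
  also have "\<dots> = real n *\<^sub>R (\<Sum>i = 1..n. ?b i i) + real n *\<^sub>R (\<Sum>i = 1..n. ?b i i)"
    by (simp only: sum_constant_scaleR card_atLeastAtMost scaleR_right.sum[symmetric]) simp
  also have "(\<Sum>i = 1..n. ?b i i) = sqrt (real n) *\<^sub>R fluct f n \<pi>"
    using n by (simp add: sum_cgrid_perm[OF \<pi> n] fluct_def del: One_nat_def)
  finally have "2 *\<^sub>R (\<Sum>(i, j)\<in>pairs n. swap_stat f n \<pi> i j)
    = (real n * sqrt (real n)) *\<^sub>R fluct f n \<pi> + (real n * sqrt (real n)) *\<^sub>R fluct f n \<pi>"
    by (simp only: scaleR_scaleR)
  then show ?thesis unfolding scaleR_2[symmetric] scaleR_cancel_left by simp
qed

text \<open>The potential in the local parameter \<open>h = sqrt n *\<^sub>R \<theta>\<close>, normalised such that it vanishes at \<open>0\<close> and has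
  a limiting Hessian \<open>\<Gamma>\<close>.\<close>

definition pl_local :: "(real \<times> real \<Rightarrow> real ^ 'l) \<Rightarrow> nat \<Rightarrow> (nat \<Rightarrow> nat) \<Rightarrow> real ^ 'l \<Rightarrow> real" where
  "pl_local f n \<pi> h = (2 / real n) * (pl_potential f n \<pi> (h /\<^sub>R sqrt (real n)) - real (card (pairs n)) * ln 2)"

lemma pl_local_deriv:
  "(pl_local f n \<pi> has_derivative (\<lambda>x. x \<bullet> (- (2 / (real n * sqrt (real n))) *\<^sub>R pl_score f n \<pi> (h /\<^sub>R sqrt (real n))))) (at h)"
proof -
  have "((\<lambda>h. h /\<^sub>R sqrt (real n)) has_derivative (\<lambda>x. x /\<^sub>R sqrt (real n))) (at h)"
    by (auto intro!: derivative_eq_intros)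
  from has_derivative_compose[OF this pl_potential_deriv]
  have "((\<lambda>h. (2 / real n) * (pl_potential f n \<pi> (h /\<^sub>R sqrt (real n)) - real (card (pairs n)) * ln 2)) has_derivative
     (\<lambda>x. (2 / real n) * ((x /\<^sub>R sqrt (real n)) \<bullet> (- pl_score f n \<pi> (h /\<^sub>R sqrt (real n))) - 0))) (at h)"
    by (intro has_derivative_mult_right has_derivative_diff has_derivative_const)
  then show ?thesis
    unfolding pl_local_def[abs_def] by (simp add: field_simps)
qed

text \<open>Second-order expansion of each logistic loss. The linear terms sum to \<open>- h \<bullet> fluct\<close>, the quadratic ones to the
  energy form, and the fourth-order remainders, of size \<open>O(1 / n\<^sup>2)\<close> each, are at most \<open>n\<^sup>2\<close> in number
  with a prefactor \<open>2 / n\<close>.\<close>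

lemma pl_local_expansion:
  assumes \<pi>: "\<pi> \<in> perms n" and n: "n > 0"
    and Y: "\<And>i j. i \<in> {1..n} \<Longrightarrow> j \<in> {1..n} \<Longrightarrow> norm (swap_stat f n \<pi> i j) \<le> Y" and h: "norm h \<le> K"
  shows "\<bar>pl_local f n \<pi> h - (h \<bullet> (energy_mat f n \<pi> *v h) / 2 - h \<bullet> fluct f n \<pi>)\<bar> \<le> (K * Y) ^ 4 / (4 * real n)"
proof -
  have n0: "real n > 0" using n by simp
  let ?r = "sqrt (real n)"
  define u where "u p = (h /\<^sub>R ?r) \<bullet> swap_stat f n \<pi> (fst p) (snd p)" for p
  have lin: "(\<Sum>p\<in>pairs n. u p) = real n * (h \<bullet> fluct f n \<pi>)"
  proof -
    have "(\<Sum>p\<in>pairs n. u p) = (h /\<^sub>R ?r) \<bullet> (\<Sum>(i, j)\<in>pairs n. swap_stat f n \<pi> i j)"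
      by (simp add: u_def inner_sum_right split_beta)
    then show ?thesis unfolding sum_swap_stat_pairs[OF \<pi> n] using n0 by simp
  qed
  have quad: "(\<Sum>p\<in>pairs n. (u p)\<^sup>2) = 2 * real n * (h \<bullet> (energy_mat f n \<pi> *v h))"
  proof -
    have "(u p)\<^sup>2 = (h \<bullet> swap_stat f n \<pi> (fst p) (snd p))\<^sup>2 / real n" for p
      using n0 by (simp add: u_def power_divide power_mult_distrib power_inverse divide_inverse)
    then have "(\<Sum>p\<in>pairs n. (u p)\<^sup>2) = (\<Sum>(i, j)\<in>pairs n. (h \<bullet> swap_stat f n \<pi> i j)\<^sup>2) / real n"
      by (simp add: sum_divide_distrib split_beta)
    then show ?thesis unfolding energy_form_pairs using n0 by (simp add: power2_eq_square)
  qed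
  have ub: "\<bar>logistic_loss (u p) - (ln 2 - u p / 2 + (u p)\<^sup>2 / 8)\<bar> \<le> (K * Y) ^ 4 / (8 * (real n)\<^sup>2)" if p: "p \<in> pairs n" for p
  proof -
    have Yp: "norm (swap_stat f n \<pi> (fst p) (snd p)) \<le> Y"
      using p by (intro Y) (auto simp: pairs_def)
    have "\<bar>u p\<bar> \<le> norm (h /\<^sub>R ?r) * norm (swap_stat f n \<pi> (fst p) (snd p))"
      unfolding u_def by (rule Cauchy_Schwarz_ineq2)
    also have "\<dots> \<le> (K / ?r) * Y"
      using h Yp n0 order_trans[OF norm_ge_zero h]
      by (intro mult_mono) (auto simp: divide_inverse mult.commute)
    finally have "\<bar>u p\<bar> ^ 4 \<le> ((K / ?r) * Y) ^ 4" by (intro power_mono) auto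
    also have "\<dots> = (K * Y) ^ 4 / ?r ^ 4" by (simp add: power_mult_distrib power_divide)
    also have "?r ^ 4 = (real n)\<^sup>2" using power_mult[of ?r 2 2] n0 by simp
    finally have "(u p) ^ 4 \<le> (K * Y) ^ 4 / (real n)\<^sup>2" by (simp add: power_even_abs)
    then show ?thesis using logistic_loss_expansion[of "u p"] by simp
  qed
  have "pl_potential f n \<pi> (h /\<^sub>R ?r) = (\<Sum>p\<in>pairs n. logistic_loss (u p))"
    by (simp add: pl_potential_def u_def split_beta)
  then have "pl_potential f n \<pi> (h /\<^sub>R ?r) - real (card (pairs n)) * ln 2
     = (\<Sum>p\<in>pairs n. logistic_loss (u p) - (ln 2 - u p / 2 + (u p)\<^sup>2 / 8)) - (\<Sum>p\<in>pairs n. u p) / 2 + (\<Sum>p\<in>pairs n. (u p)\<^sup>2) / 8"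
    by (simp add: sum_subtractf sum.distrib sum_divide_distrib)
  then have "pl_local f n \<pi> h - (h \<bullet> (energy_mat f n \<pi> *v h) / 2 - h \<bullet> fluct f n \<pi>)
    = (2 / real n) * (\<Sum>p\<in>pairs n. logistic_loss (u p) - (ln 2 - u p / 2 + (u p)\<^sup>2 / 8))"
    unfolding pl_local_def lin quad using n0 by (simp add: field_simps)
  also have "\<bar>\<dots>\<bar> \<le> (2 / real n) * (\<Sum>p\<in>pairs n. (K * Y) ^ 4 / (8 * (real n)\<^sup>2))"
    unfolding abs_mult using n0
    by (intro mult_mono order_trans[OF sum_abs sum_mono] ub) auto
  also have "\<dots> \<le> (2 / real n) * ((real n)\<^sup>2 * ((K * Y) ^ 4 / (8 * (real n)\<^sup>2)))"
  proof -
    have "card (pairs n) \<le> card ({1..n} \<times> {1..n})" by (rule card_mono) (auto simp: pairs_def)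
    then have "real (card (pairs n)) \<le> (real n)\<^sup>2" by (simp add: power2_eq_square flip: of_nat_mult)
    then show ?thesis using n0 by (simp del: times_divide_eq_left times_divide_eq_right, intro mult_left_mono mult_right_mono) auto
  qed
  also have "\<dots> = (K * Y) ^ 4 / (4 * real n)" using n0 by (simp add: field_simps power2_eq_square)
  finally show ?thesis .
qed

text \<open>The mean of the sufficient statistic under the model with parameter \<open>\<theta>\<close>, which is the gradient of the
  log-partition function.\<close>

definition gibbs_mean :: "(real \<times> real \<Rightarrow> real ^ 'l) \<Rightarrow> nat \<Rightarrow> real ^ 'l \<Rightarrow> real ^ 'l" where
  "gibbs_mean f n \<theta> = (\<Sum>\<pi>\<in>perms n. exp (\<theta> \<bullet> suff_stat f n \<pi>) *\<^sub>R suff_stat f n \<pi>)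
     /\<^sub>R (\<Sum>\<pi>\<in>perms n. exp (\<theta> \<bullet> suff_stat f n \<pi>))"

lemma perms_nonempty: "perms n \<noteq> {}"
  using card_perms[of n] by (metis card.empty fact_nonzero)

lemma partition_pos: "0 < (\<Sum>\<pi>\<in>perms n. exp (\<theta> \<bullet> suff_stat f n \<pi>))"
  by (rule sum_pos) (use perms_nonempty in auto)

lemma log_partition_deriv:
  "(log_partition f n has_derivative (\<lambda>x. x \<bullet> gibbs_mean f n \<theta>)) (at \<theta>)"
proof -
  have "((\<lambda>\<theta>. \<Sum>\<pi>\<in>perms n. exp (\<theta> \<bullet> suff_stat f n \<pi>)) has_derivative
     (\<lambda>x. \<Sum>\<pi>\<in>perms n. exp (\<theta> \<bullet> suff_stat f n \<pi>) * (x \<bullet> suff_stat f n \<pi>))) (at \<theta>)"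
    by (auto intro!: derivative_eq_intros simp: mult.commute)
  from has_derivative_ln[OF partition_pos this]
  show ?thesis
    unfolding log_partition_def[abs_def] gibbs_mean_def
    by (simp add: inner_sum_right divide_inverse mult.commute)
qed

lemma is_root_ML_iff: "is_root_ML f n \<pi> \<theta> \<longleftrightarrow> gibbs_mean f n \<theta> = suff_stat f n \<pi>"
proof
  assume "is_root_ML f n \<pi> \<theta>"
  then have "(log_partition f n has_derivative (\<lambda>x. x \<bullet> suff_stat f n \<pi>)) (at \<theta>)"
    by (simp add: is_root_ML_def gderiv_def)
  from has_derivative_unique[OF this log_partition_deriv]
  have "x \<bullet> suff_stat f n \<pi> = x \<bullet> gibbs_mean f n \<theta>" for x by (rule fun_cong)
  then show "gibbs_mean f n \<theta> = suff_stat f n \<pi>" by (metis vector_eq_ldot)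
next
  assume "gibbs_mean f n \<theta> = suff_stat f n \<pi>"
  then show "is_root_ML f n \<pi> \<theta>"
    using log_partition_deriv[of f n \<theta>] by (simp add: is_root_ML_def gderiv_def)
qed

text \<open>The equation says that \<open>X\<close> and \<open>exp X\<close> have zero covariance under the weights \<open>w\<close>. Written as a double sum over pairs
  of points, this covariance consists of nonnegative terms that vanish only where \<open>X\<close> agrees.\<close>

lemma tilted_mean_eq_imp_const:
  fixes X w :: "'a \<Rightarrow> real"
  assumes fin: "finite S" and w: "\<And>a. a \<in> S \<Longrightarrow> 0 < w a"
    and eq: "(\<Sum>a\<in>S. w a * exp (X a) * X a) * (\<Sum>a\<in>S. w a) = (\<Sum>a\<in>S. w a * X a) * (\<Sum>a\<in>S. w a * exp (X a))"
    and ab: "a \<in> S" "b \<in> S"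
  shows "X a = X b"
proof -
  let ?t = "\<lambda>a b. w a * w b * ((X a - X b) * (exp (X a) - exp (X b)))"
  have pos: "0 < (x - y) * (exp x - exp y)" if "x \<noteq> y" for x y :: real
    using that by (cases "x < y") (auto intro: mult_neg_neg mult_pos_pos)
  then have nn: "0 \<le> (x - y) * (exp x - exp y)" for x y :: real
    by (cases "x = y") (auto intro: less_imp_le)
  have "(\<Sum>a\<in>S. \<Sum>b\<in>S. ?t a b) =
     (\<Sum>a\<in>S. \<Sum>b\<in>S. (w a * exp (X a) * X a) * w b) - (\<Sum>a\<in>S. \<Sum>b\<in>S. (w a * X a) * (w b * exp (X b)))
     - (\<Sum>a\<in>S. \<Sum>b\<in>S. (w a * exp (X a)) * (w b * X b)) + (\<Sum>a\<in>S. \<Sum>b\<in>S. w a * (w b * exp (X b) * X b))"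
    unfolding sum_subtractf[symmetric] sum.distrib[symmetric] by (intro sum.cong refl) (simp add: algebra_simps)
  also have "\<dots> = 0"
    unfolding sum_product[symmetric] using eq by (simp add: mult.commute)
  finally have z: "(\<Sum>a\<in>S. \<Sum>b\<in>S. ?t a b) = 0" .
  have t0: "0 \<le> ?t a b" if "a \<in> S" "b \<in> S" for a b
    by (intro mult_nonneg_nonneg[OF mult_nonneg_nonneg[OF less_imp_le[OF w] less_imp_le[OF w]] nn] that)
  have "(\<Sum>b\<in>S. ?t a b) = 0"
    using z ab fin t0 by (subst (asm) sum_nonneg_eq_0_iff) (auto intro!: sum_nonneg)
  then have "?t a b = 0"
    using ab fin t0 by (subst (asm) sum_nonneg_eq_0_iff) auto
  then show ?thesis using w[OF ab(1)] w[OF ab(2)] pos[of "X a" "X b"] by force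
qed

text \<open>The model at one root is an exponential tilt of the model at the other; equal means force the tilting
  statistic to be constant over all permutations. Comparing a permutation with its compositions with
  transpositions, all its swap statistics are orthogonal to the difference of the roots.\<close>

lemma ml_root_unique:
  assumes \<pi>: "\<pi> \<in> perms n" and nondeg: "\<And>d. d \<noteq> 0 \<Longrightarrow> 0 < d \<bullet> (energy_mat f n \<pi> *v d)"
    and r1: "is_root_ML f n \<pi> \<theta>1" and r2: "is_root_ML f n \<pi> \<theta>2"
  shows "\<theta>1 = \<theta>2"
proof (rule ccontr)
  assume ne: "\<theta>1 \<noteq> \<theta>2"
  let ?d = "\<theta>1 - \<theta>2" and ?T = "suff_stat f n"
  let ?w = "\<lambda>\<pi>. exp (\<theta>2 \<bullet> ?T \<pi>)" and ?X = "\<lambda>\<pi>. ?d \<bullet> ?T \<pi>"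
  have gm: "?d \<bullet> gibbs_mean f n \<theta> = (\<Sum>\<pi>\<in>perms n. exp (\<theta> \<bullet> ?T \<pi>) * ?X \<pi>) / (\<Sum>\<pi>\<in>perms n. exp (\<theta> \<bullet> ?T \<pi>))" for \<theta>
    by (simp add: gibbs_mean_def inner_sum_right divide_inverse mult.commute)
  have w1: "?w \<sigma> * exp (?X \<sigma>) = exp (\<theta>1 \<bullet> ?T \<sigma>)" for \<sigma>
    by (simp add: inner_diff_left flip: exp_add)
  have "?d \<bullet> gibbs_mean f n \<theta>1 = ?d \<bullet> gibbs_mean f n \<theta>2"
    using r1 r2 by (simp add: is_root_ML_iff)
  then have eq: "(\<Sum>\<pi>\<in>perms n. ?w \<pi> * exp (?X \<pi>) * ?X \<pi>) * (\<Sum>\<pi>\<in>perms n. ?w \<pi>)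
      = (\<Sum>\<pi>\<in>perms n. ?w \<pi> * ?X \<pi>) * (\<Sum>\<pi>\<in>perms n. ?w \<pi> * exp (?X \<pi>))"
    unfolding gm w1 using partition_pos[where \<theta> = \<theta>1 and f = f and n = n] partition_pos[where \<theta> = \<theta>2 and f = f and n = n]
    by (simp add: frac_eq_eq)
  have const: "?X \<sigma> = ?X \<rho>" if "\<sigma> \<in> perms n" "\<rho> \<in> perms n" for \<sigma> \<rho>
    by (rule tilted_mean_eq_imp_const[OF finite_perms _ eq that]) simp
  have "?d \<bullet> swap_stat f n \<pi> i j = 0" if ij: "i \<in> {1..n}" "j \<in> {1..n}" for i j
  proof -
    let ?a = "\<lambda>i j. ?d \<bullet> grid f n i j"
    have ls: "lin_stat n ?a \<sigma> = ?X \<sigma>" for \<sigma>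
      unfolding lin_stat_def suff_stat_def grid_def by (simp add: inner_sum_right)
    have "\<pi> \<circ> Transposition.transpose i j \<in> perms n"
      using \<pi> ij unfolding perms_def by (auto intro!: permutes_compose permutes_swap_id)
    from const[OF this \<pi>] have "lin_stat n ?a (\<pi> \<circ> Transposition.transpose i j) = lin_stat n ?a \<pi>"
      unfolding ls .
    then have "swap_diff ?a \<pi> i j = 0" using lin_stat_transpose[OF ij, of ?a \<pi>] by simp
    then show ?thesis by (simp add: swap_diff_def swap_stat_def grid_def inner_add_right inner_diff_right)
  qed
  then have "?d \<bullet> (energy_mat f n \<pi> *v ?d) = 0" unfolding energy_form by simp
  with nondeg[of ?d] ne show False by simp
qed

text \<open>The negative log-likelihood in the local parameter, with the constant chosen such that it vanishes at \<open>0\<close>.\<close>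

definition ml_local :: "(real \<times> real \<Rightarrow> real ^ 'l) \<Rightarrow> nat \<Rightarrow> (nat \<Rightarrow> nat) \<Rightarrow> real ^ 'l \<Rightarrow> real" where
  "ml_local f n \<pi> h = log_partition f n (h /\<^sub>R sqrt (real n)) - (h /\<^sub>R sqrt (real n)) \<bullet> suff_stat f n \<pi> - ln (fact n)"

lemma ml_local_deriv:
  "(ml_local f n \<pi> has_derivative (\<lambda>x. x \<bullet> ((gibbs_mean f n (h /\<^sub>R sqrt (real n)) - suff_stat f n \<pi>) /\<^sub>R sqrt (real n)))) (at h)"
proof -
  have l: "((\<lambda>h. h /\<^sub>R sqrt (real n)) has_derivative (\<lambda>x. x /\<^sub>R sqrt (real n))) (at h)"
    by (auto intro!: derivative_eq_intros)
  have "((\<lambda>h. log_partition f n (h /\<^sub>R sqrt (real n)) - (h /\<^sub>R sqrt (real n)) \<bullet> suff_stat f n \<pi> - ln (fact n)) has_derivative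
     (\<lambda>x. (x /\<^sub>R sqrt (real n)) \<bullet> gibbs_mean f n (h /\<^sub>R sqrt (real n)) - (x /\<^sub>R sqrt (real n)) \<bullet> suff_stat f n \<pi> - 0)) (at h)"
    by (intro has_derivative_diff has_derivative_const has_derivative_inner_left l has_derivative_compose[OF l log_partition_deriv])
  then show ?thesis
    unfolding ml_local_def[abs_def] by (simp add: inner_diff_right right_diff_distrib)
qed

text \<open>Centring \<open>suff_stat\<close> by its mean changes the log-partition function by a linear term, which cancels.\<close>

lemma ml_local_eq:
  assumes \<pi>: "\<pi> \<in> perms n" and n: "n > 0"
  shows "ml_local f n \<pi> h = ln (perm_avg n (\<lambda>\<sigma>. exp (h \<bullet> fluct f n \<sigma>))) - h \<bullet> fluct f n \<pi>"
proof -
  let ?r = "sqrt (real n)" and ?m = "real n *\<^sub>R grid_mean f n"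
  have fl: "h \<bullet> fluct f n \<sigma> = (h /\<^sub>R ?r) \<bullet> suff_stat f n \<sigma> - (h /\<^sub>R ?r) \<bullet> ?m" for \<sigma>
    by (simp add: fluct_def inner_diff_right right_diff_distrib)
  have "perm_avg n (\<lambda>\<sigma>. exp (h \<bullet> fluct f n \<sigma>))
     = exp (- ((h /\<^sub>R ?r) \<bullet> ?m)) * (\<Sum>\<sigma>\<in>perms n. exp ((h /\<^sub>R ?r) \<bullet> suff_stat f n \<sigma>)) / fact n"
    unfolding perm_avg_def fl exp_diff
    by (simp add: sum_divide_distrib[symmetric] exp_minus field_simps)
  then have "ln (perm_avg n (\<lambda>\<sigma>. exp (h \<bullet> fluct f n \<sigma>)))
     = - ((h /\<^sub>R ?r) \<bullet> ?m) + log_partition f n (h /\<^sub>R ?r) - ln (fact n)"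
    using partition_pos[where \<theta> = "h /\<^sub>R ?r" and f = f and n = n]
    by (simp only: log_partition_def) (subst ln_div, auto simp: ln_mult)
  then show ?thesis unfolding ml_local_def fl by simp
qed

section \<open>Convergence in distribution from trigonometric test functions\<close>

text \<open>Real trigonometric polynomials with arbitrary real frequency vectors. Products stay in this class by the
  addition formulas.\<close>

inductive trig_poly :: "('a::euclidean_space \<Rightarrow> real) \<Rightarrow> bool" where
  trig_cos: "trig_poly (\<lambda>x. c * cos (t \<bullet> x))"
| trig_sin: "trig_poly (\<lambda>x. c * sin (t \<bullet> x))"
| trig_add: "trig_poly p \<Longrightarrow> trig_poly q \<Longrightarrow> trig_poly (\<lambda>x. p x + q x)"

lemma trig_poly_const: "trig_poly (\<lambda>x. c)"
  using trig_cos[of c 0] by simp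

lemma trig_poly_continuous: "trig_poly p \<Longrightarrow> continuous_on S p"
  by (induction rule: trig_poly.induct) (auto intro!: continuous_intros)

lemma trig_poly_bounded: "trig_poly p \<Longrightarrow> \<exists>M. \<forall>x. \<bar>p x\<bar> \<le> M"
proof (induction rule: trig_poly.induct)
  case (trig_cos c t)
  have "\<bar>c * cos (t \<bullet> x)\<bar> \<le> \<bar>c\<bar>" for x by (simp add: abs_mult mult_left_le)
  then show ?case by blast
next
  case (trig_sin c t)
  have "\<bar>c * sin (t \<bullet> x)\<bar> \<le> \<bar>c\<bar>" for x by (simp add: abs_mult mult_left_le)
  then show ?case by blast
next
  case (trig_add p q)
  then obtain M N where "\<And>x. \<bar>p x\<bar> \<le> M" "\<And>x. \<bar>q x\<bar> \<le> N" by blast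
  then have "\<bar>p x + q x\<bar> \<le> M + N" for x by (rule order_trans[OF abs_triangle_ineq add_mono])
  then show ?case by blast
qed

lemma trig_poly_mult_cos: "trig_poly p \<Longrightarrow> trig_poly (\<lambda>x. p x * (c * cos (t \<bullet> x)))"
proof (induction rule: trig_poly.induct)
  case (trig_cos d s)
  have "(\<lambda>x. (d * c / 2) * cos ((s - t) \<bullet> x) + (d * c / 2) * cos ((s + t) \<bullet> x))
     = (\<lambda>x. d * cos (s \<bullet> x) * (c * cos (t \<bullet> x)))"
    by (rule ext) (simp add: inner_diff_left inner_add_left cos_add cos_diff algebra_simps)
  then show ?case by (rule back_subst[of trig_poly, OF trig_poly.trig_add[OF trig_poly.trig_cos trig_poly.trig_cos]])
next
  case (trig_sin d s)
  have "(\<lambda>x. (d * c / 2) * sin ((s - t) \<bullet> x) + (d * c / 2) * sin ((s + t) \<bullet> x))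
     = (\<lambda>x. d * sin (s \<bullet> x) * (c * cos (t \<bullet> x)))"
    by (rule ext) (simp add: inner_diff_left inner_add_left sin_add sin_diff algebra_simps)
  then show ?case by (rule back_subst[of trig_poly, OF trig_poly.trig_add[OF trig_poly.trig_sin trig_poly.trig_sin]])
next
  case (trig_add p q)
  then show ?case using trig_poly.trig_add by (simp add: distrib_right)
qed

lemma trig_poly_mult_sin: "trig_poly p \<Longrightarrow> trig_poly (\<lambda>x. p x * (c * sin (t \<bullet> x)))"
proof (induction rule: trig_poly.induct)
  case (trig_cos d s)
  have "(\<lambda>x. (d * c / 2) * sin ((s + t) \<bullet> x) + (- d * c / 2) * sin ((s - t) \<bullet> x))
     = (\<lambda>x. d * cos (s \<bullet> x) * (c * sin (t \<bullet> x)))"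
    by (rule ext) (simp add: inner_diff_left inner_add_left sin_add sin_diff algebra_simps)
  then show ?case by (rule back_subst[of trig_poly, OF trig_poly.trig_add[OF trig_poly.trig_sin trig_poly.trig_sin]])
next
  case (trig_sin d s)
  have "(\<lambda>x. (d * c / 2) * cos ((s - t) \<bullet> x) + (- d * c / 2) * cos ((s + t) \<bullet> x))
     = (\<lambda>x. d * sin (s \<bullet> x) * (c * sin (t \<bullet> x)))"
    by (rule ext) (simp add: inner_diff_left inner_add_left cos_add cos_diff algebra_simps)
  then show ?case by (rule back_subst[of trig_poly, OF trig_poly.trig_add[OF trig_poly.trig_cos trig_poly.trig_cos]])
next
  case (trig_add p q)
  then show ?case using trig_poly.trig_add by (simp add: distrib_right)
qed

lemma trig_poly_mult: 
  assumes "trig_poly p" shows "trig_poly q \<Longrightarrow> trig_poly (\<lambda>x. p x * q x)"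
proof (induction q rule: trig_poly.induct)
  case (trig_add q r)
  then show ?case using trig_poly.trig_add by (simp add: distrib_left)
qed (auto intro: trig_poly_mult_cos trig_poly_mult_sin assms)

lemma trig_poly_compose_polynomial:
  assumes "real_polynomial_function q" and p: "trig_poly p"
  shows "trig_poly (\<lambda>x. q (p x))"
  using assms(1)
proof (induction rule: real_polynomial_function.induct)
  case (linear f)
  have "f y = y * f 1" for y
    using linear_cmul[OF bounded_linear.linear[OF linear], of y 1] by (simp only: real_scaleR_def mult_1_right)
  then have "(\<lambda>x. p x * f 1) = (\<lambda>x. f (p x))" by (intro ext) (rule sym)
  then show ?case by (rule back_subst[of trig_poly, OF trig_poly_mult[OF p trig_poly_const]])
qed (auto intro: trig_poly_const trig_add trig_poly_mult)

text \<open>A frequency vector \<open>t\<close> with \<open>t \<bullet> (x - y) = 1\<close> works since \<open>1\<close> is not a multiple of \<open>2 * pi\<close>.\<close>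

lemma trig_poly_separates:
  fixes x y :: "'a::euclidean_space"
  assumes "x \<noteq> y" shows "\<exists>p. trig_poly p \<and> p x \<noteq> p y"
proof -
  define t where "t = (1 / (norm (x - y))\<^sup>2) *\<^sub>R (x - y)"
  have "t \<bullet> (x - y) = 1"
    using assms by (simp add: t_def power2_norm_eq_inner)
  then have eq: "t \<bullet> x - t \<bullet> y = 1" by (simp add: inner_diff_right)
  have "\<not> (cos (t \<bullet> x) = cos (t \<bullet> y) \<and> sin (t \<bullet> x) = sin (t \<bullet> y))"
  proof
    assume "cos (t \<bullet> x) = cos (t \<bullet> y) \<and> sin (t \<bullet> x) = sin (t \<bullet> y)"
    then have "cos (t \<bullet> x - t \<bullet> y) = 1"
      using sin_cos_squared_add[of "t \<bullet> y"] by (simp add: cos_diff power2_eq_square)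
    then have "cos 1 = (1::real)" using eq by simp
    moreover have "cos 1 < cos (0::real)"
      by (rule cos_monotone_0_pi) (use pi_gt3 in auto)
    ultimately show False by simp
  qed
  then consider "1 * cos (t \<bullet> x) \<noteq> 1 * cos (t \<bullet> y)" | "1 * sin (t \<bullet> x) \<noteq> 1 * sin (t \<bullet> y)"
    unfolding mult_1 by blast
  then show ?thesis
  proof cases
    case 1
    show ?thesis by (rule exI[of _ "\<lambda>x. 1 * cos (t \<bullet> x)"], rule conjI[OF trig_cos 1])
  next
    case 2
    show ?thesis by (rule exI[of _ "\<lambda>x. 1 * sin (t \<bullet> x)"], rule conjI[OF trig_sin 2])
  qed
qed

text \<open>Stone--Weierstrass on a ball gives an approximation that may be large outside the ball. Composing it with
  a polynomial that approximates truncation at level \<open>B\<close>, on the bounded range of the first approximation,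
  restores a global bound and leaves the approximation on the ball intact.\<close>

lemma trig_poly_clipped_approximation:
  fixes h :: "'a::euclidean_space \<Rightarrow> real"
  assumes h: "continuous_on UNIV h" and B: "\<And>x. \<bar>h x\<bar> \<le> B" and e: "e > 0"
  obtains r where "trig_poly r" "\<And>x. norm x \<le> K \<Longrightarrow> \<bar>h x - r x\<bar> \<le> 2 * e"
    "\<And>x. \<bar>h x - r x\<bar> \<le> 2 * B + e"
proof -
  interpret function_ring_on "Collect (trig_poly :: ('a \<Rightarrow> real) \<Rightarrow> bool)" "cball 0 K"
    by unfold_locales
       (auto intro: trig_poly_continuous trig_add trig_poly_mult trig_poly_const dest: trig_poly_separates)
  obtain p where p: "trig_poly p" and ph: "\<And>x. x \<in> cball 0 K \<Longrightarrow> \<bar>h x - p x\<bar> < e"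
    using Stone_Weierstrass_basic[OF continuous_on_subset[OF h] e] by auto
  obtain M where M: "\<And>x. \<bar>p x\<bar> \<le> M" using trig_poly_bounded[OF p] by blast
  \<comment> \<open>Truncation does not increase the distance to \<open>h\<close>, because \<open>h\<close> takes values in \<open>{-B..B}\<close>.\<close>
  define clip where "clip y = max (- B) (min B y)" for y :: real
  have cc: "continuous_on {-M..M} clip" unfolding clip_def by (intro continuous_intros)
  obtain q where q: "real_polynomial_function q" and qc: "\<And>y. y \<in> {-M..M} \<Longrightarrow> \<bar>clip y - q y\<bar> < e"
    using Stone_Weierstrass_real_polynomial_function[OF compact_Icc cc e] by blast
  have qp: "\<bar>clip (p x) - q (p x)\<bar> < e" for x
    using M[of x] by (intro qc) auto
  have B0: "0 \<le> B" using B[of 0] by linarith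
  show ?thesis
  proof
    show "trig_poly (\<lambda>x. q (p x))" by (rule trig_poly_compose_polynomial[OF q p])
    show "\<bar>h x - q (p x)\<bar> \<le> 2 * e" if "norm x \<le> K" for x
    proof -
      have "\<bar>h x - clip (p x)\<bar> \<le> \<bar>h x - p x\<bar>"
        using B[of x] by (auto simp: clip_def)
      then show ?thesis using ph[of x] qp[of x] that by auto
    qed
    show "\<bar>h x - q (p x)\<bar> \<le> 2 * B + e" for x
    proof -
      have "\<bar>clip (p x)\<bar> \<le> B" using B0 by (auto simp: clip_def)
      then show ?thesis using B[of x] qp[of x] by linarith
    qed
  qed
qed

lemma (in prob_space) expectation_close:
  fixes Y :: "'a \<Rightarrow> 'b::euclidean_space"
  assumes [measurable]: "random_variable borel Y"
    and g: "continuous_on UNIV g1" "continuous_on UNIV g2" "\<And>x. \<bar>g1 x\<bar> \<le> B1" "\<And>x. \<bar>g2 x\<bar> \<le> B2"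
    and near: "\<And>x. norm x \<le> K \<Longrightarrow> \<bar>g1 x - g2 x\<bar> \<le> a"
    and far: "\<And>x. \<bar>g1 x - g2 x\<bar> \<le> b" and a0: "0 \<le> a"
  shows "\<bar>expectation (\<lambda>\<omega>. g1 (Y \<omega>)) - expectation (\<lambda>\<omega>. g2 (Y \<omega>))\<bar>
     \<le> a + b * prob {\<omega> \<in> space M. norm (Y \<omega>) > K}"
proof -
  have [measurable]: "g1 \<in> borel_measurable borel" "g2 \<in> borel_measurable borel"
    using g(1,2) by (auto intro: borel_measurable_continuous_onI)
  let ?S = "{\<omega> \<in> space M. norm (Y \<omega>) > K}"
  have S[measurable]: "?S \<in> events" by measurable
  have i1: "integrable M (\<lambda>\<omega>. g1 (Y \<omega>))" by (rule integrable_const_bound[of _ B1]) (use g in auto)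
  have i2: "integrable M (\<lambda>\<omega>. g2 (Y \<omega>))" by (rule integrable_const_bound[of _ B2]) (use g in auto)
  have iS: "integrable M (\<lambda>\<omega>. a + b * indicator ?S \<omega>)"
    using S by (intro Bochner_Integration.integrable_add integrable_const integrable_mult_right)
      (auto simp: emeasure_eq_measure)
  have "\<bar>expectation (\<lambda>\<omega>. g1 (Y \<omega>)) - expectation (\<lambda>\<omega>. g2 (Y \<omega>))\<bar>
     = \<bar>expectation (\<lambda>\<omega>. g1 (Y \<omega>) - g2 (Y \<omega>))\<bar>"
    by (simp add: Bochner_Integration.integral_diff[OF i1 i2])
  also have "\<dots> \<le> expectation (\<lambda>\<omega>. \<bar>g1 (Y \<omega>) - g2 (Y \<omega>)\<bar>)"
    by (rule integral_abs_bound)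
  also have "\<dots> \<le> expectation (\<lambda>\<omega>. a + b * indicator ?S \<omega>)"
  proof (rule integral_mono)
    show "integrable M (\<lambda>\<omega>. \<bar>g1 (Y \<omega>) - g2 (Y \<omega>)\<bar>)"
      using i1 i2 by (intro integrable_abs Bochner_Integration.integrable_diff)
    show "\<bar>g1 (Y \<omega>) - g2 (Y \<omega>)\<bar> \<le> a + b * indicator ?S \<omega>" if "\<omega> \<in> space M" for \<omega>
      using near[of "Y \<omega>"] far[of "Y \<omega>"] a0 that by (auto simp: indicator_def not_less)
  qed (rule iS)
  also have "\<dots> = a + b * prob ?S"
    using S by (subst Bochner_Integration.integral_add) (auto simp: prob_space emeasure_eq_measure)
  finally show ?thesis .
qed

lemma prob_norm_tail:
  fixes \<nu> :: "'b::euclidean_space measure"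
  assumes "prob_space \<nu>" "sets \<nu> = sets borel" "e > 0"
  obtains K where "\<And>K'. K' \<ge> K \<Longrightarrow> measure \<nu> {x \<in> space \<nu>. norm x > K'} < e"
proof -
  interpret prob_space \<nu> by fact
  note [measurable_cong] = assms(2)
  have sp: "space \<nu> = UNIV" using sets_eq_imp_space_eq[OF assms(2)] by simp
  have m[measurable]: "{x \<in> space \<nu>. norm x > K'} \<in> sets \<nu>" for K' by measurable
  have "(\<lambda>n. measure \<nu> {x \<in> space \<nu>. norm x > real n}) \<longlonglongrightarrow> measure \<nu> (\<Inter>n. {x \<in> space \<nu>. norm x > real n})"
    by (rule finite_Lim_measure_decseq) (auto simp: decseq_def)
  moreover have "(\<Inter>n. {x \<in> space \<nu>. norm x > real n}) = {}"
  proof (rule equals0I)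
    fix x assume x: "x \<in> (\<Inter>n. {x \<in> space \<nu>. norm x > real n})"
    obtain n where "norm x \<le> real n" using real_arch_simple by blast
    with x show False by (auto simp: not_less dest: spec[of _ n])
  qed
  ultimately have "(\<lambda>n. measure \<nu> {x \<in> space \<nu>. norm x > real n}) \<longlonglongrightarrow> 0" by simp
  then obtain n where n: "measure \<nu> {x \<in> space \<nu>. norm x > real n} < e"
    using order_tendstoD(2)[OF _ \<open>e > 0\<close>] eventually_happens'[OF sequentially_bot] by blast
  show ?thesis
  proof
    fix K' assume "K' \<ge> real n"
    then have "measure \<nu> {x \<in> space \<nu>. norm x > K'} \<le> measure \<nu> {x \<in> space \<nu>. norm x > real n}"
      by (intro finite_measure_mono) auto
    with n show "measure \<nu> {x \<in> space \<nu>. norm x > K'} < e" by linarith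
  qed
qed

text \<open>A multivariate continuity theorem. Convergence extends from sines and cosines to trigonometric polynomials
  by linearity; tightness confines the argument to a ball on which a bounded continuous function is
  uniformly close to such a polynomial, while the global bound controls the tails.\<close>

theorem conv_in_distr_trig:
  fixes X :: "nat \<Rightarrow> 'a \<Rightarrow> real ^ 'l"
  assumes P: "\<And>n. prob_space (P n)" and X: "\<And>n. X n \<in> borel_measurable (P n)"
    and \<nu>: "prob_space \<nu>" "sets \<nu> = sets borel"
    and cos_conv: "\<And>t. (\<lambda>n. \<integral>\<omega>. cos (t \<bullet> X n \<omega>) \<partial>P n) \<longlonglongrightarrow> (\<integral>x. cos (t \<bullet> x) \<partial>\<nu>)"
    and sin_conv: "\<And>t. (\<lambda>n. \<integral>\<omega>. sin (t \<bullet> X n \<omega>) \<partial>P n) \<longlonglongrightarrow> (\<integral>x. sin (t \<bullet> x) \<partial>\<nu>)"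
    and tight: "\<And>e. e > 0 \<Longrightarrow> \<exists>K. \<forall>\<^sub>F n in sequentially. measure (P n) {\<omega> \<in> space (P n). norm (X n \<omega>) > K} < e"
  shows "conv_in_distr P X \<nu>"
  unfolding conv_in_distr_def
proof (intro allI impI, elim conjE)
  fix h :: "real ^ 'l \<Rightarrow> real"
  assume h: "continuous_on UNIV h" and hb: "bounded (range h)"
  obtain B where B: "\<And>x. \<bar>h x\<bar> \<le> B" using hb by (auto simp: bounded_iff)
  have B0: "0 \<le> B" using B[of 0] by linarith
  interpret N: prob_space \<nu> by (rule \<nu>)
  note \<nu>(2)[measurable_cong]
  have bint: "integrable M (\<lambda>\<omega>. g (Y \<omega>))"
    if "prob_space M" "Y \<in> borel_measurable M" "continuous_on UNIV g" "\<And>x. \<bar>g x\<bar> \<le> D"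
    for M :: "'c measure" and Y :: "'c \<Rightarrow> real ^ 'l" and g and D :: real
  proof -
    interpret prob_space M by fact
    have [measurable]: "g \<in> borel_measurable borel" "Y \<in> borel_measurable M"
      using that by (auto intro: borel_measurable_continuous_onI)
    show ?thesis by (rule integrable_const_bound[of _ D]) (use that in auto)
  qed
  have trig: "(\<lambda>n. \<integral>\<omega>. p (X n \<omega>) \<partial>P n) \<longlonglongrightarrow> (\<integral>x. p x \<partial>\<nu>)" if "trig_poly p" for p
    using that
  proof (induction rule: trig_poly.induct)
    case (trig_add p q)
    obtain M N where MN: "\<And>x. \<bar>p x\<bar> \<le> M" "\<And>x. \<bar>q x\<bar> \<le> N"
      using trig_add(1,2) trig_poly_bounded by meson
    have c: "continuous_on UNIV p" "continuous_on UNIV q" using trig_add trig_poly_continuous by auto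
    have "(\<integral>x. p x + q x \<partial>\<nu>) = (\<integral>x. p x \<partial>\<nu>) + (\<integral>x. q x \<partial>\<nu>)"
      by (intro Bochner_Integration.integral_add bint[OF \<nu>(1) _ c(1) MN(1)] bint[OF \<nu>(1) _ c(2) MN(2)]) auto
    moreover have "(\<integral>\<omega>. p (X n \<omega>) + q (X n \<omega>) \<partial>P n) = (\<integral>\<omega>. p (X n \<omega>) \<partial>P n) + (\<integral>\<omega>. q (X n \<omega>) \<partial>P n)" for n
      by (intro Bochner_Integration.integral_add bint[OF P X c(1) MN(1)] bint[OF P X c(2) MN(2)])
    ultimately show ?case using tendsto_add[OF trig_add.IH] by simp
  qed (auto intro!: tendsto_mult_left cos_conv sin_conv)
  show "(\<lambda>n. \<integral>\<omega>. h (X n \<omega>) \<partial>P n) \<longlonglongrightarrow> (\<integral>x. h x \<partial>\<nu>)"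
  proof (rule tendstoI)
    fix e :: real assume e: "e > 0"
    \<comment> \<open>The error is at most \<open>(3 + 2 * B) * d\<close> on either side plus \<open>d\<close> for the polynomial, in total less than
      \<open>(8 + 4 * B) * d\<close>.\<close>
    define d where "d = min 1 (e / (8 + 4 * B))"
    have d0: "d > 0" and d1: "d \<le> 1" using e B0 by (auto simp: d_def)
    have "d \<le> e / (8 + 4 * B)" by (simp add: d_def)
    then have de: "(8 + 4 * B) * d \<le> e" using B0 by (simp add: field_simps)
    obtain K1 where K1: "\<forall>\<^sub>F n in sequentially. measure (P n) {\<omega> \<in> space (P n). norm (X n \<omega>) > K1} < d"
      using tight[OF d0] by blast
    obtain K2 where K2: "\<And>K'. K' \<ge> K2 \<Longrightarrow> measure \<nu> {x \<in> space \<nu>. norm x > K'} < d"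
      using prob_norm_tail[OF \<nu> d0] by blast
    define K where "K = max K1 K2"
    obtain r where r: "trig_poly r" and rn: "\<And>x. norm x \<le> K \<Longrightarrow> \<bar>h x - r x\<bar> \<le> 2 * d"
      and rf: "\<And>x. \<bar>h x - r x\<bar> \<le> 2 * B + d"
      using trig_poly_clipped_approximation[OF h B d0, where K = K] by blast
    obtain M where M: "\<And>x. \<bar>r x\<bar> \<le> M" using trig_poly_bounded[OF r] by blast
    note rc = trig_poly_continuous[OF r, of UNIV]
    have dd: "2 * d + (2 * B + d) * q \<le> (3 + 2 * B) * d" if "q < d" "0 \<le> q" for q
    proof -
      have "(2 * B + d) * q \<le> (2 * B + 1) * d" using that B0 d0 d1 by (intro mult_mono) auto
      then show ?thesis by (simp add: algebra_simps)
    qed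
    have N: "\<bar>(\<integral>x. h x \<partial>\<nu>) - (\<integral>x. r x \<partial>\<nu>)\<bar> \<le> (3 + 2 * B) * d"
      by (rule order_trans[OF N.expectation_close[OF _ h rc B M rn rf] dd[OF K2]])
         (use d0 in \<open>auto simp: K_def\<close>)
    have "\<forall>\<^sub>F n in sequentially. dist (\<integral>\<omega>. r (X n \<omega>) \<partial>P n) (\<integral>x. r x \<partial>\<nu>) < d"
      using tendstoD[OF trig[OF r] d0] .
    then show "\<forall>\<^sub>F n in sequentially. dist (\<integral>\<omega>. h (X n \<omega>) \<partial>P n) (\<integral>x. h x \<partial>\<nu>) < e"
      using K1
    proof eventually_elim
      case (elim n)
      interpret Q: prob_space "P n" by (rule P)
      note X[of n, measurable]
      have "measure (P n) {\<omega> \<in> space (P n). norm (X n \<omega>) > K} \<le> measure (P n) {\<omega> \<in> space (P n). norm (X n \<omega>) > K1}"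
        by (intro Q.finite_measure_mono) (auto simp: K_def)
      then have "measure (P n) {\<omega> \<in> space (P n). norm (X n \<omega>) > K} < d" using elim by linarith
      then have "\<bar>(\<integral>\<omega>. h (X n \<omega>) \<partial>P n) - (\<integral>\<omega>. r (X n \<omega>) \<partial>P n)\<bar> \<le> (3 + 2 * B) * d"
        by (intro order_trans[OF Q.expectation_close[OF X h rc B M rn rf] dd]) (use d0 in auto)
      moreover have "(3 + 2 * B) * d + (3 + 2 * B) * d + d < e"
        using de d0 by (simp add: algebra_simps)
      ultimately show ?case using N elim(1) unfolding dist_real_def by arith
    qed
  qed
qed

section \<open>Gaussian measures with prescribed covariance\<close>

text \<open>Cholesky decomposition by rank-one reduction: subtracting \<open>(B x e)\<^sup>2 / B e e\<close> keeps the form positive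
  semidefinite by the Cauchy--Schwarz inequality, annihilates the basis vector \<open>e\<close>, and keeps every
  isotropic basis vector isotropic. So the number of non-isotropic basis vectors decreases.\<close>

lemma psd_form_sum_of_squares:
  fixes B :: "'a::euclidean_space \<Rightarrow> 'a \<Rightarrow> real"
  assumes "bilinear B" "\<And>x y. B x y = B y x" "\<And>x. 0 \<le> B x x"
  shows "\<exists>(N::nat) c. \<forall>x. B x x = (\<Sum>k<N. (c k \<bullet> x)\<^sup>2)"
  using assms
proof (induction "card {b \<in> Basis. B b b \<noteq> 0}" arbitrary: B rule: less_induct)
  case less
  note bil = less.prems(1) and sym = less.prems(2) and psd = less.prems(3)
  have lin: "linear (\<lambda>x. B x y)" "linear (\<lambda>y. B x y)" for x y
    using bil by (auto simp: bilinear_def)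
  have expand: "B (x + s *\<^sub>R y) (x + s *\<^sub>R y) = B x x + 2 * s * B x y + s\<^sup>2 * B y y" for x y s
    by (simp add: bilinear_ladd[OF bil] bilinear_radd[OF bil] bilinear_lmul[OF bil] bilinear_rmul[OF bil]
        sym[of y x] power2_eq_square algebra_simps)
  have isotropic: "B x y = 0" if "B y y = 0" for x y
  proof (rule ccontr)
    assume nz: "B x y \<noteq> 0"
    have "0 \<le> B (x + (- (B x x + 1) / (2 * B x y)) *\<^sub>R y) (x + (- (B x x + 1) / (2 * B x y)) *\<^sub>R y)"
      by (rule psd)
    also have "\<dots> = - 1" unfolding expand using nz that by (simp add: field_simps)
    finally show False by simp
  qed
  show ?case
  proof (cases "\<exists>e\<in>Basis. B e e \<noteq> 0")
    case False
    have "B x x = 0" for x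
    proof -
      have "B x x = B x (\<Sum>e\<in>Basis. (x \<bullet> e) *\<^sub>R e)" by (simp add: euclidean_representation)
      also have "\<dots> = (\<Sum>e\<in>Basis. (x \<bullet> e) *\<^sub>R B x e)"
        by (simp add: linear_sum[OF lin(2)] linear_cmul[OF lin(2)])
      also have "\<dots> = 0" using False isotropic by (intro sum.neutral) auto
      finally show ?thesis .
    qed
    then show ?thesis by (intro exI[of _ 0]) simp
  next
    case True
    then obtain e where e: "e \<in> Basis" "B e e \<noteq> 0" by blast
    then have pos: "B e e > 0" using psd[of e] by linarith
    define v where "v = (\<Sum>b\<in>Basis. B b e *\<^sub>R b)"
    have v: "v \<bullet> x = B x e" for x
    proof -
      have "B x e = B (\<Sum>b\<in>Basis. (x \<bullet> b) *\<^sub>R b) e" by (simp add: euclidean_representation)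
      also have "\<dots> = (\<Sum>b\<in>Basis. (x \<bullet> b) * B b e)"
        by (simp add: linear_sum[OF lin(1)] linear_cmul[OF lin(1)])
      finally show ?thesis by (simp add: v_def inner_sum_left inner_commute[of x] mult.commute)
    qed
    define B' where "B' x y = B x y - B x e * B y e / B e e" for x y
    have bil': "bilinear B'"
      unfolding bilinear_def B'_def
      by (auto intro!: linearI simp: linear_add[OF lin(1)] linear_add[OF lin(2)] linear_cmul[OF lin(1)]
          linear_cmul[OF lin(2)] add_divide_distrib algebra_simps)
    have sym': "B' x y = B' y x" for x y by (simp add: B'_def sym[of x y] mult.commute)
    have psd': "0 \<le> B' x x" for x
    proof -
      have "0 \<le> B (x + (- B x e / B e e) *\<^sub>R e) (x + (- B x e / B e e) *\<^sub>R e)" by (rule psd)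
      also have "\<dots> = B' x x"
        unfolding expand B'_def using pos by (simp add: field_simps power2_eq_square)
      finally show ?thesis .
    qed
    have "{b \<in> Basis. B' b b \<noteq> 0} \<subset> {b \<in> Basis. B b b \<noteq> 0}"
    proof
      show "{b \<in> Basis. B' b b \<noteq> 0} \<subseteq> {b \<in> Basis. B b b \<noteq> 0}"
      proof (intro subsetI CollectI conjI)
        fix b assume "b \<in> {b \<in> Basis. B' b b \<noteq> 0}"
        then have b: "b \<in> Basis" "B' b b \<noteq> 0" by auto
        show "b \<in> Basis" by fact
        show "B b b \<noteq> 0"
        proof
          assume "B b b = 0"
          then have "B b e = 0" using isotropic[of b e] sym[of e b] by simp
          with \<open>B b b = 0\<close> b show False by (simp add: B'_def)
        qed
      qed
      have "e \<in> {b \<in> Basis. B b b \<noteq> 0}" "e \<notin> {b \<in> Basis. B' b b \<noteq> 0}"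
        using e by (auto simp: B'_def)
      then show "{b \<in> Basis. B' b b \<noteq> 0} \<noteq> {b \<in> Basis. B b b \<noteq> 0}" by blast
    qed
    then have "card {b \<in> Basis. B' b b \<noteq> 0} < card {b \<in> Basis. B b b \<noteq> 0}"
      by (intro psubset_card_mono) auto
    from less.hyps[OF this bil' sym' psd'] obtain N :: nat and c where
      Nc: "\<And>x. B' x x = (\<Sum>k<N. (c k \<bullet> x)\<^sup>2)" by blast
    have "B x x = (\<Sum>k<Suc N. ((c(N := (1 / sqrt (B e e)) *\<^sub>R v)) k \<bullet> x)\<^sup>2)" for x
    proof -
      have "B x x = B' x x + (B x e)\<^sup>2 / B e e" by (simp add: B'_def power2_eq_square)
      also have "(B x e)\<^sup>2 / B e e = (((1 / sqrt (B e e)) *\<^sub>R v) \<bullet> x)\<^sup>2"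
        using pos by (simp add: v power_divide)
      finally show ?thesis by (simp add: Nc)
    qed
    then show ?thesis by blast
  qed
qed

text \<open>The law of \<open>\<Sum>k<N. \<omega> k *\<^sub>R c k\<close> for independent standard normal \<open>\<omega> k\<close>, where the squares of the \<open>c k\<close> sum to the
  covariance form.\<close>

lemma gaussian_measure_exists:
  fixes B :: "'a::euclidean_space \<Rightarrow> 'a \<Rightarrow> real"
  assumes "bilinear B" "\<And>x y. B x y = B y x" "\<And>x. 0 \<le> B x x"
  obtains \<nu> :: "'a measure" where "prob_space \<nu>" "sets \<nu> = sets borel"
    "\<And>t. (\<integral>x. cos (t \<bullet> x) \<partial>\<nu>) = exp (- B t t / 2)" "\<And>t. (\<integral>x. sin (t \<bullet> x) \<partial>\<nu>) = 0"
proof -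
  obtain N :: nat and c where Nc: "\<And>x. B x x = (\<Sum>k<N. (c k \<bullet> x)\<^sup>2)"
    using psd_form_sum_of_squares[OF assms] by blast
  interpret S: prob_space std_normal_distribution
    using real_dist_normal_dist by (rule real_distribution.axioms(1))
  interpret Pr: product_prob_space "\<lambda>_::nat. std_normal_distribution" "{..<N}" ..
  define M where "M = Pi\<^sub>M {..<N} (\<lambda>_. std_normal_distribution)"
  interpret M: prob_space M unfolding M_def by (rule Pr.prob_space_axioms)
  define Y where "Y \<omega> = (\<Sum>k<N. \<omega> k *\<^sub>R c k)" for \<omega> :: "nat \<Rightarrow> real"
  have comp: "(\<lambda>\<omega>. \<omega> k) \<in> borel_measurable M" if "k < N" for k
    using measurable_component_singleton[of k "{..<N}" "\<lambda>_. std_normal_distribution"] that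
    by (simp add: M_def cong: measurable_cong_sets)
  have Y[measurable]: "Y \<in> borel_measurable M"
    unfolding Y_def[abs_def] by (intro borel_measurable_sum borel_measurable_scaleR comp) auto
  define \<nu> where "\<nu> = distr M borel Y"
  have ch: "(CLINT \<omega>|M. iexp (t \<bullet> Y \<omega>)) = exp (- B t t / 2)" for t
  proof -
    have "(CLINT \<omega>|M. iexp (t \<bullet> Y \<omega>)) = (CLINT \<omega>|M. (\<Prod>k<N. iexp ((t \<bullet> c k) * \<omega> k)))"
      by (simp add: Y_def inner_sum_right sum_distrib_left mult.commute flip: exp_sum)
    also have "\<dots> = (\<Prod>k<N. char std_normal_distribution (t \<bullet> c k))"
      unfolding M_def char_def
    proof (rule Pr.product_integral_prod)
      fix k
      show "integrable std_normal_distribution (\<lambda>x. iexp (t \<bullet> c k * x))"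
        by (rule S.integrable_const_bound[of _ 1]) auto
    qed simp
    also have "\<dots> = complex_of_real (\<Prod>k<N. exp (- (t \<bullet> c k)\<^sup>2 / 2))"
      by (simp add: char_std_normal_distribution)
    also have "(\<Prod>k<N. exp (- (t \<bullet> c k)\<^sup>2 / 2)) = exp (- B t t / 2)"
      by (simp add: Nc inner_commute sum_negf sum_divide_distrib flip: exp_sum)
    finally show ?thesis .
  qed
  have int: "complex_integrable M (\<lambda>\<omega>. iexp (t \<bullet> Y \<omega>))" for t
    by (rule M.integrable_const_bound[of _ 1]) auto
  show ?thesis
  proof
    show "prob_space \<nu>" unfolding \<nu>_def by (rule M.prob_space_distr) measurable
    show "sets \<nu> = sets borel" by (simp add: \<nu>_def)
    show "(\<integral>x. cos (t \<bullet> x) \<partial>\<nu>) = exp (- B t t / 2)" for t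
    proof -
      have "(\<integral>x. cos (t \<bullet> x) \<partial>\<nu>) = (\<integral>\<omega>. Re (iexp (t \<bullet> Y \<omega>)) \<partial>M)"
        unfolding \<nu>_def by (subst integral_distr) (auto simp: Re_exp)
      also have "\<dots> = Re (CLINT \<omega>|M. iexp (t \<bullet> Y \<omega>))" by (rule integral_Re[OF int])
      finally show ?thesis unfolding ch by simp
    qed
    show "(\<integral>x. sin (t \<bullet> x) \<partial>\<nu>) = 0" for t
    proof -
      have "(\<integral>x. sin (t \<bullet> x) \<partial>\<nu>) = (\<integral>\<omega>. Im (iexp (t \<bullet> Y \<omega>)) \<partial>M)"
        unfolding \<nu>_def by (subst integral_distr) (auto simp: Im_exp)
      also have "\<dots> = Im (CLINT \<omega>|M. iexp (t \<bullet> Y \<omega>))" by (rule integral_Im[OF int])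
      finally show ?thesis unfolding ch by simp
    qed
  qed
qed

section \<open>The common limit of the two estimators\<close>

lemma log_partition_0: "log_partition f n 0 = ln (fact n)"
  by (simp add: log_partition_def card_perms)

lemma perm_model_0: "perm_model f n 0 = point_measure (perms n) (\<lambda>\<pi>. ennreal (1 / fact n))"
  by (simp add: perm_model_def log_partition_0 exp_minus inverse_eq_divide)

lemma integral_perm_model_0:
  fixes h :: "(nat \<Rightarrow> nat) \<Rightarrow> real"
  shows "(\<integral>\<pi>. h \<pi> \<partial>perm_model f n 0) = perm_avg n h"
  unfolding perm_model_0
  by (subst lebesgue_integral_point_measure_finite) (simp_all add: perm_avg_def sum_distrib_left divide_inverse)

lemma space_perm_model_0: "space (perm_model f n 0) = perms n"
  by (simp add: perm_model_0 space_point_measure)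

lemma measurable_perm_model_0: "X \<in> perm_model f n 0 \<rightarrow>\<^sub>M borel"
  by (simp add: perm_model_0)

lemma prob_space_perm_model_0: "prob_space (perm_model f n 0)"
proof (rule prob_spaceI)
  have "emeasure (perm_model f n 0) (perms n) = (\<Sum>\<pi>\<in>perms n. ennreal (1 / fact n))"
    unfolding perm_model_0 by (rule emeasure_point_measure_finite) auto
  also have "\<dots> = ennreal (\<Sum>\<pi>\<in>perms n. 1 / fact n)" by (rule sum_ennreal) simp
  also have "\<dots> = 1" by (simp add: card_perms)
  finally show "emeasure (perm_model f n 0) (space (perm_model f n 0)) = 1"
    by (simp add: space_perm_model_0)
qed

lemma measure_perm_model_0:
  "measure (perm_model f n 0) {\<pi> \<in> space (perm_model f n 0). Q \<pi>} = perm_avg n (\<lambda>\<pi>. if Q \<pi> then 1 else 0)"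
proof -
  let ?S = "{\<pi> \<in> space (perm_model f n 0). Q \<pi>}"
  have "?S \<in> sets (perm_model f n 0)"
    by (auto simp: perm_model_0 sets_point_measure space_point_measure)
  then have "measure (perm_model f n 0) ?S = (\<integral>\<pi>. indicator ?S \<pi> \<partial>perm_model f n 0)" by simp
  also have "\<dots> = perm_avg n (indicator ?S)" by (rule integral_perm_model_0)
  also have "\<dots> = perm_avg n (\<lambda>\<pi>. if Q \<pi> then 1 else 0)"
    by (rule perm_avg_cong) (simp add: space_perm_model_0 indicator_def)
  finally show ?thesis .
qed

lemma abs_cos_diff_le: "\<bar>cos x - cos y\<bar> \<le> \<bar>x - y\<bar>" for x y :: real
  using field_differentiable_bound[of UNIV cos "\<lambda>x. - sin x" 1 x y]
  by (auto intro!: derivative_eq_intros)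

lemma abs_sin_diff_le: "\<bar>sin x - sin y\<bar> \<le> \<bar>x - y\<bar>" for x y :: real
  using field_differentiable_bound[of UNIV sin cos 1 x y]
  by (auto intro!: derivative_eq_intros)

context permuton_family
begin

abbreviation Gamma_inv :: "real ^ 'l ^ 'l" where
  "Gamma_inv \<equiv> matrix_inv (Gamma_mat f)"

abbreviation limit_stat :: "nat \<Rightarrow> (nat \<Rightarrow> nat) \<Rightarrow> real ^ 'l" where
  "limit_stat n \<pi> \<equiv> Gamma_inv *v fluct f n \<pi>"

abbreviation near :: "(nat \<Rightarrow> (nat \<Rightarrow> nat) \<Rightarrow> real ^ 'l) \<Rightarrow> real \<Rightarrow> nat \<Rightarrow> (nat \<Rightarrow> nat) \<Rightarrow> bool" where
  "near est r n \<pi> \<equiv> norm (sqrt (real n) *\<^sub>R est n \<pi> - limit_stat n \<pi>) < r"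

lemma Gamma_inv_cancel: "Gamma_mat f *v (Gamma_inv *v x) = x"
  by (simp add: matrix_vector_mul_assoc matrix_inv_mult[OF invertible_Gamma])

lemma Gamma_inv_symmetric: "x \<bullet> (Gamma_inv *v y) = y \<bullet> (Gamma_inv *v x)"
  using Gamma_symmetric[of "Gamma_inv *v x" "Gamma_inv *v y"]
  unfolding Gamma_inv_cancel by (simp add: inner_commute)

lemma Gamma_inv_nonneg: "0 \<le> x \<bullet> (Gamma_inv *v x)"
proof -
  have "0 \<le> (Gamma_inv *v x) \<bullet> (Gamma_mat f *v (Gamma_inv *v x))"
    using Gamma_pos[of "Gamma_inv *v x"] by (cases "Gamma_inv *v x = 0") auto
  then show ?thesis unfolding Gamma_inv_cancel by (simp add: inner_commute)
qed

text \<open>Coercivity of \<open>\<Gamma>\<close> applied to \<open>Gamma_inv *v x\<close> itself.\<close>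

lemma Gamma_inv_norm:
  assumes c: "c > 0" "\<And>d. c * (norm d)\<^sup>2 \<le> d \<bullet> (Gamma_mat f *v d)"
  shows "norm (Gamma_inv *v x) \<le> norm x / c"
proof (cases "Gamma_inv *v x = 0")
  case False
  let ?h = "Gamma_inv *v x"
  have "c * (norm ?h)\<^sup>2 \<le> ?h \<bullet> x" using c(2)[of ?h] by (simp add: Gamma_inv_cancel)
  also have "\<dots> \<le> norm ?h * norm x" by (rule norm_cauchy_schwarz)
  finally have "norm ?h * (c * norm ?h) \<le> norm ?h * norm x" by (simp add: power2_eq_square mult_ac)
  then have "c * norm ?h \<le> norm x" using False by simp
  then show ?thesis using c(1) by (simp add: field_simps)
qed (use c in simp)

lemma swap_stat_bound:
  obtains Y where "\<And>n \<pi> i j. \<pi> \<in> perms n \<Longrightarrow> i \<in> {1..n} \<Longrightarrow> j \<in> {1..n} \<Longrightarrow> norm (swap_stat f n \<pi> i j) \<le> Y"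
proof -
  obtain B where B: "B \<ge> 0 \<and> (\<forall>n>0. \<forall>i\<in>{1..n}. \<forall>j\<in>{1..n}. norm (grid f n i j) \<le> B \<and> norm (cgrid f n i j) \<le> 4 * B)"
    using grid_bound by blast
  have "norm (swap_stat f n \<pi> i j) \<le> 4 * B" if \<pi>: "\<pi> \<in> perms n" and ij: "i \<in> {1..n}" "j \<in> {1..n}" for n \<pi> i j
  proof -
    have n: "n > 0" using ij by auto
    have g: "norm (grid f n a (\<pi> b)) \<le> B" if "a \<in> {1..n}" "b \<in> {1..n}" for a b
      using B n that perms_range[OF \<pi>] by blast
    have eq: "swap_stat f n \<pi> i j = grid f n i (\<pi> i) + grid f n j (\<pi> j) - grid f n i (\<pi> j) - grid f n j (\<pi> i)"
      by (simp add: swap_stat_def grid_def)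
    show ?thesis unfolding eq
      using g[of i i] g[of j j] g[of i j] g[of j i] ij
        norm_triangle_ineq4[of "grid f n i (\<pi> i) + grid f n j (\<pi> j) - grid f n i (\<pi> j)" "grid f n j (\<pi> i)"]
        norm_triangle_ineq4[of "grid f n i (\<pi> i) + grid f n j (\<pi> j)" "grid f n i (\<pi> j)"]
        norm_triangle_ineq[of "grid f n i (\<pi> i)" "grid f n j (\<pi> j)"] by linarith
  qed
  then show ?thesis by (rule that)
qed

text \<open>Chebyshev's inequality.\<close>

lemma fluct_tail:
  assumes e: "e > 0"
  obtains R where "R > 0" "\<And>n. n \<ge> 4 \<Longrightarrow> perm_avg n (\<lambda>\<pi>. if norm (fluct f n \<pi>) \<le> R then 0 else (1::real)) \<le> e"
proof -
  obtain D where D: "\<And>n. n \<ge> 4 \<Longrightarrow> perm_avg n (\<lambda>\<pi>. (norm (fluct f n \<pi>))\<^sup>2) \<le> D"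
    using fluct_second_moment by blast
  define R where "R = sqrt ((\<bar>D\<bar> + 1) / e)"
  have R: "R > 0" "R\<^sup>2 = (\<bar>D\<bar> + 1) / e" using e by (auto simp: R_def)
  have "perm_avg n (\<lambda>\<pi>. if norm (fluct f n \<pi>) \<le> R then 0 else (1::real)) \<le> e" if n: "n \<ge> 4" for n
  proof -
    have "perm_avg n (\<lambda>\<pi>. if norm (fluct f n \<pi>) \<le> R then 0 else (1::real))
       \<le> perm_avg n (\<lambda>\<pi>. (1 / R\<^sup>2) * (norm (fluct f n \<pi>))\<^sup>2)"
    proof (rule perm_avg_mono)
      fix \<pi>
      have "1 \<le> (1 / R\<^sup>2) * (norm (fluct f n \<pi>))\<^sup>2" if "\<not> norm (fluct f n \<pi>) \<le> R"
        using that R(1) power_mono[of R "norm (fluct f n \<pi>)" 2] by (simp add: field_simps)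
      then show "(if norm (fluct f n \<pi>) \<le> R then 0 else (1::real)) \<le> (1 / R\<^sup>2) * (norm (fluct f n \<pi>))\<^sup>2"
        by auto
    qed
    also have "\<dots> \<le> (1 / R\<^sup>2) * D"
      unfolding perm_avg_cmult by (intro mult_left_mono D n) simp
    also have "\<dots> \<le> e" 
      unfolding R(2) using e mult_left_mono[of D "\<bar>D\<bar> + 1" e] by (simp add: field_simps)
    finally show ?thesis .
  qed
  with R(1) show ?thesis by (rule that)
qed

text \<open>A root that is unique must be the value of the estimator.\<close>

lemma root_estimator_near:
  assumes est: "root_estimator Rt est" and \<pi>: "\<pi> \<in> perms n" and n: "n > 0"
    and uniq: "\<And>\<theta>1 \<theta>2. Rt n \<pi> \<theta>1 \<Longrightarrow> Rt n \<pi> \<theta>2 \<Longrightarrow> \<theta>1 = \<theta>2"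
    and h: "h \<in> ball h0 r" "Rt n \<pi> (h /\<^sub>R sqrt (real n))"
  shows "norm (sqrt (real n) *\<^sub>R est n \<pi> - h0) < r"
proof -
  have "\<exists>!\<theta>. Rt n \<pi> \<theta>" using h(2) uniq by blast
  then have "Rt n \<pi> (est n \<pi>)" using est \<pi> unfolding root_estimator_def by blast
  then have "est n \<pi> = h /\<^sub>R sqrt (real n)" using h(2) by (rule uniq)
  then have "sqrt (real n) *\<^sub>R est n \<pi> = h" using n by simp
  then show ?thesis using h(1) by (simp add: dist_norm norm_minus_commute)
qed

text \<open>On the event that \<open>fluct\<close> is bounded and the energy matrix is close to \<open>\<Gamma>\<close>, both local potentials are within \<open>\<epsilon>\<close> of the
  common quadratic near its minimum, which yields roots within distance \<open>r\<close>. On the same event the energy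
  form is positive definite, which makes these roots unique.\<close>

lemma estimators_localised:
  assumes ml_est: "root_estimator (is_root_ML f) est_ML" and pl_est: "root_estimator (is_root_PL f) est_PL"
    and r: "r > 0" and R: "R \<ge> 0"
  shows "\<exists>\<eta>>0. \<forall>\<^sub>F n in sequentially. \<forall>\<pi>\<in>perms n. norm (fluct f n \<pi>) \<le> R \<longrightarrow>
    mat_l1 (energy_mat f n \<pi> - Gamma_mat f) \<le> \<eta> \<longrightarrow>
    near est_ML r n \<pi> \<and> near est_PL r n \<pi>"
proof -
  obtain c where c: "c > 0" "\<And>d. c * (norm d)\<^sup>2 \<le> d \<bullet> (Gamma_mat f *v d)"
    using Gamma_lower_bound by blast
  obtain Y where Y: "\<And>n \<pi> i j. \<pi> \<in> perms n \<Longrightarrow> i \<in> {1..n} \<Longrightarrow> j \<in> {1..n} \<Longrightarrow> norm (swap_stat f n \<pi> i j) \<le> Y"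
    using swap_stat_bound by blast
  define K where "K = R / c + r"
  \<comment> \<open>The minimum of the quadratic lies within \<open>R / c\<close> of the origin, so \<open>K\<close> bounds the ball of radius \<open>r\<close> around it;
    \<open>\<epsilon>\<close> satisfies the depth condition \<open>4 * \<epsilon> < c * r\<^sup>2\<close>; the first bound on \<open>\<eta>\<close> keeps the energy form positive
    definite, and the second one makes its deviation at most \<open>\<epsilon>\<close> on that ball.\<close>
  define \<epsilon> where "\<epsilon> = c * r\<^sup>2 / 8"
  define \<eta> where "\<eta> = min (c / 2) (\<epsilon> / (K\<^sup>2 + 1))"
  have K: "K \<ge> 0" using R c r by (simp add: K_def)
  have \<epsilon>: "\<epsilon> > 0" "4 * \<epsilon> < c * r\<^sup>2" using c r by (auto simp: \<epsilon>_def)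
  have K1: "K\<^sup>2 + 1 > 0" by (rule add_nonneg_pos) auto
  have \<eta>: "\<eta> > 0" using c \<epsilon> K1 by (simp add: \<eta>_def)
  have \<eta>c: "\<eta> \<le> c / 2" unfolding \<eta>_def by (rule min.cobounded1)
  have "\<eta> \<le> \<epsilon> / (K\<^sup>2 + 1)" by (simp add: \<eta>_def)
  then have "(K\<^sup>2 + 1) * \<eta> \<le> \<epsilon>" using K1 by (simp add: field_simps)
  then have \<eta>K: "K\<^sup>2 * \<eta> \<le> \<epsilon>" using \<eta> by (simp add: distrib_right)
  have "(\<lambda>n. ((K * Y) ^ 4 / 4) * (1 / real n)) \<longlonglongrightarrow> ((K * Y) ^ 4 / 4) * 0"
    by (intro tendsto_mult_left lim_1_over_n)
  then have "\<forall>\<^sub>F n in sequentially. ((K * Y) ^ 4 / 4) * (1 / real n) < \<epsilon> / 2"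
    using \<epsilon> by (intro order_tendstoD(2)[where y = 0]) auto
  moreover note log_mgf_limit[OF K \<epsilon>(1)]
  ultimately have "\<forall>\<^sub>F n in sequentially. \<forall>\<pi>\<in>perms n. norm (fluct f n \<pi>) \<le> R \<longrightarrow>
    mat_l1 (energy_mat f n \<pi> - Gamma_mat f) \<le> \<eta> \<longrightarrow>
    near est_ML r n \<pi> \<and> near est_PL r n \<pi>"
    using eventually_gt_at_top[of 0]
  proof eventually_elim
    case (elim n)
    note n = elim(3)
    have n0: "real n > 0" using n by simp
    show ?case
    proof (intro ballI impI)
      fix \<pi> assume \<pi>: "\<pi> \<in> perms n" and fl: "norm (fluct f n \<pi>) \<le> R"
        and en: "mat_l1 (energy_mat f n \<pi> - Gamma_mat f) \<le> \<eta>"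
      let ?W = "fluct f n \<pi>" and ?h0 = "limit_stat n \<pi>"
      have "norm ?h0 \<le> norm ?W / c" by (rule Gamma_inv_norm[OF c])
      also have "\<dots> \<le> R / c" using fl c by (intro divide_right_mono) auto
      finally have h0: "norm ?h0 \<le> R / c" .
      have hK: "norm h \<le> K" if "h \<in> cball ?h0 r" for h
      proof -
        have "norm (h - ?h0) \<le> r" using that by (simp add: dist_norm norm_minus_commute)
        then show ?thesis using h0 norm_triangle_sub[of h ?h0] by (simp add: K_def)
      qed
      have diff: "\<bar>d \<bullet> (energy_mat f n \<pi> *v d) - d \<bullet> (Gamma_mat f *v d)\<bar> \<le> (norm d)\<^sup>2 * \<eta>" for d
      proof -
        have "\<bar>d \<bullet> (energy_mat f n \<pi> *v d) - d \<bullet> (Gamma_mat f *v d)\<bar> = \<bar>d \<bullet> ((energy_mat f n \<pi> - Gamma_mat f) *v d)\<bar>"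
          by (simp add: matrix_vector_mult_diff_rdistrib inner_diff_right)
        also have "\<dots> \<le> norm d * norm d * mat_l1 (energy_mat f n \<pi> - Gamma_mat f)" by (rule bilinear_form_bound)
        also have "\<dots> \<le> norm d * norm d * \<eta>" using en by (intro mult_left_mono) auto
        finally show ?thesis by (simp add: power2_eq_square)
      qed
      have nondeg: "0 < d \<bullet> (energy_mat f n \<pi> *v d)" if "d \<noteq> 0" for d
      proof -
        have "(norm d)\<^sup>2 * \<eta> \<le> (norm d)\<^sup>2 * (c / 2)" using \<eta>c by (intro mult_left_mono) auto
        moreover have "0 < (norm d)\<^sup>2 * (c / 2)" using that c by simp
        ultimately show ?thesis using diff[of d] c(2)[of d] unfolding abs_le_iff by (simp add: mult.commute)
      qed
      have "\<exists>h\<in>ball ?h0 r. (gibbs_mean f n (h /\<^sub>R sqrt (real n)) - suff_stat f n \<pi>) /\<^sub>R sqrt (real n) = 0"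
      proof (rule interior_critical_point[OF ml_local_deriv Gamma_symmetric c(2) Gamma_inv_cancel r \<epsilon>(2)])
        fix h assume h: "h \<in> cball ?h0 r"
        show "\<bar>ml_local f n \<pi> h - (h \<bullet> (Gamma_mat f *v h) / 2 - h \<bullet> ?W)\<bar> \<le> \<epsilon>"
          unfolding ml_local_eq[OF \<pi> n] using elim(2) hK[OF h] by simp
      qed
      then obtain h1 where h1: "h1 \<in> ball ?h0 r" "is_root_ML f n \<pi> (h1 /\<^sub>R sqrt (real n))"
        using n0 by (auto simp: is_root_ML_iff)
      have ml: "near est_ML r n \<pi>"
        by (rule root_estimator_near[where Rt = "is_root_ML f", OF ml_est \<pi> n _ h1]) (rule ml_root_unique[OF \<pi> nondeg])
      have "\<exists>h\<in>ball ?h0 r. - (2 / (real n * sqrt (real n))) *\<^sub>R pl_score f n \<pi> (h /\<^sub>R sqrt (real n)) = 0"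
      proof (rule interior_critical_point[OF pl_local_deriv Gamma_symmetric c(2) Gamma_inv_cancel r \<epsilon>(2)])
        fix h assume h: "h \<in> cball ?h0 r"
        have "\<bar>pl_local f n \<pi> h - (h \<bullet> (energy_mat f n \<pi> *v h) / 2 - h \<bullet> ?W)\<bar> \<le> (K * Y) ^ 4 / (4 * real n)"
          by (rule pl_local_expansion[OF \<pi> n Y[OF \<pi>] hK[OF h]])
        also have "\<dots> \<le> \<epsilon> / 2" using elim(1) by simp
        finally have 1: "\<bar>pl_local f n \<pi> h - (h \<bullet> (energy_mat f n \<pi> *v h) / 2 - h \<bullet> ?W)\<bar> \<le> \<epsilon> / 2" .
        have "(norm h)\<^sup>2 * \<eta> \<le> K\<^sup>2 * \<eta>" using hK[OF h] \<eta> by (intro mult_right_mono power_mono) auto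
        then have "\<bar>h \<bullet> (energy_mat f n \<pi> *v h) - h \<bullet> (Gamma_mat f *v h)\<bar> \<le> \<epsilon>"
          using diff[of h] \<eta>K by linarith
        then show "\<bar>pl_local f n \<pi> h - (h \<bullet> (Gamma_mat f *v h) / 2 - h \<bullet> ?W)\<bar> \<le> \<epsilon>"
          using 1 unfolding abs_le_iff by argo
      qed
      then obtain h2 where h2: "h2 \<in> ball ?h0 r" "is_root_PL f n \<pi> (h2 /\<^sub>R sqrt (real n))"
        using n0 by (auto simp: is_root_PL_iff)
      have pl: "near est_PL r n \<pi>"
        by (rule root_estimator_near[where Rt = "is_root_PL f", OF pl_est \<pi> n _ h2]) (rule pl_root_unique[OF nondeg])
      show "near est_ML r n \<pi> \<and> near est_PL r n \<pi>"
        using ml pl by blast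
    qed
  qed
  then show ?thesis using \<eta> by blast
qed

text \<open>The event of the preceding lemma has probability close to \<open>1\<close>, by the second moment of \<open>fluct\<close> and the convergence
  in mean of the energy matrix.\<close>

lemma estimators_linearised:
  assumes ml_est: "root_estimator (is_root_ML f) est_ML" and pl_est: "root_estimator (is_root_PL f) est_PL"
    and r: "r > 0"
  shows "(\<lambda>n. perm_avg n (\<lambda>\<pi>. if near est_ML r n \<pi> \<and> near est_PL r n \<pi> then 0 else (1::real))) \<longlonglongrightarrow> 0"
proof (rule tendstoI)
  fix e :: real assume e: "e > 0"
  obtain R where R0: "R > 0"
    and tail: "\<And>n. n \<ge> 4 \<Longrightarrow> perm_avg n (\<lambda>\<pi>. if norm (fluct f n \<pi>) \<le> R then 0 else (1::real)) \<le> e / 4"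
    using fluct_tail[of "e / 4"] e by auto
  obtain \<eta> where \<eta>: "\<eta> > 0" and ev: "\<forall>\<^sub>F n in sequentially. \<forall>\<pi>\<in>perms n. norm (fluct f n \<pi>) \<le> R \<longrightarrow>
    mat_l1 (energy_mat f n \<pi> - Gamma_mat f) \<le> \<eta> \<longrightarrow>
    near est_ML r n \<pi> \<and> near est_PL r n \<pi>"
    using estimators_localised[OF ml_est pl_est r less_imp_le[OF R0]] by blast
  have "\<forall>\<^sub>F n in sequentially. perm_avg n (\<lambda>\<pi>. mat_l1 (energy_mat f n \<pi> - Gamma_mat f)) < \<eta> * (e / 2)"
    using \<eta> e by (intro order_tendstoD(2)[OF energy_mat_tendsto]) auto
  with ev show "\<forall>\<^sub>F n in sequentially. dist (perm_avg n (\<lambda>\<pi>. if near est_ML r n \<pi> \<and> near est_PL r n \<pi> then 0 else (1::real))) 0 < e"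
    using eventually_ge_at_top[of 4]
  proof eventually_elim
    case (elim n)
    let ?bad = "\<lambda>\<pi>. if near est_ML r n \<pi> \<and> near est_PL r n \<pi> then 0 else (1::real)"
    let ?l = "\<lambda>\<pi>. mat_l1 (energy_mat f n \<pi> - Gamma_mat f)"
    let ?far = "\<lambda>\<pi>. if norm (fluct f n \<pi>) \<le> R then 0 else (1::real)"
    have "perm_avg n ?bad \<le> perm_avg n (\<lambda>\<pi>. ?far \<pi> + (1 / \<eta>) * ?l \<pi>)"
    proof (rule perm_avg_mono)
      fix \<pi> assume \<pi>: "\<pi> \<in> perms n"
      have l0: "0 \<le> (1 / \<eta>) * ?l \<pi>" using \<eta> by (auto intro!: divide_nonneg_pos mat_l1_nonneg)
      have l1: "1 \<le> (1 / \<eta>) * ?l \<pi>" if "\<not> ?l \<pi> \<le> \<eta>" using that \<eta> by (simp add: field_simps)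
      have "?bad \<pi> = 0" if "norm (fluct f n \<pi>) \<le> R" "?l \<pi> \<le> \<eta>" using elim(1) \<pi> that by simp
      moreover have "?bad \<pi> \<le> 1" by simp
      ultimately show "?bad \<pi> \<le> ?far \<pi> + (1 / \<eta>) * ?l \<pi>" using l0 l1 by (cases "?l \<pi> \<le> \<eta>") (auto split: if_splits)
    qed
    also have "\<dots> \<le> e / 4 + (1 / \<eta>) * (\<eta> * (e / 2))"
      unfolding perm_avg_add perm_avg_cmult using tail[OF elim(3)] elim(2) \<eta>
      by (intro add_mono mult_left_mono) auto
    also have "\<dots> = e / 4 + e / 2" using \<eta> by simp
    also have "\<dots> < e" using e by simp
    finally have "perm_avg n ?bad < e" .
    moreover have "0 \<le> perm_avg n ?bad" by (rule perm_avg_nonneg) simp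
    ultimately show ?case by (simp add: dist_real_def)
  qed
qed

lemma limit_stat_trig:
  "(\<lambda>n. perm_avg n (\<lambda>\<pi>. cos (t \<bullet> limit_stat n \<pi>))) \<longlonglongrightarrow> exp (- (t \<bullet> (Gamma_inv *v t)) / 2)"
  "(\<lambda>n. perm_avg n (\<lambda>\<pi>. sin (t \<bullet> limit_stat n \<pi>))) \<longlonglongrightarrow> 0"
proof -
  let ?s = "Gamma_inv *v t"
  have eq: "t \<bullet> limit_stat n \<pi> = ?s \<bullet> fluct f n \<pi>" for n \<pi>
    by (simp add: Gamma_inv_symmetric[of t] inner_commute)
  have var: "?s \<bullet> (Gamma_mat f *v ?s) = t \<bullet> (Gamma_inv *v t)"
    unfolding Gamma_inv_cancel by (rule inner_commute)
  have lim: "(\<lambda>n. perm_avg n (\<lambda>\<pi>. exp (\<i> * complex_of_real (t \<bullet> limit_stat n \<pi>))))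
     \<longlonglongrightarrow> complex_of_real (exp (- (t \<bullet> (Gamma_inv *v t)) / 2))"
    using char_limit[of ?s] unfolding eq var .
  have re: "Re (perm_avg n F) = perm_avg n (\<lambda>\<pi>. Re (F \<pi>))" "Im (perm_avg n F) = perm_avg n (\<lambda>\<pi>. Im (F \<pi>))" for n F
    by (simp_all add: perm_avg_def)
  show "(\<lambda>n. perm_avg n (\<lambda>\<pi>. cos (t \<bullet> limit_stat n \<pi>))) \<longlonglongrightarrow> exp (- (t \<bullet> (Gamma_inv *v t)) / 2)"
    using tendsto_Re[OF lim] by (simp add: re Re_exp)
  show "(\<lambda>n. perm_avg n (\<lambda>\<pi>. sin (t \<bullet> limit_stat n \<pi>))) \<longlonglongrightarrow> 0"
    using tendsto_Im[OF lim] by (simp add: re Im_exp)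
qed

text \<open>Slutsky's theorem in terms of trigonometric test functions, which are bounded and Lipschitz: a statistic
  close in probability to \<open>limit_stat\<close> has the same limiting characteristic function and is also tight.\<close>

lemma conv_in_distr_of_linearised:
  fixes X :: "nat \<Rightarrow> (nat \<Rightarrow> nat) \<Rightarrow> real ^ 'l"
  assumes lin: "\<And>r. r > 0 \<Longrightarrow> (\<lambda>n. perm_avg n (\<lambda>\<pi>. if norm (X n \<pi> - limit_stat n \<pi>) < r then 0 else (1::real))) \<longlonglongrightarrow> 0"
    and \<nu>: "prob_space \<nu>" "sets \<nu> = sets borel"
    and cos\<nu>: "\<And>t. (\<integral>x. cos (t \<bullet> x) \<partial>\<nu>) = exp (- (t \<bullet> (Gamma_inv *v t)) / 2)"
    and sin\<nu>: "\<And>t. (\<integral>x. sin (t \<bullet> x) \<partial>\<nu>) = 0"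
  shows "conv_in_distr (\<lambda>n. perm_model f n 0) X \<nu>"
proof (rule conv_in_distr_trig[OF prob_space_perm_model_0 measurable_perm_model_0 \<nu>])
  have trig: "(\<lambda>n. perm_avg n (\<lambda>\<pi>. g (t \<bullet> X n \<pi>))) \<longlonglongrightarrow> L"
    if g: "\<And>x y. \<bar>g x - g y\<bar> \<le> \<bar>x - y\<bar>" "\<And>x. \<bar>g x\<bar> \<le> 1"
      and L: "(\<lambda>n. perm_avg n (\<lambda>\<pi>. g (t \<bullet> limit_stat n \<pi>))) \<longlonglongrightarrow> L" for g :: "real \<Rightarrow> real" and t and L :: real
  proof -
    have "(\<lambda>n. perm_avg n (\<lambda>\<pi>. g (t \<bullet> X n \<pi>)) - perm_avg n (\<lambda>\<pi>. g (t \<bullet> limit_stat n \<pi>))) \<longlonglongrightarrow> 0"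
    proof (rule tendstoI)
      fix e :: real assume e: "e > 0"
      have t1: "norm t + 1 > 0" by (rule add_nonneg_pos) auto
      define r where "r = (e / 2) / (norm t + 1)"
      have r: "r > 0" using e t1 by (simp add: r_def)
      have tr: "norm t * r \<le> e / 2"
      proof -
        have "norm t * r \<le> (norm t + 1) * r" using r by (intro mult_right_mono) auto
        also have "\<dots> = e / 2" using t1 unfolding r_def by (subst times_divide_eq_right, subst nonzero_mult_div_cancel_left) auto
        finally show ?thesis .
      qed
      let ?bad = "\<lambda>n \<pi>. if norm (X n \<pi> - limit_stat n \<pi>) < r then 0 else (1::real)"
      have "\<forall>\<^sub>F n in sequentially. perm_avg n (?bad n) < e / 4"
        using e by (intro order_tendstoD(2)[OF lin[OF r]]) auto
      then show "\<forall>\<^sub>F n in sequentially. dist (perm_avg n (\<lambda>\<pi>. g (t \<bullet> X n \<pi>)) - perm_avg n (\<lambda>\<pi>. g (t \<bullet> limit_stat n \<pi>))) 0 < e"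
      proof eventually_elim
        case (elim n)
        have "\<bar>perm_avg n (\<lambda>\<pi>. g (t \<bullet> X n \<pi>)) - perm_avg n (\<lambda>\<pi>. g (t \<bullet> limit_stat n \<pi>))\<bar>
          \<le> perm_avg n (\<lambda>\<pi>. \<bar>g (t \<bullet> X n \<pi>) - g (t \<bullet> limit_stat n \<pi>)\<bar>)"
          unfolding perm_avg_diff[symmetric]
          using perm_avg_norm_le[of n "\<lambda>\<pi>. g (t \<bullet> X n \<pi>) - g (t \<bullet> limit_stat n \<pi>)"] by simp
        also have "\<dots> \<le> perm_avg n (\<lambda>\<pi>. norm t * r + 2 * ?bad n \<pi>)"
        proof (rule perm_avg_mono)
          fix \<pi>
          show "\<bar>g (t \<bullet> X n \<pi>) - g (t \<bullet> limit_stat n \<pi>)\<bar> \<le> norm t * r + 2 * ?bad n \<pi>"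
          proof (cases "norm (X n \<pi> - limit_stat n \<pi>) < r")
            case True
            have "\<bar>g (t \<bullet> X n \<pi>) - g (t \<bullet> limit_stat n \<pi>)\<bar> \<le> \<bar>t \<bullet> (X n \<pi> - limit_stat n \<pi>)\<bar>"
              using g(1)[of "t \<bullet> X n \<pi>" "t \<bullet> limit_stat n \<pi>"] by (simp add: inner_diff_right)
            also have "\<dots> \<le> norm t * norm (X n \<pi> - limit_stat n \<pi>)" by (rule Cauchy_Schwarz_ineq2)
            also have "\<dots> \<le> norm t * r" using True by (intro mult_left_mono) auto
            finally show ?thesis using True by simp
          next
            case False
            have "0 \<le> norm t * r" using r by simp
            then show ?thesis using False g(2)[of "t \<bullet> X n \<pi>"] g(2)[of "t \<bullet> limit_stat n \<pi>"] by simp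
          qed
        qed
        also have "\<dots> = norm t * r + 2 * perm_avg n (?bad n)"
          unfolding perm_avg_add perm_avg_cmult perm_avg_const ..
        also have "\<dots> < e" using tr elim by linarith
        finally show ?case by (simp add: dist_real_def)
      qed
    qed
    from tendsto_add[OF this L] show ?thesis by simp
  qed
  show "(\<lambda>n. \<integral>\<pi>. cos (t \<bullet> X n \<pi>) \<partial>perm_model f n 0) \<longlonglongrightarrow> (\<integral>x. cos (t \<bullet> x) \<partial>\<nu>)" for t
    unfolding integral_perm_model_0 cos\<nu>
    by (rule trig[OF _ _ limit_stat_trig(1)]) (auto intro: abs_cos_diff_le)
  show "(\<lambda>n. \<integral>\<pi>. sin (t \<bullet> X n \<pi>) \<partial>perm_model f n 0) \<longlonglongrightarrow> (\<integral>x. sin (t \<bullet> x) \<partial>\<nu>)" for t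
    unfolding integral_perm_model_0 sin\<nu>
    by (rule trig[OF _ _ limit_stat_trig(2)]) (auto intro: abs_sin_diff_le)
  fix e :: real assume e: "e > 0"
  obtain c where c: "c > 0" "\<And>d. c * (norm d)\<^sup>2 \<le> d \<bullet> (Gamma_mat f *v d)"
    using Gamma_lower_bound by blast
  obtain R where R0: "R > 0"
    and tail: "\<And>n. n \<ge> 4 \<Longrightarrow> perm_avg n (\<lambda>\<pi>. if norm (fluct f n \<pi>) \<le> R then 0 else (1::real)) \<le> e / 4"
    using fluct_tail[of "e / 4"] e by auto
  let ?bad = "\<lambda>n \<pi>. if norm (X n \<pi> - limit_stat n \<pi>) < 1 then 0 else (1::real)"
  have "\<forall>\<^sub>F n in sequentially. perm_avg n (?bad n) < e / 2"
    using e by (intro order_tendstoD(2)[OF lin]) auto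
  then have "\<forall>\<^sub>F n in sequentially. measure (perm_model f n 0) {\<pi> \<in> space (perm_model f n 0). norm (X n \<pi>) > R / c + 1} < e"
    using eventually_ge_at_top[of 4]
  proof eventually_elim
    case (elim n)
    let ?far = "\<lambda>\<pi>. if norm (fluct f n \<pi>) \<le> R then 0 else (1::real)"
    have "perm_avg n (\<lambda>\<pi>. if norm (X n \<pi>) > R / c + 1 then 1 else (0::real)) \<le> perm_avg n (\<lambda>\<pi>. ?bad n \<pi> + ?far \<pi>)"
    proof (rule perm_avg_mono)
      fix \<pi>
      have "norm (X n \<pi>) \<le> R / c + 1" if "norm (fluct f n \<pi>) \<le> R" "norm (X n \<pi> - limit_stat n \<pi>) < 1"
      proof -
        have "norm (limit_stat n \<pi>) \<le> norm (fluct f n \<pi>) / c" by (rule Gamma_inv_norm[OF c])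
        also have "\<dots> \<le> R / c" using that(1) c(1) by (intro divide_right_mono) auto
        finally show ?thesis using that(2) norm_triangle_sub[of "X n \<pi>" "limit_stat n \<pi>"] by linarith
      qed
      then show "(if norm (X n \<pi>) > R / c + 1 then 1 else (0::real)) \<le> ?bad n \<pi> + ?far \<pi>" by auto
    qed
    also have "\<dots> = perm_avg n (?bad n) + perm_avg n ?far" by (rule perm_avg_add)
    also have "\<dots> < e" using elim(1) tail[OF elim(2)] e by linarith
    finally show ?case unfolding measure_perm_model_0 .
  qed
  then show "\<exists>K. \<forall>\<^sub>F n in sequentially. measure (perm_model f n 0) {\<pi> \<in> space (perm_model f n 0). norm (X n \<pi>) > K} < e"
    by blast
qed

lemma gaussian_limit_exists:
  obtains \<nu> :: "(real ^ 'l) measure" where "prob_space \<nu>" "sets \<nu> = sets borel"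
    "\<And>t. (\<integral>x. cos (t \<bullet> x) \<partial>\<nu>) = exp (- (t \<bullet> (Gamma_inv *v t)) / 2)" "\<And>t. (\<integral>x. sin (t \<bullet> x) \<partial>\<nu>) = 0"
proof (rule gaussian_measure_exists)
  show "bilinear (\<lambda>x y. x \<bullet> (Gamma_inv *v y))"
    by (auto simp: bilinear_def matrix_vector_right_distrib matrix_vector_mult_scaleR inner_add_left inner_add_right intro!: linearI)
qed (use Gamma_inv_symmetric Gamma_inv_nonneg that in auto)

end

theorem corollary1p8:
  fixes f :: "real \<times> real \<Rightarrow> real ^ 'l"
    and est_ML est_PL :: "nat \<Rightarrow> (nat \<Rightarrow> nat) \<Rightarrow> real ^ 'l"
  assumes "\<And>r. (\<lambda>z. f z $ r) \<in> class_C"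
    and "lin_indep f"
    and "root_estimator (is_root_ML f) est_ML"
    and "root_estimator (is_root_PL f) est_PL"
  shows "invertible (A_mat f 0) \<and> invertible (Gamma_mat f)
     \<and> matrix_inv (A_mat f 0) ** Sigma_mat f 0 ** matrix_inv (A_mat f 0) = matrix_inv (Gamma_mat f)
     \<and> (\<exists>\<nu>. prob_space \<nu> \<and> sets \<nu> = sets borel
          \<and> conv_in_distr (\<lambda>n. perm_model f n 0) (\<lambda>n \<pi>. sqrt (real n) *\<^sub>R est_PL n \<pi>) \<nu>
          \<and> conv_in_distr (\<lambda>n. perm_model f n 0) (\<lambda>n \<pi>. sqrt (real n) *\<^sub>R est_ML n \<pi>) \<nu>)"
proof -
  interpret permuton_family f by unfold_locales (rule assms)+
  obtain \<nu> :: "(real ^ 'l) measure" where \<nu>: "prob_space \<nu>" "sets \<nu> = sets borel"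
    "\<And>t. (\<integral>x. cos (t \<bullet> x) \<partial>\<nu>) = exp (- (t \<bullet> (matrix_inv (Gamma_mat f) *v t)) / 2)"
    "\<And>t. (\<integral>x. sin (t \<bullet> x) \<partial>\<nu>) = 0"
    using gaussian_limit_exists by blast
  note joint = estimators_linearised[OF assms(3,4)]
  have conv: "conv_in_distr (\<lambda>n. perm_model f n 0) X \<nu>"
    if X: "\<And>n \<pi> r. near est_ML r n \<pi> \<Longrightarrow>
      near est_PL r n \<pi> \<Longrightarrow> norm (X n \<pi> - limit_stat n \<pi>) < r" for X
  proof (rule conv_in_distr_of_linearised[OF _ \<nu>])
    fix r :: real assume "r > 0"
    show "(\<lambda>n. perm_avg n (\<lambda>\<pi>. if norm (X n \<pi> - limit_stat n \<pi>) < r then 0 else (1::real))) \<longlonglongrightarrow> 0"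
    proof (rule tendsto_sandwich[OF _ _ tendsto_const joint[OF \<open>r > 0\<close>]])
      show "\<forall>\<^sub>F n in sequentially. 0 \<le> perm_avg n (\<lambda>\<pi>. if norm (X n \<pi> - limit_stat n \<pi>) < r then 0 else (1::real))"
        by (intro always_eventually allI perm_avg_nonneg) simp
      show "\<forall>\<^sub>F n in sequentially. perm_avg n (\<lambda>\<pi>. if norm (X n \<pi> - limit_stat n \<pi>) < r then 0 else (1::real))
        \<le> perm_avg n (\<lambda>\<pi>. if near est_ML r n \<pi> \<and> near est_PL r n \<pi> then 0 else (1::real))"
        using X by (intro always_eventually allI perm_avg_mono) auto
    qed
  qed
  have "conv_in_distr (\<lambda>n. perm_model f n 0) (\<lambda>n \<pi>. sqrt (real n) *\<^sub>R est_PL n \<pi>) \<nu>"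
    by (rule conv)
  moreover have "conv_in_distr (\<lambda>n. perm_model f n 0) (\<lambda>n \<pi>. sqrt (real n) *\<^sub>R est_ML n \<pi>) \<nu>"
    by (rule conv)
  ultimately show ?thesis
    using \<nu>(1,2) sandwich_identity invertible_Gamma by blast
qed

end
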